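(* Let $G=(V,E)$ be a simple, unweighted, connected undirected graph and let $k$ be a parameter with $k \le |E|$. There is a polynomial time algorithm that does each of the following: (1) For any $\epsilon > 1/k$, it finds a set $S \subseteq V$ with $\phi(S) = O\big(\sqrt{\phi_k(G)/\epsilon}\big)$ and $\mathrm{vol}(S) \le k^{1+\epsilon}$. (2) For any $\epsilon > 2\ln k / k$, it finds a set $S \subseteq V$ with $\phi(S) = O\big(\sqrt{\phi_k(G)\log k/\epsilon}\big)$ and $\mathrm{vol}(S) \le (1+\epsilon)k$. Here the constants hidden in $O(\cdot)$ are absolute.
   Context: For $v \in V$, $d(v)$ denotes the degree of $v$. For $S \subseteq V$, $\mathrm{vol}(S) = \sum_{v\in S} d(v)$, $\delta(S)$ is the set of edges with exactly one endpoint in $S$, and the conductance of $S$ is $\phi(S) = |\delta(S)|/\mathrm{vol}(S)$. For a parameter $k$, $\phi_k(G) = \min_{S \subseteq V,\, S\neq\emptyset,\, \mathrm{vol}(S) \le k} \phi(S)$.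
   Formalization: The hidden constants are absolute only for bounded ε: they may depend on an upper bound for ε (for unbounded ε the claim fails on expanders). Part (2) takes k ≥ 2 (at k = 1 it fails). k is an integer, ε is a rational input, and some nonempty set of volume at most k is assumed to exist. *)

theory Defs
  imports Complex_Main "HOL-Library.Log_Nat" "HOL-Computational_Algebra.Polynomial"
begin

section \<open>Graphs, volume, conductance\<close>

text \<open>Edges are two-element sets of vertices, so there are neither loops nor parallel edges.\<close>

definition simple_graph :: "'a set \<Rightarrow> 'a set set \<Rightarrow> bool" where
  "simple_graph V E \<longleftrightarrow>
     finite V \<and> V \<noteq> {} \<and> (\<forall>e\<in>E. \<exists>u\<in>V. \<exists>v\<in>V. u \<noteq> v \<and> e = {u, v})"

definition connected_graph :: "'a set \<Rightarrow> 'a set set \<Rightarrow> bool" where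
  "connected_graph V E \<longleftrightarrow> (\<forall>u\<in>V. \<forall>v\<in>V. (u, v) \<in> {(x, y). {x, y} \<in> E}\<^sup>*)"

definition deg :: "'a set set \<Rightarrow> 'a \<Rightarrow> nat" where
  "deg E v = card {e \<in> E. v \<in> e}"

definition vol :: "'a set set \<Rightarrow> 'a set \<Rightarrow> nat" where
  "vol E S = (\<Sum>v\<in>S. deg E v)"

definition edge_boundary :: "'a set set \<Rightarrow> 'a set \<Rightarrow> 'a set set" where
  "edge_boundary E S = {e \<in> E. \<exists>!v. v \<in> e \<and> v \<in> S}"

definition conductance :: "'a set set \<Rightarrow> 'a set \<Rightarrow> real" where
  "conductance E S = real (card (edge_boundary E S)) / real (vol E S)"

definition small_sets :: "'a set \<Rightarrow> 'a set set \<Rightarrow> nat \<Rightarrow> 'a set set" where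
  "small_sets V E k = {S. S \<subseteq> V \<and> S \<noteq> {} \<and> vol E S \<le> k}"

text \<open>\<open>small_conductance V E k\<close> is $\phi_k(G)$; it is meaningful only if
  \<open>small_sets V E k\<close> is nonempty.\<close>

definition small_conductance :: "'a set \<Rightarrow> 'a set set \<Rightarrow> nat \<Rightarrow> real" where
  "small_conductance V E k = Min (conductance E ` small_sets V E k)"


section \<open>Algorithms and their running time\<close>

text \<open>
  Algorithms are programs of a structured random access machine with the logarithmic cost
  measure: the store consists of named arrays of natural numbers of unbounded length
  (a scalar variable is an array used at index 0), and each operation costs at least
  the number of binary digits of its operands. Hence running time agrees with
  Turing machine time up to a polynomial. There is no randomness and no oracle.
\<close>

type_synonym vname = string

type_synonym store = "vname \<Rightarrow> nat \<Rightarrow> nat"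

datatype expr =
    Num nat
  | Cell vname expr
  | Plus expr expr
  | Minus expr expr
  | Times expr expr
  | Quot expr expr

datatype prog =
    Skip
  | Assign vname expr expr  \<comment> \<open>\<open>Assign x i e\<close> is \<open>x[i] := e\<close>\<close>
  | Seq prog prog
  | If expr prog prog
  | While expr prog

text \<open>Subtraction is truncated, division is \<open>div\<close> (with \<open>n div 0 = 0\<close>).\<close>

primrec val :: "expr \<Rightarrow> store \<Rightarrow> nat" where
  "val (Num n) s = n"
| "val (Cell x i) s = s x (val i s)"
| "val (Plus a b) s = val a s + val b s"
| "val (Minus a b) s = val a s - val b s"
| "val (Times a b) s = val a s * val b s"
| "val (Quot a b) s = val a s div val b s"

abbreviation len :: "nat \<Rightarrow> nat" where
  "len n \<equiv> floorlog 2 n"  \<comment> \<open>number of binary digits\<close>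

primrec cost :: "expr \<Rightarrow> store \<Rightarrow> nat" where
  "cost (Num n) s = 1 + len n"
| "cost (Cell x i) s = 1 + cost i s + len (val i s) + len (s x (val i s))"
| "cost (Plus a b) s = 1 + cost a s + cost b s + len (val a s) + len (val b s)"
| "cost (Minus a b) s = 1 + cost a s + cost b s + len (val a s) + len (val b s)"
| "cost (Times a b) s = 1 + cost a s + cost b s + len (val a s) + len (val b s)"
| "cost (Quot a b) s = 1 + cost a s + cost b s + len (val a s) + len (val b s)"

text \<open>\<open>exec c s T t\<close>: started in store \<open>s\<close>, program \<open>c\<close> halts after time \<open>T\<close> in store \<open>t\<close>.
  A condition holds if its value is nonzero.\<close>

inductive exec :: "prog \<Rightarrow> store \<Rightarrow> nat \<Rightarrow> store \<Rightarrow> bool" where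
  Skip: "exec Skip s 1 s"
| Assign: "exec (Assign x i e) s (1 + cost i s + cost e s)
             (s(x := (s x)(val i s := val e s)))"
| Seq: "exec c1 s T1 s1 \<Longrightarrow> exec c2 s1 T2 s2 \<Longrightarrow> exec (Seq c1 c2) s (1 + T1 + T2) s2"
| IfTrue: "val b s \<noteq> 0 \<Longrightarrow> exec c1 s T t \<Longrightarrow> exec (If b c1 c2) s (1 + cost b s + T) t"
| IfFalse: "val b s = 0 \<Longrightarrow> exec c2 s T t \<Longrightarrow> exec (If b c1 c2) s (1 + cost b s + T) t"
| WhileFalse: "val b s = 0 \<Longrightarrow> exec (While b c) s (1 + cost b s) s"
| WhileTrue: "val b s \<noteq> 0 \<Longrightarrow> exec c s T1 s1 \<Longrightarrow> exec (While b c) s1 T2 s2 \<Longrightarrow>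
    exec (While b c) s (1 + cost b s + T1 + T2) s2"

inductive_cases exec_cases:
  "exec Skip s T t"
  "exec (Assign x i e) s T t"
  "exec (Seq c1 c2) s T t"
  "exec (If b c1 c2) s T t"
  "exec (While b c) s T t"

lemma exec_deterministic:
  "exec c s T t \<Longrightarrow> exec c s T' t' \<Longrightarrow> T' = T \<and> t' = t"
proof (induction arbitrary: T' t' rule: exec.induct)
  case (Skip s)
  then show ?case by (auto elim: exec_cases)
next
  case (Assign x i e s)
  then show ?case by (auto elim: exec_cases)
next
  case (Seq c1 s T1 s1 c2 T2 s2)
  from Seq.prems obtain U1 u1 U2 where
    "exec c1 s U1 u1" "exec c2 u1 U2 t'" "T' = 1 + U1 + U2"
    by (auto elim: exec_cases)
  with Seq.IH show ?case by metis
next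
  case (IfTrue b s c1 T t c2)
  from IfTrue.prems IfTrue.hyps obtain U where
    "exec c1 s U t'" "T' = 1 + cost b s + U"
    by (auto elim: exec_cases)
  with IfTrue.IH show ?case by metis
next
  case (IfFalse b s c2 T t c1)
  from IfFalse.prems IfFalse.hyps obtain U where
    "exec c2 s U t'" "T' = 1 + cost b s + U"
    by (auto elim: exec_cases)
  with IfFalse.IH show ?case by metis
next
  case (WhileFalse b s c)
  from WhileFalse.prems WhileFalse.hyps show ?case by (auto elim: exec_cases)
next
  case (WhileTrue b s c T1 s1 T2 s2)
  from WhileTrue.prems WhileTrue.hyps(1) obtain U1 u1 U2 where
    "exec c s U1 u1" "exec (While b c) u1 U2 t'" "T' = 1 + cost b s + U1 + U2"
    by (auto elim: exec_cases)
  with WhileTrue.IH show ?case by metis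
qed


section \<open>Inputs and outputs\<close>

text \<open>
  An input consists of a graph on the vertex set \<open>{..<n}\<close>, given by its adjacency matrix in
  row-major order, the number \<open>k\<close>, and the rational number \<open>\<epsilon> = p / q\<close>. All other cells
  are initially 0.
\<close>

definition input_store :: "nat \<Rightarrow> nat set set \<Rightarrow> nat \<Rightarrow> nat \<Rightarrow> nat \<Rightarrow> store" where
  "input_store n E k p q = (\<lambda>x i.
     if x = ''adj'' then (if i < n * n \<and> {i div n, i mod n} \<in> E then 1 else 0)
     else if i \<noteq> 0 then 0
     else if x = ''n'' then n
     else if x = ''k'' then k
     else if x = ''p'' then p
     else if x = ''q'' then q
     else 0)"

definition input_size :: "nat \<Rightarrow> nat \<Rightarrow> nat \<Rightarrow> nat \<Rightarrow> nat" where
  "input_size n k p q = n * n + len n + len k + len p + len q"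

definition output_set :: "nat \<Rightarrow> store \<Rightarrow> nat set" where
  "output_set n t = {v. v < n \<and> t ''S'' v \<noteq> 0}"

end

theory Submission
  imports Defs
begin

text \<open>
  The algorithm runs the lazy random walk from every vertex \<open>v\<close> for up to \<open>k\<^sup>2\<close> steps and returns
  the sparsest level set of the density \<open>p\<^sub>t(u) / d(u)\<close> whose volume is at most the allowed bound \<open>K\<close>.

  Suppose that all these sets have conductance at least \<open>\<phi>\<close>. By the argument of Lovasz and
  Simonovits a set of volume \<open>x\<close> has mass at most \<open>x / K + (1 - \<phi>\<^sup>2 / 8)\<^sup>t \<surd>x\<close> after \<open>t\<close> steps.
  On the other hand, an optimal set of volume at most \<open>k\<close> and conductance \<open>\<theta>\<close> contains a vertex from
  which the walk stays inside with probability at least \<open>(1 - \<theta> / 2)\<^sup>t\<close>. For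
  \<open>t \<approx> ln (K / k) / (2 \<theta>)\<close> the two bounds give \<open>\<phi>\<^sup>2 = O(\<theta> ln k / ln (K / k))\<close>. Both parts follow
  with \<open>K = k powr (1 + \<epsilon>)\<close> and \<open>K = (1 + \<epsilon>) k\<close>.

  The program stays within the integers by scaling the density with \<open>2 n!\<close> in each step, which
  clears all denominators and keeps the numbers at polynomial length. To compare integers with
  \<open>k powr (1 + \<epsilon>)\<close> in polynomial time, \<open>\<epsilon>\<close> is first rounded down to \<open>m / k\<close> with \<open>1 \<le> m \<le> k\<close>; as
  \<open>\<epsilon> > 1 / k\<close>, this loses only a constant factor.
\<close>

section \<open>Random walks on weighted graphs\<close>

text \<open>The assumption \<open>k \<le> card E\<close> acts twice. A set of volume at most |E| is
  not all of V, so connectivity gives it a boundary edge; the optimal conductance \<theta> is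
  therefore at least 1 / k, and a walk of length about ln (K / k) / (2 \<theta>) fits into k^2
  steps. Moreover k <= |E| <= n^2, so a running time polynomial in the value of k is polynomial in
  the input size. Write l = ln (K / k). The two estimates of the mass on the optimal set leave a gap
  of exp (- l / 2) - exp (- l), which is of order l for small l. The argument takes its logarithm,
  and this costs O(ln k) only if l is at least a constant multiple of 1 / k: here the lower bounds
  on \<epsilon> enter a second time. In the other direction l is kept at most ln k, so that the
  exponent - l is also absorbed by O(ln k). For \<epsilon> > 1 the analysis therefore works with the
  threshold belonging to \<epsilon> = 1, and the ratio of the two values goes into the constant as
  \<open>max 1 \<epsilon>max\<close>.\<close>

lemma sqrt_concave:
  fixes x y m :: real
  assumes "0 \<le> x" "0 \<le> y" "0 \<le> m" "m \<le> 1"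
  shows "(1 - m) * sqrt x + m * sqrt y \<le> sqrt ((1 - m) * x + m * y)"
proof (rule real_le_rsqrt)
  define p q where "p = sqrt x" and "q = sqrt y"
  have pq: "x = p\<^sup>2" "y = q\<^sup>2" using assms by (auto simp: p_def q_def)
  have "(1 - m) * x + m * y - ((1 - m) * p + m * q)\<^sup>2 = (1 - m) * m * (p - q)\<^sup>2"
    unfolding pq by (simp add: power2_eq_square algebra_simps)
  moreover have "0 \<le> (1 - m) * m * (p - q)\<^sup>2" using assms by simp
  ultimately show "((1 - m) * sqrt x + m * sqrt y)\<^sup>2 \<le> (1 - m) * x + m * y"
    unfolding p_def q_def by linarith
qed

text \<open>Squaring leaves (1 + sqrt (1 - r^2)) / 2, which is at most 1 - r^2 / 4 and hence at most
  (1 - r^2 / 8)^2. With r the conductance of a level set, this is the factor by which one step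
  contracts the square-root term of the upper bound.\<close>

lemma sqrt_mean_le:
  fixes r :: real
  assumes "0 \<le> r" "r \<le> 1"
  shows "(sqrt (1 - r) + sqrt (1 + r)) / 2 \<le> 1 - r\<^sup>2 / 8"
proof (rule power2_le_imp_le)
  have r2: "r\<^sup>2 \<le> 1" using assms by (simp add: power_le_one)
  have "sqrt (1 - r\<^sup>2) \<le> 1 - r\<^sup>2 / 2"
    using r2 by (intro real_le_lsqrt) (auto simp: power2_diff power_divide)
  moreover have "sqrt (1 - r) * sqrt (1 + r) = sqrt (1 - r\<^sup>2)"
    by (simp add: real_sqrt_mult[symmetric] power2_eq_square algebra_simps)
  moreover have "((sqrt (1 - r) + sqrt (1 + r)) / 2)\<^sup>2 = (2 + 2 * (sqrt (1 - r) * sqrt (1 + r))) / 4"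
    using assms by (simp add: power_divide power2_sum)
  moreover have "(1 - r\<^sup>2 / 8)\<^sup>2 = 1 - r\<^sup>2 / 4 + (r\<^sup>2 / 8)\<^sup>2"
    by (simp add: power2_diff)
  moreover have "0 \<le> (r\<^sup>2 / 8)\<^sup>2" by simp
  ultimately show "((sqrt (1 - r) + sqrt (1 + r)) / 2)\<^sup>2 \<le> (1 - r\<^sup>2 / 8)\<^sup>2" by argo
  show "0 \<le> 1 - r\<^sup>2 / 8" using r2 by simp
qed

text \<open>Log-convexity makes the ratio of consecutive terms nondecreasing, so the first ratio
  bounds all later ones. Positivity is carried along in the induction because \<open>b i\<close> has
  to be cancelled.\<close>

lemma log_convex_ratio:
  fixes b :: "nat \<Rightarrow> real"
  assumes nn: "\<And>i. 0 \<le> b i" and lc: "\<And>i. (b (Suc i))\<^sup>2 \<le> b i * b (Suc (Suc i))"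
    and b0: "0 < b 0" and r: "0 < r" "r * b 0 \<le> b 1"
  shows "r ^ i * b 0 \<le> b i"
proof -
  have "r * b i \<le> b (Suc i) \<and> 0 < b i" for i
  proof (induction i)
    case 0
    then show ?case using b0 r by simp
  next
    case (Suc i)
    then have p: "0 < b (Suc i)" using r by (meson less_le_trans mult_pos_pos)
    have "(r * b i) * b (Suc i) \<le> b (Suc i) * b (Suc i)" using Suc p by (intro mult_right_mono) auto
    also have "\<dots> \<le> b i * b (Suc (Suc i))" using lc[of i] by (simp add: power2_eq_square)
    finally have "b i * (r * b (Suc i)) \<le> b i * b (Suc (Suc i))" by (simp add: mult_ac)
    then show ?case using Suc p by simp
  qed
  note key = this
  show ?thesis
  proof (induction i)
    case (Suc i)
    have "r ^ Suc i * b 0 = r * (r ^ i * b 0)" by simp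
    also have "\<dots> \<le> r * b i" using Suc r by (intro mult_left_mono) auto
    also have "\<dots> \<le> b (Suc i)" using key by blast
    finally show ?case .
  qed simp
qed

text \<open>The value 1 / (1 + x) lies between both sides on the unit interval. This turns the
  probability (1 - \<theta> / 2)^t of staying in the optimal set into exp (- \<theta> t).\<close>

lemma one_minus_half_ge_exp:
  fixes x :: real
  assumes "0 \<le> x" "x \<le> 1"
  shows "exp (- x) \<le> 1 - x / 2"
proof -
  have "1 + x \<le> exp x" by simp
  then have "exp (- x) \<le> inverse (1 + x)"
    unfolding exp_minus using assms by (intro le_imp_inverse_le) auto
  also have "inverse (1 + x) \<le> 1 - x / 2"
  proof -
    have "1 \<le> (1 - x / 2) * (1 + x)" using assms mult_right_mono[of x 1 x] by (simp add: algebra_simps)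
    then show ?thesis using assms by (simp add: inverse_eq_divide divide_le_eq)
  qed
  finally show ?thesis .
qed

text \<open>Degrees are required to be at least 1, not just positive: at time 0 a fractional set
  \<open>w\<close> has mass \<open>w v\<close>, which is compared with the square root of a volume
  that contains \<open>w v * d v\<close>.\<close>

locale weighted_graph =
  fixes V :: "'a set" and a :: "'a \<Rightarrow> 'a \<Rightarrow> real"
  assumes finite_V: "finite V"
    and sym: "a u w = a w u"
    and nonneg: "0 \<le> a u w"
    and deg_ge_1: "u \<in> V \<Longrightarrow> 1 \<le> (\<Sum>w\<in>V. a u w)"
begin

definition d :: "'a \<Rightarrow> real" where
  "d u = (\<Sum>w\<in>V. a u w)"

definition wvol :: "'a set \<Rightarrow> real" where
  "wvol S = (\<Sum>u\<in>S. d u)"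

definition cut :: "'a set \<Rightarrow> real" where
  "cut S = (\<Sum>u\<in>S. \<Sum>w\<in>V - S. a u w)"

text \<open>Functions on \<open>V\<close> are densities p(u) / d(u), so this is the operator (I +
  D^-1 A) / 2. On densities a step is an average: it fixes constants and is self-adjoint for the
  degree-weighted product \<open>ip\<close>, and \<open>ip (\<lambda>_. 1) f\<close> is the total
  mass.\<close>

definition lazy :: "('a \<Rightarrow> real) \<Rightarrow> 'a \<Rightarrow> real" where
  "lazy f u = (f u + (\<Sum>w\<in>V. a u w * f w) / d u) / 2"

definition level :: "('a \<Rightarrow> real) \<Rightarrow> 'a \<Rightarrow> 'a set" where
  "level f u = {w \<in> V. f u \<le> f w}"

definition ip :: "('a \<Rightarrow> real) \<Rightarrow> ('a \<Rightarrow> real) \<Rightarrow> real" where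
  "ip f g = (\<Sum>u\<in>V. d u * f u * g u)"

lemma d_ge_1: "u \<in> V \<Longrightarrow> 1 \<le> d u"
  using deg_ge_1 by (simp add: d_def)

lemma d_pos: "u \<in> V \<Longrightarrow> 0 < d u"
  using d_ge_1[of u] by linarith

lemma finite_subV: "S \<subseteq> V \<Longrightarrow> finite S"
  using finite_V finite_subset by blast

lemma wvol_nonneg: "S \<subseteq> V \<Longrightarrow> 0 \<le> wvol S"
  unfolding wvol_def using d_pos by (intro sum_nonneg) (auto intro: less_imp_le)

lemma cut_nonneg: "0 \<le> cut S"
  unfolding cut_def by (intro sum_nonneg nonneg)

lemma sum_split_cut:
  assumes "S \<subseteq> V"
  shows "(\<Sum>u\<in>S. \<Sum>w\<in>S. a u w) = wvol S - cut S"
proof -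
  have "wvol S = (\<Sum>u\<in>S. (\<Sum>w\<in>S. a u w) + (\<Sum>w\<in>V - S. a u w))"
    unfolding wvol_def d_def
    using sum.subset_diff[OF assms finite_V] by (intro sum.cong) (auto simp: add.commute)
  then show ?thesis by (simp add: cut_def sum.distrib)
qed

lemma cut_le_wvol: "S \<subseteq> V \<Longrightarrow> cut S \<le> wvol S"
  using sum_split_cut[of S] sum_nonneg[of S "\<lambda>u. \<Sum>w\<in>S. a u w"]
  by (simp add: sum_nonneg nonneg)

lemma sum_outside: "(\<Sum>u\<in>V - S. \<Sum>w\<in>S. a u w) = cut S"
  unfolding cut_def by (subst sum.swap) (simp add: sym[of _ _])

lemma lazy_mono: "(\<And>u. u \<in> V \<Longrightarrow> f u \<le> g u) \<Longrightarrow> u \<in> V \<Longrightarrow> lazy f u \<le> lazy g u"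
  unfolding lazy_def using d_pos[of u]
  by (intro divide_right_mono add_mono sum_mono mult_left_mono nonneg) auto

lemma lazy_nonneg: "(\<And>u. u \<in> V \<Longrightarrow> 0 \<le> f u) \<Longrightarrow> u \<in> V \<Longrightarrow> 0 \<le> lazy f u"
  unfolding lazy_def using d_pos[of u] nonneg by (auto intro!: add_nonneg_nonneg sum_nonneg divide_nonneg_nonneg)

lemma d_lazy: "u \<in> V \<Longrightarrow> d u * lazy f u = (d u * f u + (\<Sum>w\<in>V. a u w * f w)) / 2"
  using d_pos[of u] by (simp add: lazy_def field_simps)

lemma lazy_self_adjoint: "ip f (lazy g) = ip (lazy f) g"
proof -
  have eq: "ip f (lazy g) = (ip f g + (\<Sum>u\<in>V. \<Sum>w\<in>V. a u w * f u * g w)) / 2" for f g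
  proof -
    have "ip f (lazy g) = (\<Sum>u\<in>V. f u * (d u * lazy g u))"
      unfolding ip_def by (simp add: mult_ac)
    also have "\<dots> = (\<Sum>u\<in>V. (d u * f u * g u + (\<Sum>w\<in>V. a u w * f u * g w)) / 2)"
      by (intro sum.cong refl) (simp add: d_lazy algebra_simps sum_distrib_left)
    finally show ?thesis by (simp add: ip_def sum.distrib sum_divide_distrib[symmetric])
  qed
  have com: "ip f g = ip g f" for f g by (simp add: ip_def mult_ac)
  have "(\<Sum>u\<in>V. \<Sum>w\<in>V. a u w * f u * g w) = (\<Sum>u\<in>V. \<Sum>w\<in>V. a u w * g u * f w)"
    by (subst sum.swap) (simp add: sym mult_ac)
  then show ?thesis using eq[of f g] eq[of g f] com[of "lazy f" g] com[of f g] by simp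
qed

text \<open>Fractional sets \<open>w\<close> play the role of the Lovasz--Simonovits curve: its value at \<open>x\<close> is the
  maximal mass of a \<open>w\<close> of volume \<open>x\<close>. By linear programming duality with multiplier \<open>\<theta>\<close> the
  maximum lies on the segment between the level sets \<open>f > \<theta>\<close> and \<open>f \<ge> \<theta>\<close>.\<close>

lemma fractional_mass_le:
  fixes f w :: "'a \<Rightarrow> real" and \<alpha> \<beta> :: real
  assumes pos: "0 \<le> \<beta>"
    and w: "\<And>u. u \<in> V \<Longrightarrow> 0 \<le> w u \<and> w u \<le> 1"
    and lev: "\<And>u. u \<in> V \<Longrightarrow>
      (\<Sum>z\<in>level f u. d z * f z) \<le> \<alpha> * wvol (level f u) + \<beta> * sqrt (wvol (level f u))"
  shows "(\<Sum>u\<in>V. w u * d u * f u) \<le> \<alpha> * (\<Sum>u\<in>V. w u * d u) + \<beta> * sqrt (\<Sum>u\<in>V. w u * d u)"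
proof -
  define x where "x = (\<Sum>u\<in>V. w u * d u)"
  define h where "h y = \<alpha> * y + \<beta> * sqrt y" for y
  have wd: "0 \<le> w u * d u" if "u \<in> V" for u using w d_pos that by (simp add: less_imp_le)
  have x0: "0 \<le> x" unfolding x_def using wd by (intro sum_nonneg)
  show ?thesis
  proof (cases "x = 0")
    case True
    then have "w u * d u = 0" if "u \<in> V" for u
      using that wd finite_V by (simp add: x_def sum_nonneg_eq_0_iff)
    then have "(\<Sum>u\<in>V. w u * d u * f u) = 0" by (intro sum.neutral) auto
    then show ?thesis using True by (simp add: x_def)
  next
    case False
    with x0 have xp: "0 < x" by simp
    then have ne: "V \<noteq> {}" by (auto simp: x_def)
    \<comment> \<open>The maximum of \<open>A\<close> is the largest threshold whose level set still
      has volume at least \<open>x\<close>. The smallest value of \<open>f\<close> always qualifies,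
      since its level set is \<open>V\<close>.\<close>
    define A where "A = {f u | u. u \<in> V \<and> x \<le> wvol (level f u)}"
    have finA: "finite A" using finite_V by (simp add: A_def)
    have "Min (f ` V) \<in> A"
    proof -
      have "Min (f ` V) \<in> f ` V" using finite_V ne by simp
      then obtain u where u: "u \<in> V" "f u = Min (f ` V)" by auto
      have "level f u = V" unfolding level_def u(2) using finite_V by auto
      moreover have "x \<le> wvol V" unfolding x_def wvol_def
        using w d_pos by (intro sum_mono) (auto intro!: mult_left_le_one_le less_imp_le)
      ultimately show ?thesis using u unfolding A_def by (intro CollectI exI[of _ u]) auto
    qed
    then have neA: "A \<noteq> {}" by blast
    define \<theta> where "\<theta> = Max A"
    have "\<theta> \<in> A" unfolding \<theta>_def using finA neA by simp
    then obtain u1 where u1: "u1 \<in> V" "f u1 = \<theta>" "x \<le> wvol (level f u1)" by (auto simp: A_def)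
    define S0 S1 where "S0 = {u \<in> V. \<theta> < f u}" and "S1 = level f u1"
    have sub: "S0 \<subseteq> S1" "S1 \<subseteq> V" by (auto simp: S0_def S1_def level_def u1)
    \<comment> \<open>If nonempty, \<open>S0\<close> is itself the level set at its minimal value,
      so \<open>lev\<close> applies to it, and maximality of \<open>\<theta>\<close> forces its
      volume below \<open>x\<close>.\<close>
    have S0: "wvol S0 < x \<and> (\<Sum>z\<in>S0. d z * f z) \<le> h (wvol S0)"
    proof (cases "S0 = {}")
      case True
      then show ?thesis using xp by (simp add: wvol_def h_def)
    next
      case False
      have finS0: "finite S0" by (simp add: S0_def finite_V)
      then have "Min (f ` S0) \<in> f ` S0" using False by simp
      then obtain u0 where u0: "u0 \<in> S0" "f u0 = Min (f ` S0)" by auto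
      have "S0 = level f u0"
      proof
        show "S0 \<subseteq> level f u0" unfolding level_def u0(2) using finS0 by (auto simp: S0_def)
        show "level f u0 \<subseteq> S0" using u0(1) by (auto simp: S0_def level_def)
      qed
      moreover have "wvol (level f u0) < x"
      proof (rule ccontr)
        assume "\<not> wvol (level f u0) < x"
        then have "f u0 \<in> A" using u0(1) by (auto simp: A_def S0_def)
        then have "f u0 \<le> \<theta>" unfolding \<theta>_def using finA by simp
        then show False using u0(1) by (simp add: S0_def)
      qed
      moreover have "u0 \<in> V" using u0(1) by (simp add: S0_def)
      ultimately show ?thesis using lev[of u0] by (simp add: h_def)
    qed
    have S1: "(\<Sum>z\<in>S1. d z * f z) \<le> h (wvol S1)" using lev[OF u1(1)] by (simp add: h_def S1_def)
    have diff: "(\<Sum>z\<in>S1. d z * f z) = (\<Sum>z\<in>S0. d z * f z) + \<theta> * (wvol S1 - wvol S0)"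
    proof -
      have fin: "finite S1" using sub finite_subV by blast
      have "(\<Sum>z\<in>S1 - S0. d z * f z) = (\<Sum>z\<in>S1 - S0. \<theta> * d z)"
        by (intro sum.cong) (auto simp: S1_def S0_def level_def u1)
      then show ?thesis
        using sum.subset_diff[OF sub(1) fin, of "\<lambda>z. d z * f z"] sum.subset_diff[OF sub(1) fin, of d]
        by (simp add: wvol_def sum_distrib_left)
    qed
    \<comment> \<open>After subtracting \<open>\<theta>\<close> from \<open>f\<close> the summands
      are nonnegative on \<open>S0\<close> and nonpositive elsewhere, so no \<open>w\<close> does
      better than the indicator of \<open>S0\<close>.\<close>
    have up: "(\<Sum>u\<in>V. w u * d u * f u) \<le> (\<Sum>z\<in>S0. d z * f z) + \<theta> * (x - wvol S0)"
    proof -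
      have "(\<Sum>u\<in>V. w u * d u * (f u - \<theta>)) \<le> (\<Sum>u\<in>V. if u \<in> S0 then d u * (f u - \<theta>) else 0)"
      proof (rule sum_mono)
        fix u assume u: "u \<in> V"
        show "w u * d u * (f u - \<theta>) \<le> (if u \<in> S0 then d u * (f u - \<theta>) else 0)"
        proof (cases "u \<in> S0")
          case True
          then have "0 \<le> d u * (f u - \<theta>)" using d_pos[OF u] by (simp add: S0_def)
          then have "w u * (d u * (f u - \<theta>)) \<le> d u * (f u - \<theta>)"
            using w[OF u] by (intro mult_left_le_one_le) auto
          then show ?thesis using True by (simp add: mult.assoc)
        next
          case False
          then have "f u - \<theta> \<le> 0" using u by (simp add: S0_def)
          then show ?thesis using False wd[OF u] by (simp add: mult_nonneg_nonpos)
        qed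
      qed
      also have "\<dots> = (\<Sum>u\<in>S0. d u * (f u - \<theta>))"
        using finite_V sub by (subst sum.inter_restrict[symmetric]) (auto intro: sum.cong simp: Int_absorb1)
      finally show ?thesis
        by (simp add: algebra_simps sum_subtractf sum_distrib_left x_def wvol_def)
    qed
    have lt: "wvol S0 < wvol S1" using S0 u1 by (simp add: S1_def)
    define m where "m = (x - wvol S0) / (wvol S1 - wvol S0)"
    have m: "0 \<le> m" "m \<le> 1" using S0 u1(3) lt by (auto simp: m_def S1_def)
    have mx: "m * (wvol S1 - wvol S0) = x - wvol S0" using lt by (simp add: m_def)
    have "(\<Sum>u\<in>V. w u * d u * f u) \<le> (1 - m) * (\<Sum>z\<in>S0. d z * f z) + m * (\<Sum>z\<in>S1. d z * f z)"
      using up unfolding diff mx[symmetric] by (simp add: algebra_simps)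
    also have "\<dots> \<le> (1 - m) * h (wvol S0) + m * h (wvol S1)"
      using S0 S1 m by (intro add_mono mult_left_mono) auto
    also have "\<dots> = \<alpha> * ((1 - m) * wvol S0 + m * wvol S1) + \<beta> * ((1 - m) * sqrt (wvol S0) + m * sqrt (wvol S1))"
      by (simp add: h_def algebra_simps)
    also have "\<dots> \<le> \<alpha> * ((1 - m) * wvol S0 + m * wvol S1) + \<beta> * sqrt ((1 - m) * wvol S0 + m * wvol S1)"
      using m sub wvol_nonneg[of S0] wvol_nonneg[of S1] pos
      by (intro add_left_mono mult_left_mono sqrt_concave) auto
    also have "(1 - m) * wvol S0 + m * wvol S1 = x" using mx by (simp add: algebra_simps)
    finally show ?thesis by (simp add: x_def)
  qed
qed

text \<open>Twice the new mass on \<open>S\<close> is the old mass on two fractional sets whose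
  volumes are \<open>wvol S\<close> minus and plus \<open>cut S\<close>. The linear terms average
  out, and only the square root feels the spread between the two volumes.\<close>

lemma lazy_mass_le:
  fixes f :: "'a \<Rightarrow> real" and \<alpha> \<beta> :: real
  assumes S: "S \<subseteq> V"
    and H: "\<And>w. (\<And>u. u \<in> V \<Longrightarrow> 0 \<le> w u \<and> w u \<le> 1) \<Longrightarrow>
      (\<Sum>u\<in>V. w u * d u * f u) \<le> \<alpha> * (\<Sum>u\<in>V. w u * d u) + \<beta> * sqrt (\<Sum>u\<in>V. w u * d u)"
  shows "(\<Sum>u\<in>S. d u * lazy f u) \<le>
    \<alpha> * wvol S + \<beta> * ((sqrt (wvol S - cut S) + sqrt (wvol S + cut S)) / 2)"
proof -
  define e where "e u = (\<Sum>w\<in>S. a u w)" for u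
  \<comment> \<open>The quotient \<open>e u / d u\<close> is the share of the edges at
    \<open>u\<close> that lead into \<open>S\<close>. The sum \<open>w1 + w2\<close> is the
    indicator of \<open>S\<close>, for the lazy half of the step, plus this share at every vertex,
    for the moving half; splitting it this way keeps both functions between 0 and 1.\<close>
  define w1 w2 where "w1 u = (if u \<in> S then e u / d u else 0)"
    and "w2 u = (if u \<in> S then 1 else e u / d u)" for u
  have e: "0 \<le> e u \<and> e u \<le> d u" for u
    unfolding e_def d_def using S finite_V by (auto intro!: sum_nonneg sum_mono2 nonneg)
  have W: "0 \<le> w1 u \<and> w1 u \<le> 1" "0 \<le> w2 u \<and> w2 u \<le> 1" if "u \<in> V" for u
    using e[of u] d_pos[OF that] by (auto simp: w1_def w2_def)
  have fS: "finite S" using S finite_subV by blast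
  have restr: "(\<Sum>u\<in>V. if u \<in> S then g u else 0) = (\<Sum>u\<in>S. g u)" for g :: "'a \<Rightarrow> real"
    using sum.inter_restrict[OF finite_V, of g S] S by (simp add: Int_absorb1)
  have v1: "(\<Sum>u\<in>V. w1 u * d u) = wvol S - cut S"
  proof -
    have "(\<Sum>u\<in>V. w1 u * d u) = (\<Sum>u\<in>V. if u \<in> S then e u else 0)"
      using d_pos by (intro sum.cong) (force simp: w1_def)+
    then show ?thesis using restr[of e] sum_split_cut[OF S] by (simp add: e_def)
  qed
  have v2: "(\<Sum>u\<in>V. w2 u * d u) = wvol S + cut S"
  proof -
    have "(\<Sum>u\<in>V. w2 u * d u) = (\<Sum>u\<in>V - S. w2 u * d u) + (\<Sum>u\<in>S. w2 u * d u)"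
      by (rule sum.subset_diff[OF S finite_V])
    also have "(\<Sum>u\<in>V - S. w2 u * d u) = (\<Sum>u\<in>V - S. e u)"
      using d_pos by (intro sum.cong) (force simp: w2_def)+
    also have "(\<Sum>u\<in>S. w2 u * d u) = wvol S" by (simp add: w2_def wvol_def)
    finally show ?thesis using sum_outside[of S] by (simp add: e_def)
  qed
  have "(\<Sum>u\<in>V. w1 u * d u * f u) + (\<Sum>u\<in>V. w2 u * d u * f u)
      = (\<Sum>u\<in>V. (if u \<in> S then d u * f u else 0) + e u * f u)"
    unfolding sum.distrib[symmetric] using d_pos
    by (intro sum.cong refl) (force simp: w1_def w2_def field_simps)
  also have "\<dots> = (\<Sum>u\<in>S. d u * f u) + (\<Sum>u\<in>V. e u * f u)"
    by (simp add: sum.distrib restr)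
  also have "(\<Sum>u\<in>V. e u * f u) = (\<Sum>u\<in>S. \<Sum>w\<in>V. a u w * f w)"
    unfolding e_def sum_distrib_right by (subst sum.swap) (simp add: sym)
  also have "(\<Sum>u\<in>S. d u * f u) + (\<Sum>u\<in>S. \<Sum>w\<in>V. a u w * f w) = 2 * (\<Sum>u\<in>S. d u * lazy f u)"
    unfolding sum.distrib[symmetric] sum_distrib_left
    using S by (intro sum.cong refl) (auto simp: d_lazy)
  finally have "2 * (\<Sum>u\<in>S. d u * lazy f u)
      = (\<Sum>u\<in>V. w1 u * d u * f u) + (\<Sum>u\<in>V. w2 u * d u * f u)" by simp
  also have "\<dots> \<le> (\<alpha> * (wvol S - cut S) + \<beta> * sqrt (wvol S - cut S))
      + (\<alpha> * (wvol S + cut S) + \<beta> * sqrt (wvol S + cut S))"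
    using H[of w1] H[of w2] W v1 v2 by (intro add_mono) auto
  finally show ?thesis by (simp add: field_simps)
qed

section \<open>The walk from a vertex and the upper bound on its mass\<close>

definition start :: "'a \<Rightarrow> 'a \<Rightarrow> real" where
  "start v u = (if u = v then 1 / d v else 0)"

definition walk :: "'a \<Rightarrow> nat \<Rightarrow> 'a \<Rightarrow> real" where
  "walk v t = (lazy ^^ t) (start v)"

lemma walk_0: "walk v 0 = start v" and walk_Suc: "walk v (Suc t) = lazy (walk v t)"
  by (simp_all add: walk_def)

lemma walk_nonneg: "v \<in> V \<Longrightarrow> u \<in> V \<Longrightarrow> 0 \<le> walk v t u"
proof (induction t arbitrary: u)
  case 0
  then show ?case using d_pos[of v] by (simp add: walk_0 start_def)
next
  case (Suc t)
  then show ?case by (simp add: walk_Suc lazy_nonneg)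
qed

lemma lazy_1: "u \<in> V \<Longrightarrow> lazy (\<lambda>_. 1) u = 1"
  using d_pos[of u] by (simp add: lazy_def d_def[symmetric])

lemma ip_start: "v \<in> V \<Longrightarrow> ip f (start v) = f v"
proof -
  assume v: "v \<in> V"
  have "ip f (start v) = (\<Sum>u\<in>V. if u = v then f v else 0)"
    unfolding ip_def using d_pos[OF v] by (intro sum.cong) (auto simp: start_def)
  then show ?thesis using v finite_V by simp
qed

lemma ip_cong: "(\<And>u. u \<in> V \<Longrightarrow> f u = f' u) \<Longrightarrow> (\<And>u. u \<in> V \<Longrightarrow> g u = g' u) \<Longrightarrow> ip f g = ip f' g'"
  unfolding ip_def by (intro sum.cong) auto

lemma walk_mass: "v \<in> V \<Longrightarrow> ip (\<lambda>_. 1) (walk v t) = 1"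
proof (induction t)
  case 0
  then show ?case by (simp add: walk_0 ip_start)
next
  case (Suc t)
  have "ip (\<lambda>_. 1) (walk v (Suc t)) = ip (lazy (\<lambda>_. 1)) (walk v t)"
    by (simp add: walk_Suc lazy_self_adjoint)
  also have "\<dots> = ip (\<lambda>_. 1) (walk v t)" by (intro ip_cong) (simp_all add: lazy_1)
  finally show ?case using Suc by simp
qed

text \<open>By \<open>fractional_mass_le\<close> only level sets of the newest density have to be
  checked in the induction. One of volume above \<open>K\<close> is settled by total mass 1, which
  is where the term x / K comes from. A smaller one has conductance at least \<open>\<phi>\<close>,
  and then \<open>lazy_mass_le\<close> and \<open>sqrt_mean_le\<close> contract the square-root
  term.\<close>

lemma walk_upper:
  fixes \<phi> K :: real
  assumes v: "v \<in> V" and K: "0 < K" and phi: "0 \<le> \<phi>" "\<phi> \<le> 1"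
    and exp: "\<And>s u. s \<le> t \<Longrightarrow> u \<in> V \<Longrightarrow> wvol (level (walk v s) u) \<le> K \<Longrightarrow>
      \<phi> * wvol (level (walk v s) u) \<le> cut (level (walk v s) u)"
    and w: "\<And>u. u \<in> V \<Longrightarrow> 0 \<le> w u \<and> w u \<le> 1"
  shows "(\<Sum>u\<in>V. w u * d u * walk v t u) \<le>
    1 / K * (\<Sum>u\<in>V. w u * d u) + (1 - \<phi>\<^sup>2 / 8) ^ t * sqrt (\<Sum>u\<in>V. w u * d u)"
  using exp w
proof (induction t arbitrary: w)
  case 0
  define x where "x = (\<Sum>u\<in>V. w u * d u)"
  have wd: "0 \<le> w u * d u" if "u \<in> V" for u using 0 d_pos that by (simp add: less_imp_le)
  have x0: "0 \<le> x" unfolding x_def using wd by (intro sum_nonneg)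
  have wv: "0 \<le> w v \<and> w v \<le> 1" using 0 v by blast
  have "(\<Sum>u\<in>V. w u * d u * walk v 0 u) = w v"
    using ip_start[OF v, of w] by (simp add: walk_0 ip_def mult_ac)
  also have "\<dots> \<le> sqrt (w v)" using wv by (intro real_le_rsqrt) (simp add: power2_eq_square mult_left_le_one_le)
  also have "w v \<le> w v * d v" using wv d_ge_1[OF v] mult_left_mono[of 1 "d v" "w v"] by simp
  then have "sqrt (w v) \<le> sqrt (w v * d v)" by simp
  also have "w v * d v \<le> x" unfolding x_def using finite_V v wd by (intro member_le_sum) auto
  then have "sqrt (w v * d v) \<le> sqrt x" by simp
  finally have "(\<Sum>u\<in>V. w u * d u * walk v 0 u) \<le> sqrt x" by simp
  also have "\<dots> \<le> 1 / K * x + sqrt x" using x0 K by simp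
  finally show ?case by (simp add: x_def)
next
  case (Suc t)
  define c where "c = 1 - \<phi>\<^sup>2 / 8"
  have "\<phi>\<^sup>2 \<le> 1" using phi by (simp add: power_le_one)
  then have c: "0 \<le> c" by (simp add: c_def)
  show ?case unfolding c_def[symmetric]
  proof (rule fractional_mass_le)
    show "0 \<le> c ^ Suc t" using c by simp
    show "0 \<le> w u \<and> w u \<le> 1" if "u \<in> V" for u using Suc.prems that by blast
    fix u assume u: "u \<in> V"
    define S where "S = level (walk v (Suc t)) u"
    have S: "S \<subseteq> V" by (auto simp: S_def level_def)
    have "u \<in> S" using u by (simp add: S_def level_def)
    then have "d u \<le> wvol S" unfolding wvol_def using S finite_subV d_pos
      by (intro member_le_sum) (auto intro: less_imp_le)
    then have vp: "0 < wvol S" using d_pos[OF u] by linarith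
    show "(\<Sum>z\<in>S. d z * walk v (Suc t) z) \<le> 1 / K * wvol S + c ^ Suc t * sqrt (wvol S)"
    proof (cases "wvol S \<le> K")
      case False
      have "(\<Sum>z\<in>S. d z * walk v (Suc t) z) \<le> ip (\<lambda>_. 1) (walk v (Suc t))"
        unfolding ip_def using S finite_V d_pos walk_nonneg[OF v]
        by (simp, intro sum_mono2) (auto intro!: mult_nonneg_nonneg intro: less_imp_le)
      also have "\<dots> = 1" by (rule walk_mass[OF v])
      also have "1 \<le> 1 / K * wvol S" using False K by simp
      also have "\<dots> \<le> 1 / K * wvol S + c ^ Suc t * sqrt (wvol S)" using c vp by simp
      finally show ?thesis .
    next
      case True
      define r where "r = cut S / wvol S"
      have rc: "cut S = r * wvol S" using vp by (simp add: r_def)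
      have r: "0 \<le> r" "r \<le> 1" using cut_nonneg cut_le_wvol[OF S] vp by (auto simp: r_def)
      have "\<phi> * wvol S \<le> cut S" using Suc.prems(1)[of "Suc t" u] u True by (simp add: S_def)
      then have "\<phi> \<le> r" using vp by (simp add: r_def field_simps)
      then have "\<phi>\<^sup>2 \<le> r\<^sup>2" using phi by (simp add: power_mono)
      then have rr: "(sqrt (1 - r) + sqrt (1 + r)) / 2 \<le> c" using sqrt_mean_le[OF r] by (simp add: c_def)
      have "(\<Sum>z\<in>S. d z * walk v (Suc t) z) \<le>
        1 / K * wvol S + c ^ t * ((sqrt (wvol S - cut S) + sqrt (wvol S + cut S)) / 2)"
        unfolding walk_Suc
      proof (rule lazy_mass_le[OF S])
        fix w' :: "'a \<Rightarrow> real" assume "\<And>u. u \<in> V \<Longrightarrow> 0 \<le> w' u \<and> w' u \<le> 1"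
        then show "(\<Sum>u\<in>V. w' u * d u * walk v t u) \<le>
          1 / K * (\<Sum>u\<in>V. w' u * d u) + c ^ t * sqrt (\<Sum>u\<in>V. w' u * d u)"
          unfolding c_def using Suc.prems(1) by (intro Suc.IH) auto
      qed
      also have "(sqrt (wvol S - cut S) + sqrt (wvol S + cut S)) / 2
          = (sqrt (1 - r) + sqrt (1 + r)) / 2 * sqrt (wvol S)"
      proof -
        have "wvol S - cut S = (1 - r) * wvol S" "wvol S + cut S = (1 + r) * wvol S"
          by (simp_all add: rc algebra_simps)
        then show ?thesis by (simp only: real_sqrt_mult) (simp add: field_simps)
      qed
      also have "1 / K * wvol S + c ^ t * ((sqrt (1 - r) + sqrt (1 + r)) / 2 * sqrt (wvol S))
          \<le> 1 / K * wvol S + c ^ t * (c * sqrt (wvol S))"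
        using rr c vp by (intro add_left_mono mult_left_mono mult_right_mono) auto
      finally show ?thesis by (simp add: mult_ac)
    qed
  qed
qed

section \<open>Probability of never leaving a set, and the lower bound on the mass kept\<close>

definition stay :: "'a set \<Rightarrow> nat \<Rightarrow> 'a \<Rightarrow> real" where
  "stay S t = ((\<lambda>f u. if u \<in> S then lazy f u else 0) ^^ t) (\<lambda>u. if u \<in> S then 1 else 0)"

lemma stay_0: "stay S 0 u = (if u \<in> S then 1 else 0)"
  and stay_Suc: "stay S (Suc t) u = (if u \<in> S then lazy (stay S t) u else 0)"
  by (simp_all add: stay_def)

lemma stay_outside: "u \<notin> S \<Longrightarrow> stay S t u = 0"
  by (cases t) (simp_all add: stay_0 stay_Suc)

lemma stay_nonneg: "u \<in> V \<Longrightarrow> 0 \<le> stay S t u"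
  by (induction t arbitrary: u) (auto simp: stay_0 stay_Suc lazy_nonneg)

lemma ip_stay: "ip (stay S i) (stay S (Suc j)) = ip (stay S i) (lazy (stay S j))"
  unfolding ip_def by (intro sum.cong) (auto simp: stay_Suc stay_outside)

lemma ip_commute: "ip f g = ip g f"
  by (simp add: ip_def mult_ac)

lemma ip_stay_shift: "ip (stay S i) (stay S (Suc j)) = ip (stay S (Suc i)) (stay S j)"
  by (metis ip_commute ip_stay lazy_self_adjoint)

text \<open>Truncation to \<open>S\<close> is invisible next to a factor supported on
  \<open>S\<close>, so self-adjointness moves steps from one factor to the other. The product
  depends on \<open>i + j\<close> only, like the moments of a self-adjoint operator.\<close>

lemma ip_stay_add: "ip (stay S i) (stay S j) = ip (stay S 0) (stay S (i + j))"
  by (induction i arbitrary: j) (simp_all add: ip_stay_shift[symmetric])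

text \<open>By duality the right-hand side is \<open>lazy\<close> iterated on the indicator of
  \<open>S\<close> and evaluated at \<open>v\<close>; killing the walk outside \<open>S\<close> can
  only lower this value.\<close>

lemma stay_le_walk: "v \<in> V \<Longrightarrow> stay S t v \<le> ip (stay S 0) (walk v t)"
proof -
  assume v: "v \<in> V"
  have "ip f (walk v t) = (lazy ^^ t) f v" for f
  proof (induction t arbitrary: f)
    case 0
    then show ?case using v by (simp add: walk_0 ip_start)
  next
    case (Suc t)
    show ?case using Suc[of "lazy f"] by (simp add: walk_Suc lazy_self_adjoint funpow_swap1)
  qed
  moreover have "stay S t u \<le> (lazy ^^ t) (stay S 0) u" if "u \<in> V" for u using that
  proof (induction t arbitrary: u)
    case (Suc t)
    have "0 \<le> lazy (stay S t) u" using Suc.prems by (intro lazy_nonneg stay_nonneg)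
    moreover have "lazy (stay S t) u \<le> lazy ((lazy ^^ t) (stay S 0)) u"
      using Suc by (intro lazy_mono)
    ultimately show ?case by (simp add: stay_Suc)
  qed simp
  ultimately show ?thesis using v by metis
qed

text \<open>Lagrange's identity: the double sum of weighted squares is twice the difference of the
  two sides.\<close>

lemma ip_Cauchy_Schwarz: "(ip f g)\<^sup>2 \<le> ip f f * ip g g"
proof -
  have "0 \<le> (\<Sum>u\<in>V. \<Sum>w\<in>V. d u * d w * (f u * g w - f w * g u)\<^sup>2)"
    using d_pos by (intro sum_nonneg mult_nonneg_nonneg) (auto intro: less_imp_le)
  also have "\<dots> = (\<Sum>u\<in>V. \<Sum>w\<in>V. (d u * f u * f u) * (d w * g w * g w)
      + (d u * g u * g u) * (d w * f w * f w) - 2 * ((d u * f u * g u) * (d w * f w * g w)))"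
    by (intro sum.cong refl) (simp add: power2_eq_square algebra_simps)
  also have "\<dots> = 2 * (ip f f * ip g g - (ip f g)\<^sup>2)"
    unfolding sum.distrib sum_subtractf sum_distrib_left[symmetric] sum_distrib_right[symmetric]
    by (simp add: ip_def power2_eq_square)
  finally show ?thesis by simp
qed

text \<open>The moments of the restricted walk are log-convex; restricting to even times, this is
  the plain Cauchy--Schwarz inequality and needs no positive semidefiniteness.\<close>

lemma walk_lower:
  assumes S: "S \<subseteq> V" "S \<noteq> {}"
  shows "\<exists>v\<in>S. (1 - cut S / wvol S / 2) ^ (2 * i) \<le> ip (stay S 0) (walk v (2 * i))"
proof -
  define m where "m j = ip (stay S 0) (stay S j)" for j
  have fS: "finite S" using S finite_subV by blast
  obtain u where u: "u \<in> S" using S by blast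
  have "d u \<le> wvol S" unfolding wvol_def using S u fS d_pos
    by (intro member_le_sum) (auto intro: less_imp_le)
  then have vp: "0 < wvol S" using d_pos[of u] u S by auto
  have restr: "(\<Sum>u\<in>V. if u \<in> S then g u else 0) = (\<Sum>u\<in>S. g u)" for g :: "'a \<Rightarrow> real"
    using sum.inter_restrict[OF finite_V, of g S] S by (simp add: Int_absorb1)
  have m_eq: "m j = (\<Sum>u\<in>S. d u * stay S j u)" for j
  proof -
    have "m j = (\<Sum>u\<in>V. if u \<in> S then d u * stay S j u else 0)"
      unfolding m_def ip_def by (intro sum.cong) (auto simp: stay_0)
    then show ?thesis by (simp add: restr)
  qed
  have m0: "m 0 = wvol S" by (simp add: m_eq stay_0 wvol_def)
  \<comment> \<open>Starting with mass \<open>d u\<close> on each \<open>u\<close> in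
    \<open>S\<close>, one lazy step carries half of the cut weight out of \<open>S\<close>.\<close>
  have m1: "m 1 = wvol S - cut S / 2"
  proof -
    have "m 1 = (\<Sum>u\<in>S. d u * lazy (stay S 0) u)"
      unfolding m_eq by (intro sum.cong) (simp_all add: stay_Suc)
    also have "\<dots> = (\<Sum>u\<in>S. (d u + (\<Sum>w\<in>S. a u w)) / 2)"
    proof (intro sum.cong refl)
      fix u assume u: "u \<in> S"
      have "(\<Sum>w\<in>V. a u w * stay S 0 w) = (\<Sum>w\<in>V. if w \<in> S then a u w else 0)"
        by (intro sum.cong) (auto simp: stay_0)
      then show "d u * lazy (stay S 0) u = (d u + (\<Sum>w\<in>S. a u w)) / 2"
        using u S by (subst d_lazy) (auto simp: stay_0 restr)
    qed
    also have "\<dots> = (wvol S + (wvol S - cut S)) / 2"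
      using sum_split_cut[OF S(1)] by (simp add: sum_divide_distrib[symmetric] sum.distrib wvol_def)
    finally show ?thesis by (simp add: field_simps)
  qed
  have mp: "m (i + j) = ip (stay S i) (stay S j)" for i j unfolding m_def by (rule ip_stay_add[symmetric])
  have cs: "(m (i + j))\<^sup>2 \<le> m (i + i) * m (j + j)" for i j
    unfolding mp by (rule ip_Cauchy_Schwarz)
  define \<rho> where "\<rho> = 1 - cut S / wvol S / 2"
  have rho: "0 < \<rho>" using cut_le_wvol[OF S(1)] vp by (simp add: \<rho>_def field_simps)
  have m1': "m 1 = \<rho> * wvol S" using vp unfolding m1 \<rho>_def by (simp add: field_simps)
  \<comment> \<open>Cauchy-Schwarz with exponents 0 and 1 gives m 0 * m 2 >= (m 1)^2 = (\<rho> * m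
    0)^2, so the first ratio of even moments is at least the square of \<rho>; log-convexity
    propagates it.\<close>
  have "(\<rho>\<^sup>2) ^ i * m (2 * 0) \<le> m (2 * i)"
  proof (rule log_convex_ratio[of "\<lambda>i. m (2 * i)"])
    show "0 \<le> m (2 * i)" for i
      unfolding m_eq using S by (intro sum_nonneg mult_nonneg_nonneg less_imp_le[OF d_pos] stay_nonneg) auto
    show "(m (2 * Suc i))\<^sup>2 \<le> m (2 * i) * m (2 * Suc (Suc i))" for i
      using cs[of i "i + 2"] by (simp add: mult_2)
    show "0 < m (2 * 0)" using m0 vp by simp
    show "0 < \<rho>\<^sup>2" using rho by simp
    have "\<rho>\<^sup>2 * m 0 * m 0 \<le> m 0 * m 2"
      using cs[of 0 1] unfolding add_0 one_add_one m1' m0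
      by (simp add: power_mult_distrib power2_eq_square mult_ac)
    then have "m 0 * (\<rho>\<^sup>2 * m 0) \<le> m 0 * m 2" by (simp add: mult_ac)
    then show "\<rho>\<^sup>2 * m (2 * 0) \<le> m (2 * 1)" using m0 vp by simp
  qed
  then have avg: "\<rho> ^ (2 * i) * wvol S \<le> (\<Sum>u\<in>S. d u * stay S (2 * i) u)"
    by (simp add: m0 m_eq[symmetric] power_mult)
  \<comment> \<open>The degree-weighted average over \<open>S\<close> reaches this value, so some
    vertex of \<open>S\<close> does.\<close>
  have "\<exists>v\<in>S. \<rho> ^ (2 * i) \<le> stay S (2 * i) v"
  proof (rule ccontr)
    assume "\<not> ?thesis"
    then have "(\<Sum>u\<in>S. d u * stay S (2 * i) u) < (\<Sum>u\<in>S. d u * \<rho> ^ (2 * i))"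
      using S fS d_pos by (intro sum_strict_mono) (auto simp: not_le)
    then show False using avg by (simp add: wvol_def sum_distrib_right[symmetric] mult_ac)
  qed
  then obtain v where "v \<in> S" "\<rho> ^ (2 * i) \<le> stay S (2 * i) v" by blast
  then show ?thesis using stay_le_walk[of v S "2 * i"] S unfolding \<rho>_def by force
qed

end

section \<open>Combining the bounds\<close>

context weighted_graph
begin

text \<open>Let \<theta> be the conductance of \<open>S\<close>. At an even time t between l / (4
  \<theta>) and l / (2 \<theta>), a walk from some vertex of \<open>S\<close> has mass at least exp
  (- l / 2) on \<open>S\<close>, while \<open>walk_upper\<close> allows at most exp (- l) + exp (- t
  \<phi>^2 / 8) * sqrt k. Taking logarithms gives t \<phi>^2 = O(ln k), and t >= l / (4 \<theta>)
  turns this into the claim.\<close>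

lemma sweep_bound:
  fixes k K \<phi> :: real
  defines "l \<equiv> ln (K / k)"
  assumes k: "2 \<le> k" and K: "0 < K"
    and S: "S \<subseteq> V" "S \<noteq> {}" "wvol S \<le> k" and cutS: "1 \<le> cut S"
    and l: "1 / (4 * k) \<le> l" "l \<le> ln k"
    and phi: "0 \<le> \<phi>" "\<phi> \<le> 1"
    and exp: "\<And>v s u. v \<in> V \<Longrightarrow> real s \<le> k\<^sup>2 \<Longrightarrow> u \<in> V \<Longrightarrow> wvol (level (walk v s) u) \<le> K \<Longrightarrow>
      \<phi> * wvol (level (walk v s) u) \<le> cut (level (walk v s) u)"
  shows "\<phi>\<^sup>2 \<le> 176 * (cut S / wvol S) * ln k / l"
proof -
  define \<theta> where "\<theta> = cut S / wvol S"
  have vp: "1 \<le> wvol S" using cutS cut_le_wvol[OF S(1)] by linarith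
  have th1: "\<theta> \<le> 1" using cut_le_wvol[OF S(1)] vp by (simp add: \<theta>_def)
  have "1 / k \<le> 1 / wvol S" using S vp by (simp add: frac_le)
  also have "\<dots> \<le> \<theta>" using cutS vp by (simp add: \<theta>_def divide_right_mono)
  finally have thk: "1 / k \<le> \<theta>" .
  then have thp: "0 < \<theta>" using k by (smt (verit) divide_pos_pos)
  have lp: "0 < l" using l k by (smt (verit) divide_pos_pos)
  have ln2: "1 / 2 \<le> ln (2::real)" using ln_le_minus_one[of "1 / 2 :: real"] by (simp add: ln_div)
  have lnk: "ln 2 \<le> ln k" using k by simp
  have phi2: "\<phi>\<^sup>2 \<le> 1" using phi by (simp add: power_le_one)
  show ?thesis
  \<comment> \<open>For such \<open>l\<close> the chosen time would round to 0, but then the claimed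
    bound is at least 1 anyway.\<close>
  proof (cases "l < 4 * \<theta>")
    case True
    have "1 \<le> 4 * \<theta> / l" using True lp by simp
    then have "\<phi>\<^sup>2 \<le> 4 * \<theta> / l" using phi2 by linarith
    also have "\<dots> \<le> 176 * \<theta> * ln k / l"
    proof -
      have "4 \<le> 176 * ln k" using lnk ln2 by linarith
      then have "4 * \<theta> \<le> 176 * ln k * \<theta>" using thp by (intro mult_right_mono) auto
      then show ?thesis using lp by (intro divide_right_mono) (auto simp: mult_ac)
    qed
    finally show ?thesis by (simp add: \<theta>_def)
  next
    case False
    \<comment> \<open>\<open>walk_lower\<close> is available at even times only, hence rounding
      before doubling. Since \<open>i\<close> is at least 1, i + 1 <= 2 i, so the doubled value is
      still at least l / (4 \<theta>).\<close>
    define i where "i = nat \<lfloor>l / (4 * \<theta>)\<rfloor>"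
    define t where "t = 2 * i"
    have ge1: "1 \<le> l / (4 * \<theta>)" using False thp by simp
    then have "1 \<le> \<lfloor>l / (4 * \<theta>)\<rfloor>" by simp
    then have i1: "real i \<le> l / (4 * \<theta>)" "l / (4 * \<theta>) < real i + 1" "1 \<le> real i"
      unfolding i_def by linarith+
    have t1: "\<theta> * real t \<le> l / 2" using i1(1) thp by (simp add: t_def field_simps)
    have t2: "l \<le> 4 * \<theta> * real t"
    proof -
      have "l / (4 * \<theta>) \<le> real t" using i1 by (simp add: t_def)
      then show ?thesis using thp by (simp add: field_simps)
    qed
    \<comment> \<open>From \<theta> >= 1 / k and l <= ln k <= k: this is why examining the times up
      to k^2 is enough.\<close>
    have tk: "real t \<le> k\<^sup>2"
    proof -
      have "real t / k \<le> \<theta> * real t" using mult_right_mono[OF thk, of "real t"] by simp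
      also have "\<dots> \<le> k" using t1 l ln_le_minus_one[of k] lp k by linarith
      finally show ?thesis using k by (simp add: field_simps power2_eq_square)
    qed
    obtain v where v: "v \<in> S" "(1 - \<theta> / 2) ^ t \<le> ip (stay S 0) (walk v t)"
      using walk_lower[OF S(1,2), of i] by (auto simp: \<theta>_def t_def)
    define c where "c = 1 - \<phi>\<^sup>2 / 8"
    have c0: "0 \<le> c" using phi2 by (simp add: c_def)
    define w where "w u = (if u \<in> S then 1 else 0 :: real)" for u
    have vw: "(\<Sum>u\<in>V. w u * d u) = wvol S"
    proof -
      have "(\<Sum>u\<in>V. w u * d u) = (\<Sum>u\<in>V. if u \<in> S then d u else 0)"
        by (intro sum.cong) (auto simp: w_def)
      then show ?thesis
        using sum.inter_restrict[OF finite_V, of d S] S by (simp add: Int_absorb1 wvol_def)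
    qed
    have "exp (- (l / 2)) \<le> exp (- \<theta> * real t)" using t1 by simp
    also have "\<dots> = exp (- \<theta>) ^ t" by (simp add: exp_of_nat_mult[symmetric] mult.commute)
    also have "\<dots> \<le> (1 - \<theta> / 2) ^ t"
      using one_minus_half_ge_exp thp th1 by (intro power_mono) auto
    also have "\<dots> \<le> ip (stay S 0) (walk v t)" by (rule v)
    also have "\<dots> = (\<Sum>u\<in>V. w u * d u * walk v t u)"
      unfolding ip_def by (intro sum.cong) (auto simp: stay_0 w_def)
    also have "\<dots> \<le> 1 / K * (\<Sum>u\<in>V. w u * d u) + c ^ t * sqrt (\<Sum>u\<in>V. w u * d u)"
      unfolding c_def
    proof (rule walk_upper)
      show "v \<in> V" using v S by blast
      then show "\<phi> * wvol (level (walk v s) u) \<le> local.cut (level (walk v s) u)"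
        if "s \<le> t" "u \<in> V" "wvol (level (walk v s) u) \<le> K" for s u
        using exp[of v s u] that tk by (smt (verit) of_nat_le_iff)
    qed (use K phi in \<open>auto simp: w_def\<close>)
    also have "\<dots> \<le> k / K + c ^ t * sqrt k"
      unfolding vw using S K c0 by (intro add_mono mult_left_mono) (auto simp: divide_right_mono)
    also have "k / K = exp (- l)"
      using k K by (simp add: l_def exp_minus)
    also have "c \<le> exp (- (\<phi>\<^sup>2 / 8))" using exp_ge_add_one_self[of "- (\<phi>\<^sup>2 / 8)"] by (simp add: c_def)
    then have "c ^ t \<le> exp (- (\<phi>\<^sup>2 / 8)) ^ t" using c0 by (intro power_mono)
    also have "\<dots> = exp (- (real t * \<phi>\<^sup>2 / 8))" by (simp add: exp_of_nat_mult[symmetric])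
    finally have main: "exp (- (l / 2)) \<le> exp (- l) + exp (- (real t * \<phi>\<^sup>2 / 8)) * sqrt k"
      using k by (smt (verit) mult_right_mono real_sqrt_ge_zero)
    \<comment> \<open>Bounds the gap exp (- l / 2) - exp (- l) from below by exp (- l) * l / 2, a
      product whose logarithm splits.\<close>
    have "l / 2 \<le> exp (l / 2) - 1" using exp_ge_add_one_self[of "l / 2"] by linarith
    then have "exp (- l) * (l / 2) \<le> exp (- l) * (exp (l / 2) - 1)"
      by (intro mult_left_mono) auto
    also have "\<dots> = exp (- (l / 2)) - exp (- l)"
      by (simp add: algebra_simps exp_add[symmetric])
    also have "\<dots> \<le> exp (- (real t * \<phi>\<^sup>2 / 8)) * sqrt k" using main by simp
    finally have "ln (exp (- l) * (l / 2)) \<le> ln (exp (- (real t * \<phi>\<^sup>2 / 8)) * sqrt k)"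
      using lp k by (subst ln_le_cancel_iff) auto
    moreover have "ln (exp (- l) * (l / 2)) = - l + ln (l / 2)"
      using lp by (subst ln_mult) auto
    moreover have "ln (exp (- (real t * \<phi>\<^sup>2 / 8)) * sqrt k) = - (real t * \<phi>\<^sup>2 / 8) + ln k / 2"
      using k by (subst ln_mult) (auto simp: ln_sqrt)
    ultimately have "- l + ln (l / 2) \<le> - (real t * \<phi>\<^sup>2 / 8) + ln k / 2" by linarith
    moreover have "- (4 * ln k) \<le> ln (l / 2)"
    proof -
      have "ln (1 / (8 * k)) \<le> ln (l / 2)" using l k lp by (subst ln_le_cancel_iff) auto
      moreover have "ln (1 / (8 * k)) = - (3 * ln 2 + ln k)"
      proof -
        have "ln (8::real) = 3 * ln 2" using ln_realpow[of "2::real" 3] by simp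
        then show ?thesis using k by (simp add: ln_div ln_mult)
      qed
      ultimately show ?thesis using lnk by linarith
    qed
    \<comment> \<open>5.5 = 1/2 + 1 + 4, from sqrt k, from l <= ln k and from ln (l / 2) >= - 4 ln
      k. The factors 8 from the decay rate and 4 from the choice of t then give 176.\<close>
    ultimately have "real t * \<phi>\<^sup>2 / 8 \<le> 5.5 * ln k" using l by simp
    then have tp: "real t * \<phi>\<^sup>2 \<le> 44 * ln k" by simp
    have "l * \<phi>\<^sup>2 \<le> 4 * \<theta> * real t * \<phi>\<^sup>2" using t2 by (intro mult_right_mono) auto
    also have "\<dots> \<le> 4 * \<theta> * (44 * ln k)"
      using mult_left_mono[OF tp, of "4 * \<theta>"] thp by (simp add: mult_ac)
    finally have "\<phi>\<^sup>2 \<le> 4 * \<theta> * (44 * ln k) / l" using lp by (simp add: pos_le_divide_eq mult.commute)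
    then show ?thesis by (simp add: \<theta>_def mult_ac)
  qed
qed

end

section \<open>Running time of programs\<close>

definition upd :: "store \<Rightarrow> vname \<Rightarrow> nat \<Rightarrow> nat \<Rightarrow> store" where
  "upd s x i v = s(x := (s x)(i := v))"

lemma upd_apply [simp]: "upd s x i v y = (if y = x then (s x)(i := v) else s y)"
  by (simp add: upd_def)

primrec nodes :: "expr \<Rightarrow> nat" where
  "nodes (Num c) = 1"
| "nodes (Cell x i) = Suc (nodes i)"
| "nodes (Plus a b) = Suc (nodes a + nodes b)"
| "nodes (Minus a b) = Suc (nodes a + nodes b)"
| "nodes (Times a b) = Suc (nodes a + nodes b)"
| "nodes (Quot a b) = Suc (nodes a + nodes b)"

text \<open>Literals up to 2 lie below 2^B for every B >= 2, so each leaf fits into one word and the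
  value of an expression can be bounded by counting nodes.\<close>

primrec small_nums :: "expr \<Rightarrow> bool" where
  "small_nums (Num c) \<longleftrightarrow> c \<le> 2"
| "small_nums (Cell x i) \<longleftrightarrow> small_nums i"
| "small_nums (Plus a b) \<longleftrightarrow> small_nums a \<and> small_nums b"
| "small_nums (Minus a b) \<longleftrightarrow> small_nums a \<and> small_nums b"
| "small_nums (Times a b) \<longleftrightarrow> small_nums a \<and> small_nums b"
| "small_nums (Quot a b) \<longleftrightarrow> small_nums a \<and> small_nums b"

definition Var :: "vname \<Rightarrow> expr" where
  "Var x = Cell x (Num 0)"

lemma Var_simps [simp]:
  "val (Var x) s = s x 0" "nodes (Var x) = 2" "small_nums (Var x)"
  by (simp_all add: Var_def)

lemma len_le: "v < 2 ^ m \<Longrightarrow> len v \<le> m"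
  by (simp add: floorlog_leI)

locale word_bound =
  fixes B :: nat
  assumes B: "2 \<le> B"
begin

definition bounded :: "store \<Rightarrow> bool" where
  "bounded s \<longleftrightarrow> (\<forall>x i. s x i < 2 ^ B)"

lemma boundedD: "bounded s \<Longrightarrow> s x i < 2 ^ B"
  by (simp add: bounded_def)

lemma bounded_upd: "bounded s \<Longrightarrow> v < 2 ^ B \<Longrightarrow> bounded (upd s x i v)"
  by (simp add: bounded_def)

text \<open>Multiplication adds lengths, and the carry bit of an addition fits into the B bits
  granted to its own node.\<close>

lemma val_less: "bounded s \<Longrightarrow> small_nums e \<Longrightarrow> val e s < 2 ^ (B * nodes e)"
proof (induction e)
  case (Num c)
  have "(2::nat) ^ 2 \<le> 2 ^ B" using B by (intro power_increasing) auto
  then show ?case using Num by simp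
next
  case (Cell x i)
  have "s x (val i s) < 2 ^ B" using Cell boundedD by blast
  also have "(2::nat) ^ B \<le> 2 ^ (B * nodes (Cell x i))" by (intro power_increasing) auto
  finally show ?case by simp
next
  case (Plus a b)
  have "val a s < 2 ^ (B * nodes a + B * nodes b)"
    by (rule less_le_trans[OF Plus.IH(1) power_increasing]) (use Plus in auto)
  moreover have "val b s < 2 ^ (B * nodes a + B * nodes b)"
    by (rule less_le_trans[OF Plus.IH(2) power_increasing]) (use Plus in auto)
  ultimately have "val (Plus a b) s < 2 ^ (1 + (B * nodes a + B * nodes b))" by simp
  also have "\<dots> \<le> 2 ^ (B * nodes (Plus a b))"
    using B by (intro power_increasing) (auto simp: algebra_simps)
  finally show ?case .
next
  case (Minus a b)
  have "val (Minus a b) s \<le> val a s" by simp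
  also have "\<dots> < 2 ^ (B * nodes a)" using Minus by auto
  also have "\<dots> \<le> 2 ^ (B * nodes (Minus a b))"
    by (intro power_increasing) (auto simp: algebra_simps)
  finally show ?case .
next
  case (Times a b)
  have "val a s < 2 ^ (B * nodes a)" "val b s < 2 ^ (B * nodes b)" using Times by auto
  then have "val (Times a b) s < 2 ^ (B * nodes a) * 2 ^ (B * nodes b)"
    by (simp add: mult_strict_mono)
  also have "\<dots> = 2 ^ (B * nodes a + B * nodes b)" by (simp add: power_add)
  also have "\<dots> \<le> 2 ^ (B * nodes (Times a b))"
    by (intro power_increasing) (auto simp: algebra_simps)
  finally show ?case .
next
  case (Quot a b)
  have "val (Quot a b) s \<le> val a s" by simp
  also have "\<dots> < 2 ^ (B * nodes a)" using Quot by auto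
  also have "\<dots> \<le> 2 ^ (B * nodes (Quot a b))"
    by (intro power_increasing) (auto simp: algebra_simps)
  finally show ?case .
qed

lemma len_val: "bounded s \<Longrightarrow> small_nums e \<Longrightarrow> nodes e \<le> N \<Longrightarrow> len (val e s) \<le> B * N"
  using val_less[of s e] len_le[of "val e s" "B * nodes e"] mult_le_mono2[of "nodes e" N B] by linarith

lemma cost_le:
  assumes "bounded s"
  shows "small_nums e \<Longrightarrow> nodes e \<le> N \<Longrightarrow> cost e s \<le> nodes e * (1 + 2 * (B * N))"
proof (induction e)
  case (Num c)
  then show ?case using len_val[OF assms, of "Num c" N] by simp
next
  case (Cell x i)
  have "len (s x (val i s)) \<le> B" by (intro len_le boundedD assms)
  also have "B \<le> B * N" using Cell.prems by simp
  finally show ?case using Cell len_val[OF assms, of i N] by simp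
next
  case (Plus a b)
  then show ?case using len_val[OF assms, of a N] len_val[OF assms, of b N] by (simp add: algebra_simps)
next
  case (Minus a b)
  then show ?case using len_val[OF assms, of a N] len_val[OF assms, of b N] by (simp add: algebra_simps)
next
  case (Times a b)
  then show ?case using len_val[OF assms, of a N] len_val[OF assms, of b N] by (simp add: algebra_simps)
next
  case (Quot a b)
  then show ?case using len_val[OF assms, of a N] len_val[OF assms, of b N] by (simp add: algebra_simps)
qed

text \<open>The unit of time is \<open>unit\<close>, which pays for any operation on at most 100 expression nodes.\<close>

definition unit :: nat where
  "unit = 1 + 100 * (1 + 2 * (B * 100))"

lemma unit_pos: "1 \<le> unit"
  by (simp add: unit_def)

lemma cost_le_unit:
  assumes "bounded s" "small_nums e" "nodes e \<le> 100"
  shows "1 + cost e s \<le> unit"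
proof -
  have "cost e s \<le> nodes e * (1 + 2 * (B * 100))" by (rule cost_le) (use assms in auto)
  also have "\<dots> \<le> 100 * (1 + 2 * (B * 100))" using assms by (intro mult_le_mono1)
  finally show ?thesis by (simp add: unit_def)
qed

text \<open>A total-correctness statement with time counted in \<open>unit\<close>s. Boundedness of
  the final store is included because the cost of the next command is estimated from the lengths of
  the cells that it reads.\<close>

definition runs :: "prog \<Rightarrow> nat \<Rightarrow> (store \<Rightarrow> bool) \<Rightarrow> store \<Rightarrow> bool" where
  "runs c N Q s \<longleftrightarrow> (\<exists>T t. exec c s T t \<and> T \<le> N * unit \<and> bounded t \<and> Q t)"

lemma runs_mono: "runs c N Q s \<Longrightarrow> N \<le> N' \<Longrightarrow> (\<And>t. bounded t \<Longrightarrow> Q t \<Longrightarrow> Q' t) \<Longrightarrow> runs c N' Q' s"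
  unfolding runs_def by (meson le_trans mult_le_mono1)

lemma runs_Skip: "bounded s \<Longrightarrow> Q s \<Longrightarrow> runs Skip 1 Q s"
  unfolding runs_def using exec.Skip unit_pos by fastforce

lemma runs_Assign:
  assumes "bounded s" "small_nums i" "small_nums e" "nodes i + nodes e \<le> 100"
    and "val e s < 2 ^ B" "Q (upd s x (val i s) (val e s))"
  shows "runs (Assign x i e) 2 Q s"
proof -
  have "exec (Assign x i e) s (1 + cost i s + cost e s) (upd s x (val i s) (val e s))"
    unfolding upd_def by (rule exec.Assign)
  moreover have "1 + cost i s + cost e s \<le> 2 * unit"
    using cost_le_unit[of s i] cost_le_unit[of s e] assms by simp
  ultimately show ?thesis unfolding runs_def using assms bounded_upd by blast
qed

lemma runs_Assign_eq:
  assumes "bounded s" "val i s = a" "val e s = b" "b < 2 ^ B" "Q (upd s x a b)"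
    and "small_nums i" "small_nums e" "nodes i + nodes e \<le> 100"
  shows "runs (Assign x i e) 2 Q s"
  using assms by (intro runs_Assign) simp_all

lemma runs_Seq:
  assumes "runs c1 N1 R s" "\<And>t. bounded t \<Longrightarrow> R t \<Longrightarrow> runs c2 N2 Q t"
  shows "runs (Seq c1 c2) (N1 + N2 + 1) Q s"
proof -
  obtain T1 t where 1: "exec c1 s T1 t" "T1 \<le> N1 * unit" "bounded t" "R t"
    using assms(1) unfolding runs_def by blast
  then obtain T2 t2 where 2: "exec c2 t T2 t2" "T2 \<le> N2 * unit" "bounded t2" "Q t2"
    using assms(2) unfolding runs_def by blast
  have "1 + T1 + T2 \<le> (N1 + N2 + 1) * unit" using 1 2 unit_pos by (simp add: algebra_simps)
  then show ?thesis unfolding runs_def using exec.Seq[OF 1(1) 2(1)] 2 by blast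
qed

lemma runs_If:
  assumes "bounded s" "small_nums b" "nodes b \<le> 100"
    and "val b s \<noteq> 0 \<Longrightarrow> runs c1 N Q s" "val b s = 0 \<Longrightarrow> runs c2 N Q s"
  shows "runs (If b c1 c2) (N + 1) Q s"
proof (cases "val b s = 0")
  case True
  then obtain T t where "exec c2 s T t" "T \<le> N * unit" "bounded t" "Q t"
    using assms(5) unfolding runs_def by blast
  then show ?thesis unfolding runs_def
    using exec.IfFalse[OF True] cost_le_unit[OF assms(1-3)] by fastforce
next
  case False
  then obtain T t where "exec c1 s T t" "T \<le> N * unit" "bounded t" "Q t"
    using assms(4) unfolding runs_def by blast
  then show ?thesis unfolding runs_def
    using exec.IfTrue[OF False] cost_le_unit[OF assms(1-3)] by fastforce
qed

end

definition For :: "vname \<Rightarrow> expr \<Rightarrow> prog \<Rightarrow> prog" where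
  "For x m c = Seq (Assign x (Num 0) (Num 0))
     (While (Minus m (Var x)) (Seq c (Assign x (Num 0) (Plus (Var x) (Num 1)))))"

context word_bound
begin

text \<open>The bound \<open>m\<close> is evaluated anew at each test, hence \<open>Im\<close>; by
  \<open>Ix\<close> the invariant sees the counter only through its index \<open>j\<close>. N + 5
  pays for the body, test, increment and sequencing of a round, and 4 for initialisation, sequencing
  and the final test. \<open>M'\<close> permits a simpler time bound than the exact number of
  rounds.\<close>

lemma runs_For:
  assumes s: "bounded s" and M: "M < 2 ^ B" "M \<le> M'" and m: "small_nums m" "nodes m \<le> 90"
    and I0: "I 0 s"
    and Ix: "\<And>j t v. I j t \<Longrightarrow> I j (upd t x 0 v)"
    and Im: "\<And>j t. I j t \<Longrightarrow> t x 0 = j \<Longrightarrow> val m t = M"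
    and body: "\<And>j t. j < M \<Longrightarrow> bounded t \<Longrightarrow> I j t \<Longrightarrow> t x 0 = j \<Longrightarrow>
      runs c N (\<lambda>t'. I (Suc j) t' \<and> t' x 0 = j) t"
    and Q: "\<And>t. bounded t \<Longrightarrow> I M t \<Longrightarrow> Q t"
  shows "runs (For x m c) (M' * (N + 5) + 4) Q s"
proof -
  let ?c = "Seq c (Assign x (Num 0) (Plus (Var x) (Num 1)))"
  have loop: "runs (While (Minus m (Var x)) ?c) ((M - j) * (N + 5) + 1) Q t"
    if "j \<le> M" "bounded t" "I j t" "t x 0 = j" for j t
    using that
  proof (induction "M - j" arbitrary: j t)
    case 0
    then have jM: "j = M" by simp
    have "val (Minus m (Var x)) t = 0" using 0 Im[of j t] by simp
    note e = exec.WhileFalse[OF this]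
    have "1 + cost (Minus m (Var x)) t \<le> unit"
      using 0 m by (intro cost_le_unit) auto
    then show ?case unfolding runs_def using e[of ?c] 0 jM Q[of t] by (intro exI conjI) auto
  next
    case (Suc l)
    then have jM: "j < M" by simp
    have g: "val (Minus m (Var x)) t \<noteq> 0" using Suc.prems jM Im[of j t] by simp
    have c: "1 + cost (Minus m (Var x)) t \<le> unit"
      using Suc.prems m by (intro cost_le_unit) auto
    have "runs ?c (N + 2 + 1) (\<lambda>t'. I (Suc j) t' \<and> t' x 0 = Suc j) t"
      by (rule runs_Seq[OF body[OF jM]])
        (use Suc.prems jM M Ix in \<open>auto intro!: runs_Assign\<close>)
    then obtain T1 t1 where 1: "exec ?c t T1 t1" "T1 \<le> (N + 2 + 1) * unit" "bounded t1"
      "I (Suc j) t1" "t1 x 0 = Suc j"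
      unfolding runs_def by blast
    have "runs (While (Minus m (Var x)) ?c) ((M - Suc j) * (N + 5) + 1) Q t1"
      using Suc.hyps(2) jM 1 by (intro Suc.hyps(1)) auto
    then obtain T2 t2 where 2: "exec (While (Minus m (Var x)) ?c) t1 T2 t2"
      "T2 \<le> ((M - Suc j) * (N + 5) + 1) * unit" "bounded t2" "Q t2"
      unfolding runs_def by blast
    define D w where "D = M - Suc j" and "w = cost (Minus m (Var x)) t"
    have D: "M - j = Suc D" using jM by (simp add: D_def)
    have "1 + w + T1 + T2 \<le> unit + (N + 2 + 1) * unit + (D * (N + 5) + 1) * unit"
      using c 1(2) 2(2) unfolding D_def w_def by linarith
    also have "\<dots> \<le> (Suc D * (N + 5) + 1) * unit" by (simp add: algebra_simps)
    finally have "1 + cost (Minus m (Var x)) t + T1 + T2 \<le> ((M - j) * (N + 5) + 1) * unit"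
      unfolding D w_def .
    then show ?case unfolding runs_def using exec.WhileTrue[OF g 1(1) 2(1)] 2 by blast
  qed
  have "runs (For x m c) (2 + (M * (N + 5) + 1) + 1) Q s"
    unfolding For_def
  proof (rule runs_Seq)
    show "runs (Assign x (Num 0) (Num 0)) 2 (\<lambda>t. I 0 t \<and> t x 0 = 0) s"
      using s I0 Ix by (intro runs_Assign) auto
    show "runs (While (Minus m (Var x)) ?c) (M * (N + 5) + 1) Q t" if "bounded t" "I 0 t \<and> t x 0 = 0" for t
      using loop[of 0 t] that by simp
  qed
  then show ?thesis
  proof (rule runs_mono)
    show "2 + (M * (N + 5) + 1) + 1 \<le> M' * (N + 5) + 4"
      using mult_le_mono1[OF M(2), of "N + 5"] by linarith
  qed
qed

end

section \<open>The sweep program\<close>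

definition row :: expr where "row = Quot (Var ''i'') (Var ''n'')"
definition col :: expr where "col = Minus (Var ''i'') (Times row (Var ''n''))"

text \<open>With truncated subtraction, 1 - (b - e) is the truth value of b <= e as a number, which
  can serve as a factor in sums.\<close>

definition at_least :: "expr \<Rightarrow> expr \<Rightarrow> expr" where
  "at_least e b = Minus (Num 1) (Minus b e)"

lemma expr_simps [simp]:
  "val row s = s ''i'' 0 div s ''n'' 0" "nodes row = 5" "small_nums row"
  "val col s = s ''i'' 0 mod s ''n'' 0" "nodes col = 11" "small_nums col"
  "val (at_least e b) s = of_bool (val b s \<le> val e s)" "nodes (at_least e b) = nodes e + nodes b + 3"
  "small_nums (at_least e b) \<longleftrightarrow> small_nums e \<and> small_nums b"
  by (auto simp: row_def col_def at_least_def minus_div_mult_eq_mod)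

definition fact_prog :: prog where
  "fact_prog = Seq (Assign ''L'' (Num 0) (Num 1))
     (For ''i'' (Var ''n'') (Assign ''L'' (Num 0) (Times (Var ''L'') (Plus (Var ''i'') (Num 1)))))"

definition deg_prog :: prog where
  "deg_prog = For ''i'' (Times (Var ''n'') (Var ''n''))
     (Assign ''deg'' row (Plus (Cell ''deg'' row) (Cell ''adj'' (Var ''i''))))"

definition start_prog :: prog where
  "start_prog = Seq (For ''i'' (Var ''n'') (Assign ''F'' (Var ''i'') (Num 0)))
     (Assign ''F'' (Var ''v'') (Num 1))"

text \<open>A matrix cell stands for an ordered pair of vertices. A boundary edge is counted only in
  the orientation that leaves the level set, hence exactly once.\<close>

definition measure_prog :: prog where
  "measure_prog = Seq (Assign ''vol'' (Num 0) (Num 0)) (Seq (Assign ''bd'' (Num 0) (Num 0))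
     (For ''i'' (Times (Var ''n'') (Var ''n''))
       (Seq (Assign ''vol'' (Num 0) (Plus (Var ''vol'')
               (Times (at_least (Cell ''F'' row) (Cell ''F'' (Var ''u''))) (Cell ''adj'' (Var ''i'')))))
            (Assign ''bd'' (Num 0) (Plus (Var ''bd'')
               (Times (Times (at_least (Cell ''F'' row) (Cell ''F'' (Var ''u'')))
                  (Minus (Num 1) (at_least (Cell ''F'' col) (Cell ''F'' (Var ''u'')))))
                  (Cell ''adj'' (Var ''i''))))))))"

text \<open>The guard encodes a conjunction as a product of truncated differences: vol <= K, and bd
  / vol < bb / bv after cross-multiplication, which stays within the integers.\<close>

definition update_prog :: prog where
  "update_prog = If (Times (Minus (Plus (Var ''K'') (Num 1)) (Var ''vol''))
       (Minus (Times (Var ''bb'') (Var ''vol'')) (Times (Var ''bd'') (Var ''bv''))))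
     (Seq (Assign ''bb'' (Num 0) (Var ''bd'')) (Seq (Assign ''bv'' (Num 0) (Var ''vol''))
        (For ''i'' (Var ''n'')
           (Assign ''S'' (Var ''i'') (at_least (Cell ''F'' (Var ''i'')) (Cell ''F'' (Var ''u'')))))))
     Skip"

text \<open>The new values are collected in \<open>G\<close> because every row still needs the old
  \<open>F\<close>.\<close>

definition step_prog :: prog where
  "step_prog = Seq (For ''i'' (Var ''n'') (Assign ''G'' (Var ''i'') (Times (Var ''L'') (Cell ''F'' (Var ''i'')))))
     (Seq (For ''i'' (Times (Var ''n'') (Var ''n''))
        (Assign ''G'' row (Plus (Cell ''G'' row) (Times (Times (Quot (Var ''L'') (Cell ''deg'' row))
            (Cell ''adj'' (Var ''i''))) (Cell ''F'' col)))))
     (For ''i'' (Var ''n'') (Assign ''F'' (Var ''i'') (Cell ''G'' (Var ''i'')))))"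

text \<open>The threshold \<open>K\<close> is left in the store by a preceding program. Level sets
  are examined before each step, so k^2 + 1 rounds cover the times 0 to k^2.\<close>

definition core_prog :: prog where
  "core_prog = Seq fact_prog (Seq deg_prog (Seq (Assign ''bb'' (Num 0) (Num 1))
     (For ''v'' (Var ''n'') (Seq start_prog
       (For ''t'' (Plus (Times (Var ''k'') (Var ''k'')) (Num 1))
          (Seq (For ''u'' (Var ''n'') (Seq measure_prog update_prog)) step_prog))))))"

section \<open>Functional description of what the program computes\<close>

definition rowsum :: "nat \<Rightarrow> (nat \<Rightarrow> nat) \<Rightarrow> nat \<Rightarrow> nat" where
  "rowsum n A u = (\<Sum>w<n. A (u * n + w))"

definition scaled_step :: "nat \<Rightarrow> (nat \<Rightarrow> nat) \<Rightarrow> (nat \<Rightarrow> nat) \<Rightarrow> nat \<Rightarrow> nat" where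
  "scaled_step n A f u = fact n * f u + (\<Sum>w<n. fact n div rowsum n A u * A (u * n + w) * f w)"

definition scaled_walk :: "nat \<Rightarrow> (nat \<Rightarrow> nat) \<Rightarrow> nat \<Rightarrow> nat \<Rightarrow> nat \<Rightarrow> nat" where
  "scaled_walk n A v t = (scaled_step n A ^^ t) (\<lambda>u. of_bool (u = v))"

lemma scaled_walk_0: "scaled_walk n A v 0 u = of_bool (u = v)"
  and scaled_walk_Suc: "scaled_walk n A v (Suc t) = scaled_step n A (scaled_walk n A v t)"
  by (simp_all add: scaled_walk_def)

text \<open>Start vertex, time, and the vertex whose value is the threshold.\<close>

type_synonym candidate = "nat \<times> nat \<times> nat"

definition cset :: "nat \<Rightarrow> (nat \<Rightarrow> nat) \<Rightarrow> candidate \<Rightarrow> nat set" where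
  "cset n A = (\<lambda>(v, t, u). {w. w < n \<and> scaled_walk n A v t u \<le> scaled_walk n A v t w})"

text \<open>Written as the program adds it up, over matrix cells, so that the loop invariant is a
  prefix of this sum; \<open>cvol_eq\<close> identifies it with the volume.\<close>

definition cvol :: "nat \<Rightarrow> (nat \<Rightarrow> nat) \<Rightarrow> candidate \<Rightarrow> nat" where
  "cvol n A c = (\<Sum>l<n * n. of_bool (l div n \<in> cset n A c) * A l)"

definition cbd :: "nat \<Rightarrow> (nat \<Rightarrow> nat) \<Rightarrow> candidate \<Rightarrow> nat" where
  "cbd n A c = (\<Sum>l<n * n. of_bool (l div n \<in> cset n A c) * (1 - of_bool (l mod n \<in> cset n A c)) * A l)"

text \<open>Here \<open>bv = 0\<close> means that no admissible set has been found yet; then \<open>bb = 1\<close> lets the first one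
  win the comparison \<open>bd * bv < bb * vol\<close>.\<close>

definition best :: "nat \<Rightarrow> (nat \<Rightarrow> nat) \<Rightarrow> nat \<Rightarrow> candidate set \<Rightarrow> store \<Rightarrow> bool" where
  "best n A K X s \<longleftrightarrow>
     (s ''bv'' 0 = 0 \<and> s ''bb'' 0 = 1 \<and> (\<forall>c\<in>X. K < cvol n A c)) \<or>
     (\<exists>c\<in>X. cvol n A c \<le> K \<and> 0 < cvol n A c \<and> s ''bv'' 0 = cvol n A c \<and> s ''bb'' 0 = cbd n A c \<and>
        (\<forall>w<n. s ''S'' w \<noteq> 0 \<longleftrightarrow> w \<in> cset n A c) \<and>
        (\<forall>c'\<in>X. cvol n A c' \<le> K \<longrightarrow> cbd n A c * cvol n A c' \<le> cbd n A c' * cvol n A c))"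

lemma sum_row:
  fixes h :: "nat \<Rightarrow> nat"
  assumes u: "u < n"
  shows "(\<Sum>l<n * n. if l div n = u then h l else 0) = (\<Sum>w<n. h (u * n + w))"
proof -
  have "(\<Sum>l<n * n. if l div n = u then h l else 0) = (\<Sum>l\<in>(\<lambda>w. u * n + w) ` {..<n}. h l)"
  proof (intro sum.mono_neutral_cong_right)
    show "(\<lambda>w. u * n + w) ` {..<n} \<subseteq> {..<n * n}"
    proof safe
      fix w assume "w < n"
      then have "u * n + w < Suc u * n" by simp
      also have "\<dots> \<le> n * n" using u by (intro mult_le_mono1) simp
      finally show "u * n + w < n * n" .
    qed
    show "\<forall>l\<in>{..<n * n} - (\<lambda>w. u * n + w) ` {..<n}. (if l div n = u then h l else 0) = 0"
    proof (intro ballI)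
      fix l assume l: "l \<in> {..<n * n} - (\<lambda>w. u * n + w) ` {..<n}"
      have "l = u * n + l mod n" if "l div n = u" using that by auto
      moreover have "l mod n < n" using u by simp
      ultimately have "l div n \<noteq> u" using l by blast
      then show "(if l div n = u then h l else 0) = 0" by simp
    qed
  qed (use u in \<open>auto\<close>)
  also have "\<dots> = (\<Sum>w<n. h (u * n + w))" by (subst sum.reindex) (auto simp: inj_on_def)
  finally show ?thesis .
qed

text \<open>The time bounds keep the shape in which the rules for \<open>Seq\<close>,
  \<open>If\<close> and \<open>For\<close> compose them, so that these rules match without
  arithmetic.\<close>

definition sweep_time :: "nat \<Rightarrow> nat" where
  "sweep_time m = (2 + (2 + (m * m * (2 + 2 + 1 + 5) + 4) + 1) + 1) + (2 + (2 + (m * (2 + 5) + 4) + 1) + 1 + 1) + 1"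

definition step_time :: "nat \<Rightarrow> nat" where
  "step_time m = (m * (2 + 5) + 4) + ((m * m * (2 + 5) + 4) + (m * (2 + 5) + 4) + 1) + 1"

definition walk_time :: "nat \<Rightarrow> nat \<Rightarrow> nat" where
  "walk_time m T' = T' * ((m * (sweep_time m + 5) + 4) + step_time m + 1 + 5) + 4"

definition core_time :: "nat \<Rightarrow> nat \<Rightarrow> nat" where
  "core_time m T' = (2 + (m * (2 + 5) + 4) + 1) + ((m * m * (2 + 5) + 4) +
     (2 + (m * (((m * (2 + 5) + 4) + 2 + 1) + walk_time m T' + 1 + 5) + 4) + 1) + 1) + 1"

text \<open>\<open>T\<close> is the number of times examined; \<open>walkB\<close> includes time
  \<open>T\<close> itself because a step follows the last examination. \<open>cvol_pos\<close>
  ensures that cross-multiplying compares conductances faithfully.\<close>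

locale sweep_run = word_bound +
  fixes n :: nat and A :: "nat \<Rightarrow> nat" and K T :: nat
  assumes A1: "A l \<le> 1"
    and nn: "n * n < 2 ^ B"
    and factB: "fact n < (2::nat) ^ B"
    and TB: "T < 2 ^ B"
    and walkB: "v < n \<Longrightarrow> t \<le> T \<Longrightarrow> u < n \<Longrightarrow> scaled_walk n A v t u < 2 ^ B"
    and cvol_pos: "v < n \<Longrightarrow> t < T \<Longrightarrow> u < n \<Longrightarrow> 0 < cvol n A (v, t, u)"
begin

lemma nB: "n < 2 ^ B"
proof -
  have "n \<le> n * n" by (cases n) auto
  then show ?thesis using nn by (rule le_less_trans)
qed

lemma B1: "1 < (2::nat) ^ B"
  using B by (intro one_less_power) auto

section \<open>Correctness and running time of the subprograms\<close>

lemma runs_fact: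
  assumes "bounded s" "s ''n'' 0 = n"
  shows "runs fact_prog (2 + (n * (2 + 5) + 4) + 1)
    (\<lambda>t. t ''L'' 0 = fact n \<and> (\<forall>y. y \<notin> {''L'', ''i''} \<longrightarrow> t y = s y)) s"
  unfolding fact_prog_def
proof (rule runs_Seq)
  show "runs (Assign ''L'' (Num 0) (Num 1)) 2
    (\<lambda>t. t ''L'' 0 = 1 \<and> (\<forall>y. y \<notin> {''L'', ''i''} \<longrightarrow> t y = s y)) s"
    using assms B1 by (intro runs_Assign) auto
next
  fix s1 assume s1: "bounded s1" "s1 ''L'' 0 = 1 \<and> (\<forall>y. y \<notin> {''L'', ''i''} \<longrightarrow> s1 y = s y)"
  show "runs (For ''i'' (Var ''n'') (Assign ''L'' (Num 0) (Times (Var ''L'') (Plus (Var ''i'') (Num 1)))))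
    (n * (2 + 5) + 4) (\<lambda>t. t ''L'' 0 = fact n \<and> (\<forall>y. y \<notin> {''L'', ''i''} \<longrightarrow> t y = s y)) s1"
  proof (rule runs_For[where M = n and
        I = "\<lambda>j t. t ''L'' 0 = fact j \<and> (\<forall>y. y \<notin> {''L'', ''i''} \<longrightarrow> t y = s y)"])
    fix j t assume j: "j < n" and t: "bounded t"
      "t ''L'' 0 = fact j \<and> (\<forall>y. y \<notin> {''L'', ''i''} \<longrightarrow> t y = s y)" "t ''i'' 0 = j"
    have "fact (Suc j) \<le> (fact n :: nat)" using j by (intro fact_mono) auto
    then have "fact (Suc j) < (2::nat) ^ B" using factB by simp
    then show "runs (Assign ''L'' (Num 0) (Times (Var ''L'') (Plus (Var ''i'') (Num 1)))) 2
     (\<lambda>t'. (t' ''L'' 0 = fact (Suc j) \<and> (\<forall>y. y \<notin> {''L'', ''i''} \<longrightarrow> t' y = s y)) \<and> t' ''i'' 0 = j) t"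
      using t by (intro runs_Assign) (auto simp: algebra_simps)
  qed (use assms s1 nB in auto)
qed

lemma runs_deg:
  assumes "bounded s" "s ''n'' 0 = n" "s ''adj'' = A" "\<And>u. s ''deg'' u = 0"
  shows "runs deg_prog (n * n * (2 + 5) + 4)
    (\<lambda>t. (\<forall>u<n. t ''deg'' u = rowsum n A u) \<and> (\<forall>y. y \<notin> {''deg'', ''i''} \<longrightarrow> t y = s y)) s"
  unfolding deg_prog_def
proof (rule runs_For[where M = "n * n" and
      I = "\<lambda>j t. t ''deg'' = (\<lambda>u. \<Sum>l<j. if l div n = u then A l else 0) \<and>
        (\<forall>y. y \<notin> {''deg'', ''i''} \<longrightarrow> t y = s y)"])
  fix j t assume j: "j < n * n" and t: "bounded t"
      "t ''deg'' = (\<lambda>u. \<Sum>l<j. if l div n = u then A l else 0) \<and>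
        (\<forall>y. y \<notin> {''deg'', ''i''} \<longrightarrow> t y = s y)" "t ''i'' 0 = j"
  have "(\<Sum>l<Suc j. if l div n = j div n then A l else 0) \<le> (\<Sum>l<Suc j. 1)"
    by (intro sum_mono) (use A1 in auto)
  then have "(\<Sum>l<Suc j. if l div n = j div n then A l else 0) < 2 ^ B" using j nn by simp
  then show "runs (Assign ''deg'' row (Plus (Cell ''deg'' row) (Cell ''adj'' (Var ''i'')))) 2
     (\<lambda>t'. (t' ''deg'' = (\<lambda>u. \<Sum>l<Suc j. if l div n = u then A l else 0) \<and>
        (\<forall>y. y \<notin> {''deg'', ''i''} \<longrightarrow> t' y = s y)) \<and> t' ''i'' 0 = j) t"
    using t assms by (intro runs_Assign) (auto simp: fun_eq_iff)
next
  fix t assume t: "t ''deg'' = (\<lambda>u. \<Sum>l<n * n. if l div n = u then A l else 0) \<and>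
        (\<forall>y. y \<notin> {''deg'', ''i''} \<longrightarrow> t y = s y)"
  then show "(\<forall>u<n. t ''deg'' u = rowsum n A u) \<and> (\<forall>y. y \<notin> {''deg'', ''i''} \<longrightarrow> t y = s y)"
    by (simp add: sum_row rowsum_def)
qed (use assms nn in auto)

lemma runs_start:
  assumes "bounded s" "s ''n'' 0 = n" "s ''v'' 0 = v" "v < n"
  shows "runs start_prog ((n * (2 + 5) + 4) + 2 + 1)
    (\<lambda>t. (\<forall>u<n. t ''F'' u = scaled_walk n A v 0 u) \<and> (\<forall>y. y \<notin> {''F'', ''i''} \<longrightarrow> t y = s y)) s"
  unfolding start_prog_def
proof (rule runs_Seq)
  show "runs (For ''i'' (Var ''n'') (Assign ''F'' (Var ''i'') (Num 0))) (n * (2 + 5) + 4)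
    (\<lambda>t. (\<forall>u<n. t ''F'' u = 0) \<and> (\<forall>y. y \<notin> {''F'', ''i''} \<longrightarrow> t y = s y)) s"
  proof (rule runs_For[where M = n and
        I = "\<lambda>j t. (\<forall>u<j. t ''F'' u = 0) \<and> (\<forall>y. y \<notin> {''F'', ''i''} \<longrightarrow> t y = s y)"])
    fix j t assume "j < n" "bounded t"
      "(\<forall>u<j. t ''F'' u = 0) \<and> (\<forall>y. y \<notin> {''F'', ''i''} \<longrightarrow> t y = s y)" "t ''i'' 0 = j"
    then show "runs (Assign ''F'' (Var ''i'') (Num 0)) 2
     (\<lambda>t'. ((\<forall>u<Suc j. t' ''F'' u = 0) \<and> (\<forall>y. y \<notin> {''F'', ''i''} \<longrightarrow> t' y = s y)) \<and> t' ''i'' 0 = j) t"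
      by (intro runs_Assign) (auto simp: less_Suc_eq)
  qed (use assms nB in auto)
next
  fix s1 assume s1: "bounded s1" "(\<forall>u<n. s1 ''F'' u = 0) \<and> (\<forall>y. y \<notin> {''F'', ''i''} \<longrightarrow> s1 y = s y)"
  then show "runs (Assign ''F'' (Var ''v'') (Num 1)) 2
    (\<lambda>t. (\<forall>u<n. t ''F'' u = scaled_walk n A v 0 u) \<and> (\<forall>y. y \<notin> {''F'', ''i''} \<longrightarrow> t y = s y)) s1"
    using assms B1 by (intro runs_Assign) (auto simp: scaled_walk_0)
qed

lemma runs_measure:
  assumes s: "bounded s" "s ''n'' 0 = n" "s ''adj'' = A" "s ''u'' 0 = u"
    and F: "\<forall>w<n. s ''F'' w = scaled_walk n A v t w" and u: "u < n"
  shows "runs measure_prog (2 + (2 + (n * n * (2 + 2 + 1 + 5) + 4) + 1) + 1)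
    (\<lambda>t'. t' ''vol'' 0 = cvol n A (v, t, u) \<and> t' ''bd'' 0 = cbd n A (v, t, u) \<and>
      (\<forall>y. y \<notin> {''vol'', ''bd'', ''i''} \<longrightarrow> t' y = s y)) s"
  unfolding measure_prog_def
proof (rule runs_Seq)
  show "runs (Assign ''vol'' (Num 0) (Num 0)) 2
    (\<lambda>t'. t' ''vol'' 0 = 0 \<and> (\<forall>y. y \<notin> {''vol'', ''bd'', ''i''} \<longrightarrow> t' y = s y)) s"
    using s by (intro runs_Assign) auto
next
  fix s1 assume s1: "bounded s1"
    "s1 ''vol'' 0 = 0 \<and> (\<forall>y. y \<notin> {''vol'', ''bd'', ''i''} \<longrightarrow> s1 y = s y)"
  let ?c = "(v, t, u)"
  define VS BS where "VS j = (\<Sum>l<j. of_bool (l div n \<in> cset n A ?c) * A l)"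
    and "BS j = (\<Sum>l<j. of_bool (l div n \<in> cset n A ?c) * (1 - of_bool (l mod n \<in> cset n A ?c)) * A l)" for j
  let ?ev = "Plus (Var ''vol'')
               (Times (at_least (Cell ''F'' row) (Cell ''F'' (Var ''u''))) (Cell ''adj'' (Var ''i'')))"
  let ?eb = "Plus (Var ''bd'')
               (Times (Times (at_least (Cell ''F'' row) (Cell ''F'' (Var ''u'')))
                  (Minus (Num 1) (at_least (Cell ''F'' col) (Cell ''F'' (Var ''u'')))))
                  (Cell ''adj'' (Var ''i'')))"
  let ?av = "Assign ''vol'' (Num 0) ?ev"
  let ?ab = "Assign ''bd'' (Num 0) ?eb"
  let ?fr = "\<lambda>t'. \<forall>y. y \<notin> {''vol'', ''bd'', ''i''} \<longrightarrow> t' y = s y"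
  show "runs (Seq (Assign ''bd'' (Num 0) (Num 0))
     (For ''i'' (Times (Var ''n'') (Var ''n'')) (Seq ?av ?ab)))
     (2 + (n * n * (2 + 2 + 1 + 5) + 4) + 1)
    (\<lambda>t'. t' ''vol'' 0 = cvol n A (v, t, u) \<and> t' ''bd'' 0 = cbd n A (v, t, u) \<and> ?fr t') s1"
  proof (rule runs_Seq)
    show "runs (Assign ''bd'' (Num 0) (Num 0)) 2
      (\<lambda>t'. t' ''vol'' 0 = 0 \<and> t' ''bd'' 0 = 0 \<and> ?fr t') s1"
      using s1 by (intro runs_Assign) auto
  next
    fix s2 assume s2: "bounded s2" "s2 ''vol'' 0 = 0 \<and> s2 ''bd'' 0 = 0 \<and> ?fr s2"
    show "runs (For ''i'' (Times (Var ''n'') (Var ''n'')) (Seq ?av ?ab))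
     (n * n * (2 + 2 + 1 + 5) + 4)
      (\<lambda>t'. t' ''vol'' 0 = cvol n A (v, t, u) \<and> t' ''bd'' 0 = cbd n A (v, t, u) \<and> ?fr t') s2"
    proof (rule runs_For[where M = "n * n" and
          I = "\<lambda>j t'. t' ''vol'' 0 = VS j \<and> t' ''bd'' 0 = BS j \<and> ?fr t'"])
      fix j t' assume j: "j < n * n" and t': "bounded t'"
        "t' ''vol'' 0 = VS j \<and> t' ''bd'' 0 = BS j \<and> ?fr t'" "t' ''i'' 0 = j"
      have np: "0 < n" using j by (cases n) auto
      then have jn: "j div n < n" "j mod n < n" using j by (auto simp: div_less_iff_less_mult)
      have mem: "l \<in> cset n A ?c \<longleftrightarrow> s ''F'' u \<le> s ''F'' l" if "l < n" for l
        using that F u by (simp add: cset_def)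
      have bound: "(\<Sum>l<Suc j. h l) < 2 ^ B" if "\<And>l. h l \<le> 1" for h :: "nat \<Rightarrow> nat"
      proof -
        have "(\<Sum>l<Suc j. h l) \<le> (\<Sum>l<Suc j. 1)" using that by (intro sum_mono) auto
        then show ?thesis using j nn by simp
      qed
      have vB: "VS (Suc j) < 2 ^ B" unfolding VS_def using A1 by (intro bound) auto
      have bB: "BS (Suc j) < 2 ^ B" unfolding BS_def using A1 by (intro bound) auto
      show "runs (Seq ?av ?ab) (2 + 2 + 1) (\<lambda>t'. (t' ''vol'' 0 = VS (Suc j) \<and>
          t' ''bd'' 0 = BS (Suc j) \<and> ?fr t') \<and> t' ''i'' 0 = j) t'"
      proof (rule runs_Seq)
        have fr: "t' ''F'' = s ''F''" "t' ''n'' 0 = n" "t' ''u'' 0 = u" "t' ''adj'' = A" "t' ''vol'' 0 = VS j"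
          using t' s by auto
        show "runs ?av 2 (\<lambda>t'. (t' ''vol'' 0 = VS (Suc j) \<and> t' ''bd'' 0 = BS j \<and> ?fr t') \<and> t' ''i'' 0 = j) t'"
        proof (rule runs_Assign_eq)
          show "val ?ev t' = VS (Suc j)" using t'(3) by (simp add: VS_def fr mem[OF jn(1)])
        qed (use t' vB in auto)
      next
        fix t2 assume t2: "bounded t2" "(t2 ''vol'' 0 = VS (Suc j) \<and>
          t2 ''bd'' 0 = BS j \<and> ?fr t2) \<and> t2 ''i'' 0 = j"
        have fr2: "t2 ''F'' = s ''F''" "t2 ''n'' 0 = n" "t2 ''u'' 0 = u" "t2 ''adj'' = A"
          "t2 ''bd'' 0 = BS j" "t2 ''i'' 0 = j"
          using t2 s by auto
        show "runs ?ab 2 (\<lambda>t'. (t' ''vol'' 0 = VS (Suc j) \<and> t' ''bd'' 0 = BS (Suc j) \<and> ?fr t') \<and> t' ''i'' 0 = j) t2"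
        proof (rule runs_Assign_eq)
          show "val ?eb t2 = BS (Suc j)" by (simp add: BS_def fr2 mem[OF jn(1)] mem[OF jn(2)])
        qed (use t2 bB in auto)
      qed
    next
      fix t' assume "t' ''vol'' 0 = VS (n * n) \<and> t' ''bd'' 0 = BS (n * n) \<and> ?fr t'"
      then show "t' ''vol'' 0 = cvol n A (v, t, u) \<and> t' ''bd'' 0 = cbd n A (v, t, u) \<and> ?fr t'"
        by (simp add: cvol_def cbd_def VS_def BS_def)
    next
      show "s2 ''vol'' 0 = VS 0 \<and> s2 ''bd'' 0 = BS 0 \<and> ?fr s2" using s2 by (simp add: VS_def BS_def)
    qed (use s s2 nn in auto)
  qed
qed

lemma runs_update:
  assumes s: "bounded s" "s ''n'' 0 = n" "s ''K'' 0 = K" "s ''u'' 0 = u"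
    "s ''vol'' 0 = cvol n A (v, t, u)" "s ''bd'' 0 = cbd n A (v, t, u)"
    and F: "\<forall>w<n. s ''F'' w = scaled_walk n A v t w" and u: "u < n" and v: "v < n" and t: "t < T"
    and best: "best n A K X s"
  shows "runs update_prog (2 + (2 + (n * (2 + 5) + 4) + 1) + 1 + 1)
    (\<lambda>t'. best n A K (insert (v, t, u) X) t' \<and>
      (\<forall>y. y \<notin> {''bb'', ''bv'', ''S'', ''i''} \<longrightarrow> t' y = s y)) s"
  unfolding update_prog_def
proof (rule runs_If)
  let ?c = "(v, t, u)"
  let ?g = "Times (Minus (Plus (Var ''K'') (Num 1)) (Var ''vol''))
       (Minus (Times (Var ''bb'') (Var ''vol'')) (Times (Var ''bd'') (Var ''bv'')))"
  let ?fr = "\<lambda>t'. \<forall>y. y \<notin> {''bb'', ''bv'', ''S'', ''i''} \<longrightarrow> t' y = s y"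
  have cp: "0 < cvol n A ?c" using cvol_pos u v t by blast
  have mem: "l \<in> cset n A ?c \<longleftrightarrow> s ''F'' u \<le> s ''F'' l" if "l < n" for l
    using that F u by (simp add: cset_def)
  show "bounded s" "small_nums ?g" "nodes ?g \<le> 100" using s by simp_all
  {
    assume "val ?g s \<noteq> 0"
    then have g: "cvol n A ?c \<le> K" "cbd n A ?c * s ''bv'' 0 < s ''bb'' 0 * cvol n A ?c"
      using s by auto
    have upd: "\<forall>c'\<in>insert ?c X. cvol n A c' \<le> K \<longrightarrow> cbd n A ?c * cvol n A c' \<le> cbd n A c' * cvol n A ?c"
      using best unfolding best_def
    proof (elim disjE bexE conjE)
      fix c assume cc: "0 < cvol n A c" and c: "s ''bv'' 0 = cvol n A c" "s ''bb'' 0 = cbd n A c"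
        "\<forall>c'\<in>X. cvol n A c' \<le> K \<longrightarrow> cbd n A c * cvol n A c' \<le> cbd n A c' * cvol n A c"
      show ?thesis
      proof safe
        fix c' assume "c' \<in> X" "cvol n A c' \<le> K"
        then have 1: "cbd n A c * cvol n A c' \<le> cbd n A c' * cvol n A c" using c by blast
        \<comment> \<open>Two cross-multiplied comparisons are chained through the previous record
          \<open>c\<close>, whose positive volume cancels at the end.\<close>
        have "cvol n A c * (cbd n A ?c * cvol n A c') = (cbd n A ?c * cvol n A c) * cvol n A c'" by simp
        also have "\<dots> \<le> (cbd n A c * cvol n A ?c) * cvol n A c'"
          using g(2) c by (intro mult_le_mono1) simp
        also have "\<dots> = (cbd n A c * cvol n A c') * cvol n A ?c" by simp
        also have "\<dots> \<le> (cbd n A c' * cvol n A c) * cvol n A ?c" using 1 by (intro mult_le_mono1)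
        finally have "cvol n A c * (cbd n A ?c * cvol n A c') \<le> cvol n A c * (cbd n A c' * cvol n A ?c)"
          by (simp add: mult_ac)
        then show "cbd n A ?c * cvol n A c' \<le> cbd n A c' * cvol n A ?c" using cc by simp
      qed
    qed auto
    show "runs (Seq (Assign ''bb'' (Num 0) (Var ''bd'')) (Seq (Assign ''bv'' (Num 0) (Var ''vol''))
        (For ''i'' (Var ''n'') (Assign ''S'' (Var ''i'') (at_least (Cell ''F'' (Var ''i'')) (Cell ''F'' (Var ''u'')))))))
      (2 + (2 + (n * (2 + 5) + 4) + 1) + 1) (\<lambda>t'. best n A K (insert ?c X) t' \<and> ?fr t') s"
    proof (rule runs_Seq)
      show "runs (Assign ''bb'' (Num 0) (Var ''bd'')) 2
        (\<lambda>t'. t' ''bb'' 0 = cbd n A ?c \<and> ?fr t') s"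
        using s boundedD[OF s(1), of "''bd''" 0] by (intro runs_Assign) auto
    next
      fix s1 assume s1: "bounded s1" "s1 ''bb'' 0 = cbd n A ?c \<and> ?fr s1"
      show "runs (Seq (Assign ''bv'' (Num 0) (Var ''vol''))
        (For ''i'' (Var ''n'') (Assign ''S'' (Var ''i'') (at_least (Cell ''F'' (Var ''i'')) (Cell ''F'' (Var ''u''))))))
        (2 + (n * (2 + 5) + 4) + 1) (\<lambda>t'. best n A K (insert ?c X) t' \<and> ?fr t') s1"
      proof (rule runs_Seq)
        show "runs (Assign ''bv'' (Num 0) (Var ''vol'')) 2
          (\<lambda>t'. t' ''bb'' 0 = cbd n A ?c \<and> t' ''bv'' 0 = cvol n A ?c \<and> ?fr t') s1"
          using s s1 boundedD[OF s(1), of "''vol''" 0] by (intro runs_Assign) auto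
      next
        fix s2 assume s2: "bounded s2" "s2 ''bb'' 0 = cbd n A ?c \<and> s2 ''bv'' 0 = cvol n A ?c \<and> ?fr s2"
        show "runs (For ''i'' (Var ''n'') (Assign ''S'' (Var ''i'') (at_least (Cell ''F'' (Var ''i'')) (Cell ''F'' (Var ''u'')))))
          (n * (2 + 5) + 4) (\<lambda>t'. best n A K (insert ?c X) t' \<and> ?fr t') s2"
        proof (rule runs_For[where M = n and
            I = "\<lambda>j t'. (\<forall>w<j. t' ''S'' w \<noteq> 0 \<longleftrightarrow> w \<in> cset n A ?c) \<and>
              t' ''bb'' 0 = cbd n A ?c \<and> t' ''bv'' 0 = cvol n A ?c \<and> ?fr t'"])
          fix j t' assume j: "j < n" and t': "bounded t'"
            "(\<forall>w<j. t' ''S'' w \<noteq> 0 \<longleftrightarrow> w \<in> cset n A ?c) \<and>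
              t' ''bb'' 0 = cbd n A ?c \<and> t' ''bv'' 0 = cvol n A ?c \<and> ?fr t'" "t' ''i'' 0 = j"
          have fr: "t' ''F'' = s ''F''" "t' ''u'' 0 = u" using t' s by auto
          show "runs (Assign ''S'' (Var ''i'') (at_least (Cell ''F'' (Var ''i'')) (Cell ''F'' (Var ''u'')))) 2
            (\<lambda>t'. ((\<forall>w<Suc j. t' ''S'' w \<noteq> 0 \<longleftrightarrow> w \<in> cset n A ?c) \<and>
              t' ''bb'' 0 = cbd n A ?c \<and> t' ''bv'' 0 = cvol n A ?c \<and> ?fr t') \<and> t' ''i'' 0 = j) t'"
          proof (rule runs_Assign_eq)
            show "val (at_least (Cell ''F'' (Var ''i'')) (Cell ''F'' (Var ''u''))) t' = of_bool (j \<in> cset n A ?c)"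
              using t'(3) by (simp add: fr mem[OF j])
            show "of_bool (j \<in> cset n A ?c) < (2::nat) ^ B" using B1 by (cases "j \<in> cset n A ?c") auto
            show "val (Var ''i'') t' = j" using t'(3) by simp
          qed (use t' in \<open>auto simp: less_Suc_eq\<close>)
        next
          fix t' assume "(\<forall>w<n. t' ''S'' w \<noteq> 0 \<longleftrightarrow> w \<in> cset n A ?c) \<and>
              t' ''bb'' 0 = cbd n A ?c \<and> t' ''bv'' 0 = cvol n A ?c \<and> ?fr t'"
          then show "best n A K (insert ?c X) t' \<and> ?fr t'"
            unfolding best_def using g upd cp by (intro conjI disjI2 bexI[of _ ?c]) auto
        qed (use s s2 nB in auto)
      qed
    qed
  }
  {
    assume "val ?g s = 0"
    then have g: "K < cvol n A ?c \<or> s ''bb'' 0 * cvol n A ?c \<le> cbd n A ?c * s ''bv'' 0"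
      using s by auto
    have "best n A K (insert ?c X) s"
      using best unfolding best_def
    proof (elim disjE bexE conjE)
      \<comment> \<open>With \<open>bv = 0\<close> and \<open>bb = 1\<close> the second factor of
        the guard is positive, so the candidate can only have failed by exceeding
        \<open>K\<close>.\<close>
      assume "s ''bv'' 0 = 0" "s ''bb'' 0 = 1" "\<forall>c\<in>X. K < cvol n A c"
      then show "s ''bv'' 0 = 0 \<and> s ''bb'' 0 = 1 \<and> (\<forall>c\<in>insert ?c X. K < cvol n A c) \<or>
        (\<exists>c\<in>insert ?c X. cvol n A c \<le> K \<and> 0 < cvol n A c \<and> s ''bv'' 0 = cvol n A c \<and> s ''bb'' 0 = cbd n A c \<and>
        (\<forall>w<n. (s ''S'' w \<noteq> 0) = (w \<in> cset n A c)) \<and>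
        (\<forall>c'\<in>insert ?c X. cvol n A c' \<le> K \<longrightarrow> cbd n A c * cvol n A c' \<le> cbd n A c' * cvol n A c))"
        using g cp by auto
    next
      fix c assume "c \<in> X" "cvol n A c \<le> K" "0 < cvol n A c" "s ''bv'' 0 = cvol n A c" "s ''bb'' 0 = cbd n A c"
        "\<forall>w<n. (s ''S'' w \<noteq> 0) = (w \<in> cset n A c)"
        "\<forall>c'\<in>X. cvol n A c' \<le> K \<longrightarrow> cbd n A c * cvol n A c' \<le> cbd n A c' * cvol n A c"
      then show "s ''bv'' 0 = 0 \<and> s ''bb'' 0 = 1 \<and> (\<forall>c\<in>insert ?c X. K < cvol n A c) \<or>
        (\<exists>c\<in>insert ?c X. cvol n A c \<le> K \<and> 0 < cvol n A c \<and> s ''bv'' 0 = cvol n A c \<and> s ''bb'' 0 = cbd n A c \<and>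
        (\<forall>w<n. (s ''S'' w \<noteq> 0) = (w \<in> cset n A c)) \<and>
        (\<forall>c'\<in>insert ?c X. cvol n A c' \<le> K \<longrightarrow> cbd n A c * cvol n A c' \<le> cbd n A c' * cvol n A c))"
        using g by (intro disjI2 bexI[of _ c]) auto
    qed
    then show "runs Skip (2 + (2 + (n * (2 + 5) + 4) + 1) + 1)
      (\<lambda>t'. best n A K (insert ?c X) t' \<and> ?fr t') s"
      using s by (intro runs_mono[OF runs_Skip]) auto
  }
qed

lemma runs_step:
  assumes s: "bounded s" "s ''n'' 0 = n" "s ''adj'' = A" "s ''L'' 0 = fact n"
    and deg: "\<forall>u<n. s ''deg'' u = rowsum n A u"
    and F: "\<forall>w<n. s ''F'' w = scaled_walk n A v t w" and v: "v < n" and t: "t < T"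
  shows "runs step_prog ((n * (2 + 5) + 4) + ((n * n * (2 + 5) + 4) + (n * (2 + 5) + 4) + 1) + 1)
    (\<lambda>t'. (\<forall>w<n. t' ''F'' w = scaled_walk n A v (Suc t) w) \<and>
      (\<forall>y. y \<notin> {''F'', ''G'', ''i''} \<longrightarrow> t' y = s y)) s"
  unfolding step_prog_def
proof (rule runs_Seq)
  let ?f = "scaled_walk n A v t"
  define h where "h l = fact n div rowsum n A (l div n) * A l * ?f (l mod n)" for l
  \<comment> \<open>The content of \<open>G\<close> at \<open>u\<close> after \<open>j\<close>
    matrix cells. It grows with \<open>j\<close> up to the next walk value, so \<open>walkB\<close>
    bounds all intermediate contents as well.\<close>
  define P where "P j u = fact n * ?f u + (\<Sum>l<j. if l div n = u then h l else 0)" for j u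
  have P_Suc: "P (Suc j) u = P j u + (if j div n = u then h j else 0)" for j u by (simp add: P_def)
  let ?fr = "\<lambda>t'. \<forall>y. y \<notin> {''F'', ''G'', ''i''} \<longrightarrow> t' y = s y"
  have G: "scaled_walk n A v (Suc t) u = P (n * n) u"
    if u: "u < n" for u
  proof -
    have "(\<Sum>l<n * n. if l div n = u then h l else 0) = (\<Sum>w<n. h (u * n + w))"
      by (rule sum_row[OF u])
    also have "\<dots> = (\<Sum>w<n. fact n div rowsum n A u * A (u * n + w) * ?f w)"
      by (intro sum.cong) (auto simp: h_def)
    finally show ?thesis by (simp add: scaled_walk_Suc scaled_step_def P_def)
  qed
  have GB: "scaled_walk n A v (Suc t) u < 2 ^ B" if "u < n" for u
    using walkB[OF v _ that, of "Suc t"] t by simp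
  show "runs (For ''i'' (Var ''n'') (Assign ''G'' (Var ''i'') (Times (Var ''L'') (Cell ''F'' (Var ''i'')))))
    (n * (2 + 5) + 4)
    (\<lambda>t'. (\<forall>w<n. t' ''G'' w = fact n * ?f w) \<and> t' ''F'' = s ''F'' \<and> ?fr t') s"
  proof (rule runs_For[where M = n and
      I = "\<lambda>j t'. (\<forall>w<j. t' ''G'' w = fact n * ?f w) \<and> t' ''F'' = s ''F'' \<and> ?fr t'"])
    fix j t' assume j: "j < n" and t': "bounded t'"
      "(\<forall>w<j. t' ''G'' w = fact n * ?f w) \<and> t' ''F'' = s ''F'' \<and> ?fr t'" "t' ''i'' 0 = j"
    have "fact n * ?f j < 2 ^ B" using G[OF j] GB[OF j] unfolding P_def by linarith
    then show "runs (Assign ''G'' (Var ''i'') (Times (Var ''L'') (Cell ''F'' (Var ''i'')))) 2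
      (\<lambda>t'. ((\<forall>w<Suc j. t' ''G'' w = fact n * ?f w) \<and> t' ''F'' = s ''F'' \<and> ?fr t') \<and> t' ''i'' 0 = j) t'"
      using t' s F j by (intro runs_Assign) (auto simp: less_Suc_eq)
  qed (use s nB in auto)
  fix s1 assume s1: "bounded s1" "(\<forall>w<n. s1 ''G'' w = fact n * ?f w) \<and> s1 ''F'' = s ''F'' \<and> ?fr s1"
  show "runs (Seq (For ''i'' (Times (Var ''n'') (Var ''n''))
        (Assign ''G'' row (Plus (Cell ''G'' row) (Times (Times (Quot (Var ''L'') (Cell ''deg'' row))
            (Cell ''adj'' (Var ''i''))) (Cell ''F'' col)))))
     (For ''i'' (Var ''n'') (Assign ''F'' (Var ''i'') (Cell ''G'' (Var ''i'')))))
    ((n * n * (2 + 5) + 4) + (n * (2 + 5) + 4) + 1)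
    (\<lambda>t'. (\<forall>w<n. t' ''F'' w = scaled_walk n A v (Suc t) w) \<and> ?fr t') s1"
  proof (rule runs_Seq)
    show "runs (For ''i'' (Times (Var ''n'') (Var ''n''))
        (Assign ''G'' row (Plus (Cell ''G'' row) (Times (Times (Quot (Var ''L'') (Cell ''deg'' row))
            (Cell ''adj'' (Var ''i''))) (Cell ''F'' col)))))
      (n * n * (2 + 5) + 4)
      (\<lambda>t'. (\<forall>w<n. t' ''G'' w = scaled_walk n A v (Suc t) w) \<and> ?fr t') s1"
    proof (rule runs_For[where M = "n * n" and
      I = "\<lambda>j t'. (\<forall>u<n. t' ''G'' u = P j u) \<and> t' ''F'' = s ''F'' \<and> ?fr t'"])
      fix j t' assume j: "j < n * n" and t': "bounded t'"
        "(\<forall>u<n. t' ''G'' u = P j u) \<and> t' ''F'' = s ''F'' \<and> ?fr t'" "t' ''i'' 0 = j"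
      have np: "0 < n" using j by (cases n) auto
      then have jn: "j div n < n" "j mod n < n" using j by (auto simp: div_less_iff_less_mult)
      have fr: "t' ''n'' 0 = n" "t' ''adj'' = A" "t' ''L'' 0 = fact n"
        "t' ''deg'' (j div n) = rowsum n A (j div n)" "t' ''F'' (j mod n) = ?f (j mod n)"
        "t' ''G'' (j div n) = P j (j div n)"
        using t' s deg F jn by auto
      let ?e = "Plus (Cell ''G'' row) (Times (Times (Quot (Var ''L'') (Cell ''deg'' row))
            (Cell ''adj'' (Var ''i''))) (Cell ''F'' col))"
      have e: "val ?e t' = P (Suc j) (j div n)" by (simp add: fr t'(3) P_Suc h_def)
      have r: "val row t' = j div n" by (simp add: fr t'(3))
      have "P (Suc j) (j div n) \<le> P (n * n) (j div n)"
        unfolding P_def using j by (intro add_left_mono sum_mono2) auto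
      then have "P (Suc j) (j div n) < 2 ^ B" using G[OF jn(1)] GB[OF jn(1)] by linarith
      then show "runs (Assign ''G'' row ?e) 2
        (\<lambda>t'. ((\<forall>u<n. t' ''G'' u = P (Suc j) u) \<and> t' ''F'' = s ''F'' \<and> ?fr t') \<and> t' ''i'' 0 = j) t'"
        by (rule runs_Assign_eq[OF t'(1) r e]) (use t'(2,3) in \<open>auto simp: P_Suc\<close>)
    next
      fix t' assume "(\<forall>u<n. t' ''G'' u = P (n * n) u) \<and> t' ''F'' = s ''F'' \<and> ?fr t'"
      then show "(\<forall>w<n. t' ''G'' w = scaled_walk n A v (Suc t) w) \<and> ?fr t'" using G by simp
    next
      show "(\<forall>u<n. s1 ''G'' u = P 0 u) \<and> s1 ''F'' = s ''F'' \<and> ?fr s1" using s1 by (simp add: P_def)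
    qed (use s s1 nn in auto)
  next
    fix s2 assume s2: "bounded s2" "(\<forall>w<n. s2 ''G'' w = scaled_walk n A v (Suc t) w) \<and> ?fr s2"
    show "runs (For ''i'' (Var ''n'') (Assign ''F'' (Var ''i'') (Cell ''G'' (Var ''i''))))
      (n * (2 + 5) + 4) (\<lambda>t'. (\<forall>w<n. t' ''F'' w = scaled_walk n A v (Suc t) w) \<and> ?fr t') s2"
    proof (rule runs_For[where M = n and
      I = "\<lambda>j t'. (\<forall>w<j. t' ''F'' w = scaled_walk n A v (Suc t) w) \<and> t' ''G'' = s2 ''G'' \<and> ?fr t'"])
      fix j t' assume j: "j < n" and t': "bounded t'"
        "(\<forall>w<j. t' ''F'' w = scaled_walk n A v (Suc t) w) \<and> t' ''G'' = s2 ''G'' \<and> ?fr t'" "t' ''i'' 0 = j"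
      then show "runs (Assign ''F'' (Var ''i'') (Cell ''G'' (Var ''i''))) 2
        (\<lambda>t'. ((\<forall>w<Suc j. t' ''F'' w = scaled_walk n A v (Suc t) w) \<and> t' ''G'' = s2 ''G'' \<and> ?fr t') \<and> t' ''i'' 0 = j) t'"
        using s2 GB[OF j] by (intro runs_Assign) (auto simp: less_Suc_eq)
    qed (use s s2 nB in auto)
  qed
qed

abbreviation "walk_cells \<equiv> {''F'', ''G'', ''i'', ''u'', ''vol'', ''bd'', ''bb'', ''bv'', ''S'', ''t''}"

abbreviation "work_cells \<equiv> {''F'', ''G'', ''i'', ''u'', ''vol'', ''bd'', ''bb'', ''bv'', ''S'', ''t'', ''v''}"

lemma runs_sweep:
  assumes s: "bounded s" "s ''n'' 0 = n" "s ''adj'' = A" "s ''K'' 0 = K" "s ''u'' 0 = u"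
    and F: "\<forall>w<n. s ''F'' w = scaled_walk n A v t w" and u: "u < n" and v: "v < n" and t: "t < T"
    and best: "best n A K X s"
  shows "runs (Seq measure_prog update_prog) (sweep_time n)
    (\<lambda>t'. best n A K (insert (v, t, u) X) t' \<and>
      (\<forall>y. y \<notin> {''vol'', ''bd'', ''i'', ''bb'', ''bv'', ''S''} \<longrightarrow> t' y = s y)) s"
  unfolding sweep_time_def
proof (rule runs_Seq[OF runs_measure[OF s(1,2,3,5) F u]])
  fix s1 assume s1: "bounded s1" "s1 ''vol'' 0 = cvol n A (v, t, u) \<and> s1 ''bd'' 0 = cbd n A (v, t, u) \<and>
      (\<forall>y. y \<notin> {''vol'', ''bd'', ''i''} \<longrightarrow> s1 y = s y)"
  then have eq: "s1 ''n'' 0 = n" "s1 ''K'' 0 = K" "s1 ''u'' 0 = u" "s1 ''F'' = s ''F''"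
    "s1 ''bb'' = s ''bb''" "s1 ''bv'' = s ''bv''" "s1 ''S'' = s ''S''" using s by auto
  have b: "best n A K X s1" using best by (simp add: best_def eq)
  show "runs update_prog (2 + (2 + (n * (2 + 5) + 4) + 1) + 1 + 1)
    (\<lambda>t'. best n A K (insert (v, t, u) X) t' \<and>
      (\<forall>y. y \<notin> {''vol'', ''bd'', ''i'', ''bb'', ''bv'', ''S''} \<longrightarrow> t' y = s y)) s1"
    by (rule runs_mono[OF runs_update[OF s1(1) eq(1-3) _ _ _ u v t b]])
      (use s1 F in \<open>auto simp: eq\<close>)
qed

lemma runs_walk:
  assumes s: "bounded s" "s ''n'' 0 = n" "s ''adj'' = A" "s ''K'' 0 = K" "s ''L'' 0 = fact n"
    and deg: "\<forall>u<n. s ''deg'' u = rowsum n A u"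
    and k: "T = s ''k'' 0 * s ''k'' 0 + 1"
    and F: "\<forall>w<n. s ''F'' w = scaled_walk n A v 0 w" and v: "v < n"
    and best: "best n A K X s"
  shows "runs (For ''t'' (Plus (Times (Var ''k'') (Var ''k'')) (Num 1))
          (Seq (For ''u'' (Var ''n'') (Seq measure_prog update_prog)) step_prog)) (walk_time n T)
    (\<lambda>t'. best n A K (X \<union> {(v, t, u) | t u. t < T \<and> u < n}) t' \<and>
      (\<forall>y. y \<notin> walk_cells \<longrightarrow> t' y = s y)) s"
  unfolding walk_time_def
proof (rule runs_For[where M = T and I = "\<lambda>j t'. (\<forall>w<n. t' ''F'' w = scaled_walk n A v j w) \<and>
    best n A K (X \<union> {(v, t, u) | t u. t < j \<and> u < n}) t' \<and>
      (\<forall>y. y \<notin> walk_cells \<longrightarrow> t' y = s y)"])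
  let ?fr = "\<lambda>t'. \<forall>y. y \<notin> walk_cells \<longrightarrow> t' y = s y"
  fix j s1 assume j: "j < T" and s1: "bounded s1" "(\<forall>w<n. s1 ''F'' w = scaled_walk n A v j w) \<and>
    best n A K (X \<union> {(v, t, u) | t u. t < j \<and> u < n}) s1 \<and> ?fr s1" "s1 ''t'' 0 = j"
  let ?X = "X \<union> {(v, t, u) | t u. t < j \<and> u < n}"
  have eq: "s1 ''n'' 0 = n" "s1 ''adj'' = A" "s1 ''K'' 0 = K" "s1 ''L'' 0 = fact n" "s1 ''deg'' = s ''deg''"
    using s1 s by auto
  show "runs (Seq (For ''u'' (Var ''n'') (Seq measure_prog update_prog)) step_prog)
     ((n * (sweep_time n + 5) + 4) + step_time n + 1)
     (\<lambda>t'. ((\<forall>w<n. t' ''F'' w = scaled_walk n A v (Suc j) w) \<and>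
       best n A K (X \<union> {(v, t, u) | t u. t < Suc j \<and> u < n}) t' \<and> ?fr t') \<and> t' ''t'' 0 = j) s1"
  proof (rule runs_Seq)
    let ?fr1 = "\<lambda>t'. \<forall>y. y \<notin> {''u'', ''vol'', ''bd'', ''i'', ''bb'', ''bv'', ''S''} \<longrightarrow> t' y = s1 y"
    show "runs (For ''u'' (Var ''n'') (Seq measure_prog update_prog)) (n * (sweep_time n + 5) + 4)
      (\<lambda>t'. best n A K (?X \<union> {(v, j, u) | u. u < n}) t' \<and> ?fr1 t') s1"
    proof (rule runs_For[where M = n and I = "\<lambda>i t'. best n A K (?X \<union> {(v, j, u) | u. u < i}) t' \<and> ?fr1 t'"])
      fix i s2 assume i: "i < n" and s2: "bounded s2"
        "best n A K (?X \<union> {(v, j, u) | u. u < i}) s2 \<and> ?fr1 s2" "s2 ''u'' 0 = i"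
      have eq2: "s2 ''n'' 0 = n" "s2 ''adj'' = A" "s2 ''K'' 0 = K" "s2 ''F'' = s1 ''F''"
        using s2 eq by auto
      have X: "insert (v, j, i) (?X \<union> {(v, j, u) | u. u < i}) = ?X \<union> {(v, j, u) | u. u < Suc i}"
        by (auto simp: less_Suc_eq)
      have F2: "\<forall>w<n. s2 ''F'' w = scaled_walk n A v j w" using s1 eq2 by simp
      have b2: "best n A K (?X \<union> {(v, j, u) | u. u < i}) s2" using s2 by blast
      show "runs (Seq measure_prog update_prog) (sweep_time n)
        (\<lambda>t'. (best n A K (?X \<union> {(v, j, u) | u. u < Suc i}) t' \<and> ?fr1 t') \<and> t' ''u'' 0 = i) s2"
        by (rule runs_mono[OF runs_sweep[OF s2(1) eq2(1-3) s2(3) F2 i v j b2]])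
          (use s2(2,3) in \<open>auto simp: X\<close>)
    next
      fix i t' y assume "best n A K (?X \<union> {(v, j, u) | u. u < i}) t' \<and> ?fr1 t'"
      then show "best n A K (?X \<union> {(v, j, u) | u. u < i}) (upd t' ''u'' 0 y) \<and> ?fr1 (upd t' ''u'' 0 y)"
        by (simp add: best_def)
    qed (use s1 eq nB in auto)
  next
    fix s2 assume s2: "bounded s2" "best n A K (?X \<union> {(v, j, u) | u. u < n}) s2 \<and>
      (\<forall>y. y \<notin> {''u'', ''vol'', ''bd'', ''i'', ''bb'', ''bv'', ''S''} \<longrightarrow> s2 y = s1 y)"
    have eq2: "s2 ''n'' 0 = n" "s2 ''adj'' = A" "s2 ''L'' 0 = fact n" "s2 ''F'' = s1 ''F''" "s2 ''deg'' = s ''deg''"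
        "s2 ''t'' 0 = j"
      using s2 eq s1(3) by auto
    have fr2: "?fr s2" using s1 s2 by auto
    have X: "?X \<union> {(v, j, u) | u. u < n} = X \<union> {(v, t, u) | t u. t < Suc j \<and> u < n}"
      by (auto simp: less_Suc_eq)
    have F2: "\<forall>w<n. s2 ''F'' w = scaled_walk n A v j w" using s1 eq2 by simp
    have d2: "\<forall>u<n. s2 ''deg'' u = rowsum n A u" using deg eq2 by simp
    have b2: "best n A K (X \<union> {(v, t, u) | t u. t < Suc j \<and> u < n}) s2" using s2 X by simp
    show "runs step_prog (step_time n) (\<lambda>t'. ((\<forall>w<n. t' ''F'' w = scaled_walk n A v (Suc j) w) \<and>
       best n A K (X \<union> {(v, t, u) | t u. t < Suc j \<and> u < n}) t' \<and> ?fr t') \<and> t' ''t'' 0 = j) s2"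
      unfolding step_time_def
    proof (rule runs_mono[OF runs_step[OF s2(1) eq2(1-3) d2 F2 v j]])
      fix t' assume t': "(\<forall>w<n. t' ''F'' w = scaled_walk n A v (Suc j) w) \<and>
        (\<forall>y. y \<notin> {''F'', ''G'', ''i''} \<longrightarrow> t' y = s2 y)"
      then have "t' ''bb'' = s2 ''bb''" "t' ''bv'' = s2 ''bv''" "t' ''S'' = s2 ''S''" "t' ''t'' 0 = j"
        using eq2 by auto
      then show "((\<forall>w<n. t' ''F'' w = scaled_walk n A v (Suc j) w) \<and>
       best n A K (X \<union> {(v, t, u) | t u. t < Suc j \<and> u < n}) t' \<and> ?fr t') \<and> t' ''t'' 0 = j"
        using t' b2 fr2 by (simp add: best_def)
    qed simp
  qed
next
  fix j t' y assume "(\<forall>w<n. t' ''F'' w = scaled_walk n A v j w) \<and>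
    best n A K (X \<union> {(v, t, u) | t u. t < j \<and> u < n}) t' \<and>
      (\<forall>y. y \<notin> walk_cells \<longrightarrow> t' y = s y)"
  then show "(\<forall>w<n. upd t' ''t'' 0 y ''F'' w = scaled_walk n A v j w) \<and>
    best n A K (X \<union> {(v, t, u) | t u. t < j \<and> u < n}) (upd t' ''t'' 0 y) \<and>
      (\<forall>z. z \<notin> walk_cells \<longrightarrow> upd t' ''t'' 0 y z = s z)"
    by (simp add: best_def)
qed (use s F best TB k in auto)

lemma runs_core:
  assumes s: "bounded s" "s ''n'' 0 = n" "s ''adj'' = A" "s ''K'' 0 = K"
    and zero: "\<And>u. s ''deg'' u = 0" "s ''bv'' 0 = 0"
    and k: "T = s ''k'' 0 * s ''k'' 0 + 1"
  shows "runs core_prog (core_time n T)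
    (best n A K {(v, t, u). v < n \<and> t < T \<and> u < n}) s"
  unfolding core_prog_def core_time_def
proof (rule runs_Seq[OF runs_fact[OF s(1,2)]])
  fix s1 assume s1: "bounded s1" "s1 ''L'' 0 = fact n \<and> (\<forall>y. y \<notin> {''L'', ''i''} \<longrightarrow> s1 y = s y)"
  have eq1: "s1 ''n'' 0 = n" "s1 ''adj'' = A" "\<And>u. s1 ''deg'' u = 0" using s s1 zero by auto
  let ?W = "For ''t'' (Plus (Times (Var ''k'') (Var ''k'')) (Num 1))
          (Seq (For ''u'' (Var ''n'') (Seq measure_prog update_prog)) step_prog)"
  let ?X = "\<lambda>j. {(v, t, u). v < j \<and> t < T \<and> u < n}"
  show "runs (Seq deg_prog (Seq (Assign ''bb'' (Num 0) (Num 1))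
     (For ''v'' (Var ''n'') (Seq start_prog ?W))))
     ((n * n * (2 + 5) + 4) + (2 + (n * (((n * (2 + 5) + 4) + 2 + 1) + walk_time n T + 1 + 5) + 4) + 1) + 1)
    (best n A K (?X n)) s1"
  proof (rule runs_Seq[OF runs_deg[OF s1(1) eq1]])
    fix s2 assume s2: "bounded s2" "(\<forall>u<n. s2 ''deg'' u = rowsum n A u) \<and>
      (\<forall>y. y \<notin> {''deg'', ''i''} \<longrightarrow> s2 y = s1 y)"
    have eq2: "s2 ''n'' 0 = n" "s2 ''adj'' = A" "s2 ''K'' 0 = K" "s2 ''L'' 0 = fact n"
      "s2 ''k'' = s ''k''" "s2 ''bv'' 0 = 0"
      using s1 s2 s zero eq1 by auto
    show "runs (Seq (Assign ''bb'' (Num 0) (Num 1)) (For ''v'' (Var ''n'') (Seq start_prog ?W)))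
     (2 + (n * (((n * (2 + 5) + 4) + 2 + 1) + walk_time n T + 1 + 5) + 4) + 1) (best n A K (?X n)) s2"
    proof (rule runs_Seq)
      show "runs (Assign ''bb'' (Num 0) (Num 1)) 2
        (\<lambda>t'. t' ''bb'' 0 = 1 \<and> (\<forall>y. y \<notin> {''bb''} \<longrightarrow> t' y = s2 y)) s2"
        using s2(1) B1 by (intro runs_Assign) auto
    next
      fix s3 assume s3: "bounded s3" "s3 ''bb'' 0 = 1 \<and> (\<forall>y. y \<notin> {''bb''} \<longrightarrow> s3 y = s2 y)"
      have eq3: "s3 ''n'' 0 = n" "s3 ''adj'' = A" "s3 ''K'' 0 = K" "s3 ''L'' 0 = fact n"
        "s3 ''k'' = s ''k''" "s3 ''bv'' 0 = 0" "\<forall>u<n. s3 ''deg'' u = rowsum n A u"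
        using eq2 s3 s2 by auto
      show "runs (For ''v'' (Var ''n'') (Seq start_prog ?W))
        (n * (((n * (2 + 5) + 4) + 2 + 1) + walk_time n T + 1 + 5) + 4) (best n A K (?X n)) s3"
      proof (rule runs_For[where M = n and I = "\<lambda>j t'. best n A K (?X j) t' \<and>
          (\<forall>y. y \<notin> work_cells \<longrightarrow> t' y = s3 y)"])
        fix j s4 assume j: "j < n" and s4: "bounded s4" "best n A K (?X j) s4 \<and>
          (\<forall>y. y \<notin> work_cells \<longrightarrow> s4 y = s3 y)" "s4 ''v'' 0 = j"
        have n4: "s4 ''n'' 0 = n" using s4 eq3 by simp
        show "runs (Seq start_prog ?W) (((n * (2 + 5) + 4) + 2 + 1) + walk_time n T + 1)
          (\<lambda>t'. (best n A K (?X (Suc j)) t' \<and> (\<forall>y. y \<notin> work_cells \<longrightarrow> t' y = s3 y)) \<and> t' ''v'' 0 = j) s4"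
        proof (rule runs_Seq[OF runs_start[OF s4(1) n4 s4(3) j]])
          fix s5 assume s5: "bounded s5" "(\<forall>u<n. s5 ''F'' u = scaled_walk n A j 0 u) \<and>
            (\<forall>y. y \<notin> {''F'', ''i''} \<longrightarrow> s5 y = s4 y)"
          have eq5: "s5 ''n'' 0 = n" "s5 ''adj'' = A" "s5 ''K'' 0 = K" "s5 ''L'' 0 = fact n"
            "\<forall>u<n. s5 ''deg'' u = rowsum n A u" "T = s5 ''k'' 0 * s5 ''k'' 0 + 1"
            using s5 s4(2) eq3 k by simp_all
          have F5: "\<forall>u<n. s5 ''F'' u = scaled_walk n A j 0 u" using s5 by blast
          have bb5: "s5 ''bb'' = s4 ''bb''" "s5 ''bv'' = s4 ''bv''" "s5 ''S'' = s4 ''S''" "s5 ''v'' 0 = j"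
            using s5 s4(3) by auto
          have b5: "best n A K (?X j) s5" using s4 by (simp add: best_def bb5)
          have fr5: "\<forall>y. y \<notin> work_cells \<longrightarrow> s5 y = s3 y" using s5 s4 by simp
          have X: "?X j \<union> {(j, t, u) | t u. t < T \<and> u < n} = ?X (Suc j)" by (auto simp: less_Suc_eq)
          show "runs ?W (walk_time n T) (\<lambda>t'. (best n A K (?X (Suc j)) t' \<and>
            (\<forall>y. y \<notin> work_cells \<longrightarrow> t' y = s3 y)) \<and> t' ''v'' 0 = j) s5"
            by (rule runs_mono[OF runs_walk[OF s5(1) eq5(1-6) F5 j b5]])
              (use fr5 bb5(4) in \<open>simp_all only: X, auto\<close>)
        qed
      next
        show "best n A K (?X 0) s3 \<and> (\<forall>y. y \<notin> work_cells \<longrightarrow> s3 y = s3 y)"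
          using s3 eq3 by (simp add: best_def)
      next
        fix j t' y assume "best n A K (?X j) t' \<and> (\<forall>y. y \<notin> work_cells \<longrightarrow> t' y = s3 y)"
        then show "best n A K (?X j) (upd t' ''v'' 0 y) \<and> (\<forall>z. z \<notin> work_cells \<longrightarrow> upd t' ''v'' 0 y z = s3 z)"
          by (simp add: best_def)
      qed (use s3 eq3 nB in auto)
    qed
  qed
qed

end

section \<open>Volume thresholds\<close>

text \<open>The result is the floor of (1 + \<epsilon>) k for \<epsilon> = p / q.\<close>

definition times_prog :: prog where
  "times_prog = Assign ''K'' (Num 0) (Quot (Times (Plus (Var ''q'') (Var ''p'')) (Var ''k'')) (Var ''q''))"

text \<open>With truncated subtraction x - (x - k) is the minimum of x and k; this makes
  \<open>a\<close> the numerator m of the rounded exponent m / k. Comparing k-th powers with k^(k +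
  m) and counting the successes avoids extracting a root.\<close>

definition power_prog :: prog where
  "power_prog = Seq (Assign ''a'' (Num 0) (Minus (Quot (Times (Var ''k'') (Var ''p'')) (Var ''q''))
       (Minus (Quot (Times (Var ''k'') (Var ''p'')) (Var ''q'')) (Var ''k''))))
     (Seq (Assign ''R'' (Num 0) (Num 1))
     (Seq (For ''i'' (Plus (Var ''k'') (Var ''a'')) (Assign ''R'' (Num 0) (Times (Var ''R'') (Var ''k''))))
     (For ''j'' (Times (Var ''k'') (Var ''k'')) (Seq (Assign ''Q'' (Num 0) (Num 1))
       (Seq (For ''i'' (Var ''k'') (Assign ''Q'' (Num 0) (Times (Var ''Q'') (Plus (Var ''j'') (Num 1)))))
        (Assign ''K'' (Num 0) (Plus (Var ''K'') (at_least (Var ''R'') (Var ''Q'')))))))))"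

text \<open>This is the floor of k powr (1 + m / k); candidates up to k * k are enough as long as m
  <= k.\<close>

definition power_bound :: "nat \<Rightarrow> nat \<Rightarrow> nat" where
  "power_bound k m = (\<Sum>v<k * k. of_bool (Suc v ^ k \<le> k ^ (k + m)))"

text \<open>The set being counted is an initial segment of the positive integers.\<close>

lemma le_power_bound_iff:
  assumes k: "1 \<le> k" and m: "m \<le> k"
  shows "x \<le> power_bound k m \<longleftrightarrow> x ^ k \<le> k ^ (k + m)"
proof -
  define A where "A = {v. v < k * k \<and> Suc v ^ k \<le> k ^ (k + m)}"
  have pb: "power_bound k m = card A"
    by (simp add: power_bound_def A_def of_bool_def sum.If_cases Int_def)
  have fin: "finite A" by (simp add: A_def)
  show ?thesis
  proof (cases "x ^ k \<le> k ^ (k + m)")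
    case True
    have "k ^ (k + m) \<le> k ^ (2 * k)" using k m by (intro power_increasing) auto
    also have "\<dots> = (k * k) ^ k" by (simp add: power_mult power2_eq_square)
    finally have "x ^ k \<le> (k * k) ^ k" using True by linarith
    then have xk: "x \<le> k * k" using k by (simp add: power_mono_iff)
    have "{..<x} \<subseteq> A"
    proof
      fix v assume "v \<in> {..<x}"
      then have v: "Suc v \<le> x" by simp
      then have "Suc v ^ k \<le> x ^ k" by (intro power_mono) auto
      then show "v \<in> A" using v xk True by (simp add: A_def)
    qed
    then have "card {..<x} \<le> card A" using fin by (intro card_mono)
    then show ?thesis using True pb by simp
  next
    case False
    have "A \<subseteq> {..<x - 1}"
    proof
      fix v assume v: "v \<in> A"
      have "Suc v < x"
      proof (rule ccontr)
        assume "\<not> Suc v < x"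
        then have "x ^ k \<le> Suc v ^ k" by (intro power_mono) auto
        then show False using v False by (simp add: A_def)
      qed
      then show "v \<in> {..<x - 1}" by simp
    qed
    then have "card A \<le> x - 1" using card_mono[of "{..<x - 1}" A] by simp
    moreover have "x \<noteq> 0" using False k by (cases x) (auto simp: zero_power)
    ultimately show ?thesis using False pb by simp
  qed
qed

definition power_time :: "nat \<Rightarrow> nat" where
  "power_time k = 2 + (2 + ((2 * k * (2 + 5) + 4) +
     (k * k * ((2 + ((k * (2 + 5) + 4) + 2 + 1) + 1) + 5) + 4) + 1) + 1) + 1"

context word_bound
begin

lemma runs_times:
  assumes "bounded s" "s ''k'' 0 = k" "s ''p'' 0 = p" "s ''q'' 0 = q" "(q + p) * k div q < 2 ^ B"
  shows "runs times_prog 2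
    (\<lambda>t. t ''K'' 0 = (q + p) * k div q \<and> (\<forall>y. y \<noteq> ''K'' \<longrightarrow> t y = s y)) s"
  unfolding times_prog_def using assms by (intro runs_Assign) auto

text \<open>The largest numbers that occur are k^(k + m) and (j + 1)^k with j < k * k. Both are at
  most k^(2 k), which is why \<open>big\<close> speaks of this power.\<close>

lemma runs_power:
  assumes m_def: "m = min (k * p div q) k"
    and s: "bounded s" "s ''k'' 0 = k" "s ''p'' 0 = p" "s ''q'' 0 = q" "s ''K'' 0 = 0"
    and k: "1 \<le> k" and big: "k ^ (2 * k) < 2 ^ B" "2 * k < 2 ^ B"
  shows "runs power_prog (power_time k)
    (\<lambda>t. t ''K'' 0 = power_bound k m \<and>
      (\<forall>y. y \<notin> {''a'', ''R'', ''Q'', ''K'', ''i'', ''j''} \<longrightarrow> t y = s y)) s"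
  unfolding power_prog_def power_time_def
proof (rule runs_Seq)
  let ?fr = "\<lambda>t. \<forall>y. y \<notin> {''a'', ''R'', ''Q'', ''K'', ''i'', ''j''} \<longrightarrow> t y = s y"
  have mk: "m \<le> k" by (simp add: m_def)
  have B1: "1 < (2::nat) ^ B" using B by (intro one_less_power) auto
  have kk: "(k * k) ^ k < 2 ^ B" using big by (simp add: power_mult power2_eq_square)
  have "k * k \<le> (k * k) ^ k" using k by (intro self_le_power) auto
  then have k2: "k * k < 2 ^ B" using kk by linarith
  show "runs (Assign ''a'' (Num 0) (Minus (Quot (Times (Var ''k'') (Var ''p'')) (Var ''q''))
       (Minus (Quot (Times (Var ''k'') (Var ''p'')) (Var ''q'')) (Var ''k'')))) 2
    (\<lambda>t. t ''a'' 0 = m \<and> t ''K'' 0 = 0 \<and> ?fr t) s"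
  proof (rule runs_Assign_eq)
    show "val (Minus (Quot (Times (Var ''k'') (Var ''p'')) (Var ''q''))
       (Minus (Quot (Times (Var ''k'') (Var ''p'')) (Var ''q'')) (Var ''k''))) s = m"
      using s by (simp add: m_def)
    show "m < 2 ^ B" using mk big by linarith
  qed (use s in auto)
  fix s1 assume s1: "bounded s1" "s1 ''a'' 0 = m \<and> s1 ''K'' 0 = 0 \<and> ?fr s1"
  let ?fi = "For ''i'' (Plus (Var ''k'') (Var ''a'')) (Assign ''R'' (Num 0) (Times (Var ''R'') (Var ''k'')))"
  let ?fq = "For ''i'' (Var ''k'') (Assign ''Q'' (Num 0) (Times (Var ''Q'') (Plus (Var ''j'') (Num 1))))"
  let ?ak = "Assign ''K'' (Num 0) (Plus (Var ''K'') (at_least (Var ''R'') (Var ''Q'')))"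
  let ?fj = "For ''j'' (Times (Var ''k'') (Var ''k'')) (Seq (Assign ''Q'' (Num 0) (Num 1)) (Seq ?fq ?ak))"
  let ?J = "\<lambda>t. t ''R'' 0 = k ^ (k + m) \<and> ?fr t"
  show "runs (Seq (Assign ''R'' (Num 0) (Num 1)) (Seq ?fi ?fj))
    (2 + ((2 * k * (2 + 5) + 4) + (k * k * ((2 + ((k * (2 + 5) + 4) + 2 + 1) + 1) + 5) + 4) + 1) + 1)
    (\<lambda>t. t ''K'' 0 = power_bound k m \<and> ?fr t) s1"
  proof (rule runs_Seq)
    show "runs (Assign ''R'' (Num 0) (Num 1)) 2
      (\<lambda>t. t ''R'' 0 = 1 \<and> t ''a'' 0 = m \<and> t ''K'' 0 = 0 \<and> ?fr t) s1"
      using s1 B1 by (intro runs_Assign) auto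
    fix s2 assume s2: "bounded s2" "s2 ''R'' 0 = 1 \<and> s2 ''a'' 0 = m \<and> s2 ''K'' 0 = 0 \<and> ?fr s2"
    show "runs (Seq ?fi ?fj) ((2 * k * (2 + 5) + 4) +
      (k * k * ((2 + ((k * (2 + 5) + 4) + 2 + 1) + 1) + 5) + 4) + 1)
      (\<lambda>t. t ''K'' 0 = power_bound k m \<and> ?fr t) s2"
    proof (rule runs_Seq)
      show "runs ?fi (2 * k * (2 + 5) + 4) (\<lambda>t. t ''K'' 0 = 0 \<and> ?J t) s2"
      proof (rule runs_For[where M = "k + m" and
          I = "\<lambda>j t. t ''R'' 0 = k ^ j \<and> t ''a'' 0 = m \<and> t ''K'' 0 = 0 \<and> ?fr t"])
        fix j t assume j: "j < k + m" and t: "bounded t"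
          "t ''R'' 0 = k ^ j \<and> t ''a'' 0 = m \<and> t ''K'' 0 = 0 \<and> ?fr t" "t ''i'' 0 = j"
        have "k ^ Suc j \<le> k ^ (2 * k)" using k j mk by (intro power_increasing) auto
        then have b: "k ^ Suc j < 2 ^ B" using big by linarith
        have tk: "t ''k'' 0 = k" using t s by auto
        show "runs (Assign ''R'' (Num 0) (Times (Var ''R'') (Var ''k''))) 2
          (\<lambda>t. (t ''R'' 0 = k ^ Suc j \<and> t ''a'' 0 = m \<and> t ''K'' 0 = 0 \<and> ?fr t) \<and> t ''i'' 0 = j) t"
        proof (rule runs_Assign_eq)
          show "val (Times (Var ''R'') (Var ''k'')) t = k ^ Suc j" using t(2) tk by (simp add: mult.commute)
        qed (use t b in auto)
      qed (use s s2 mk big in auto)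
      fix s3 assume s3: "bounded s3" "s3 ''K'' 0 = 0 \<and> ?J s3"
      define C :: "nat \<Rightarrow> nat" where "C j = (\<Sum>v<j. of_bool (Suc v ^ k \<le> k ^ (k + m)))" for j
      show "runs ?fj (k * k * ((2 + ((k * (2 + 5) + 4) + 2 + 1) + 1) + 5) + 4)
        (\<lambda>t. t ''K'' 0 = power_bound k m \<and> ?fr t) s3"
      proof (rule runs_For[where M = "k * k" and I = "\<lambda>j t. t ''K'' 0 = C j \<and> ?J t"])
        fix j s4 assume j: "j < k * k" and s4: "bounded s4" "s4 ''K'' 0 = C j \<and> ?J s4" "s4 ''j'' 0 = j"
        show "runs (Seq (Assign ''Q'' (Num 0) (Num 1)) (Seq ?fq ?ak)) (2 + ((k * (2 + 5) + 4) + 2 + 1) + 1)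
          (\<lambda>t. (t ''K'' 0 = C (Suc j) \<and> ?J t) \<and> t ''j'' 0 = j) s4"
        proof (rule runs_Seq)
          show "runs (Assign ''Q'' (Num 0) (Num 1)) 2
            (\<lambda>t. t ''Q'' 0 = 1 \<and> t ''K'' 0 = C j \<and> t ''j'' 0 = j \<and> ?J t) s4"
            using s4 B1 by (intro runs_Assign) auto
          fix s5 assume s5: "bounded s5" "s5 ''Q'' 0 = 1 \<and> s5 ''K'' 0 = C j \<and> s5 ''j'' 0 = j \<and> ?J s5"
          show "runs (Seq ?fq ?ak) ((k * (2 + 5) + 4) + 2 + 1)
            (\<lambda>t. (t ''K'' 0 = C (Suc j) \<and> ?J t) \<and> t ''j'' 0 = j) s5"
          proof (rule runs_Seq)
            show "runs ?fq (k * (2 + 5) + 4)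
              (\<lambda>t. t ''Q'' 0 = Suc j ^ k \<and> t ''K'' 0 = C j \<and> t ''j'' 0 = j \<and> ?J t) s5"
            proof (rule runs_For[where M = k and
                I = "\<lambda>i t. t ''Q'' 0 = Suc j ^ i \<and> t ''K'' 0 = C j \<and> t ''j'' 0 = j \<and> ?J t"])
              fix i t assume i: "i < k" and t: "bounded t"
                "t ''Q'' 0 = Suc j ^ i \<and> t ''K'' 0 = C j \<and> t ''j'' 0 = j \<and> ?J t" "t ''i'' 0 = i"
              have "Suc j ^ Suc i \<le> Suc j ^ k" using i by (intro power_increasing) auto
              also have "\<dots> \<le> (k * k) ^ k" using j by (intro power_mono) auto
              finally have b: "Suc j ^ Suc i < 2 ^ B" using kk by linarith
              show "runs (Assign ''Q'' (Num 0) (Times (Var ''Q'') (Plus (Var ''j'') (Num 1)))) 2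
                (\<lambda>t. (t ''Q'' 0 = Suc j ^ Suc i \<and> t ''K'' 0 = C j \<and> t ''j'' 0 = j \<and> ?J t) \<and> t ''i'' 0 = i) t"
              proof (rule runs_Assign_eq)
                show "val (Times (Var ''Q'') (Plus (Var ''j'') (Num 1))) t = Suc j ^ Suc i"
                  using t(2) by (simp add: mult.commute)
              qed (use t b in auto)
            qed (use s s5 big in auto)
            fix s6 assume s6: "bounded s6"
              "s6 ''Q'' 0 = Suc j ^ k \<and> s6 ''K'' 0 = C j \<and> s6 ''j'' 0 = j \<and> ?J s6"
            have "C (Suc j) \<le> (\<Sum>v<Suc j. 1)" unfolding C_def by (intro sum_mono) auto
            then have b: "C (Suc j) < 2 ^ B" using j k2 by simp
            show "runs ?ak 2 (\<lambda>t. (t ''K'' 0 = C (Suc j) \<and> ?J t) \<and> t ''j'' 0 = j) s6"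
            proof (rule runs_Assign_eq)
              show "val (Plus (Var ''K'') (at_least (Var ''R'') (Var ''Q''))) s6 = C (Suc j)"
                using s6(2) by (simp add: C_def)
            qed (use s6 b in auto)
          qed
        qed
      next
        show "s3 ''K'' 0 = C 0 \<and> ?J s3" using s3 by (simp add: C_def)
        show "t ''K'' 0 = power_bound k m \<and> ?fr t" if "t ''K'' 0 = C (k * k) \<and> ?J t" for t
          using that by (simp add: C_def power_bound_def)
      qed (use s s3 k2 in auto)
    qed
  qed
qed

end

section \<open>Graphs as input\<close>

locale input_graph =
  fixes n :: nat and E :: "nat set set"
  assumes simple: "simple_graph {..<n} E" and conn: "connected_graph {..<n} E"
    and E_ne: "E \<noteq> {}"
begin

definition adj :: "nat \<Rightarrow> nat" where
  "adj l = (if l < n * n \<and> {l div n, l mod n} \<in> E then 1 else 0)"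

definition a :: "nat \<Rightarrow> nat \<Rightarrow> real" where
  "a u w = of_bool ({u, w} \<in> E)"

lemma edgeE: "e \<in> E \<Longrightarrow> \<exists>u w. u < n \<and> w < n \<and> u \<noteq> w \<and> e = {u, w}"
  using simple unfolding simple_graph_def by fastforce

lemma finite_E: "finite E"
proof (rule finite_subset)
  show "E \<subseteq> Pow {..<n}" using edgeE by fastforce
qed simp

section \<open>The input graph as a weighted graph\<close>

lemma deg_eq: "deg E v = (\<Sum>w<n. of_bool ({v, w} \<in> E))"
proof -
  have "{e \<in> E. v \<in> e} = (\<lambda>w. {v, w}) ` {w. w < n \<and> {v, w} \<in> E}"
  proof safe
    fix e assume e: "e \<in> E" "v \<in> e"
    then obtain u w where uw: "u < n" "w < n" "e = {u, w}" using edgeE by blast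
    show "e \<in> (\<lambda>w. {v, w}) ` {w. w < n \<and> {v, w} \<in> E}"
      using e uw by (cases "v = u") (auto simp: insert_commute)
  qed
  moreover have "inj_on (\<lambda>w. {v, w}) {w. w < n \<and> {v, w} \<in> E}"
    by (auto simp: inj_on_def doubleton_eq_iff)
  ultimately have "deg E v = card {w. w < n \<and> {v, w} \<in> E}"
    by (simp add: deg_def card_image)
  then show ?thesis by (simp add: of_bool_def sum.If_cases Int_def)
qed

text \<open>One edge supplies two vertices, so there is one other than \<open>v\<close>; the first
  edge of a path to it is incident to \<open>v\<close>.\<close>

lemma deg_pos:
  assumes v: "v < n"
  shows "1 \<le> deg E v"
proof -
  obtain e where "e \<in> E" using E_ne by blast
  then obtain x y where xy: "x < n" "y < n" "x \<noteq> y" using edgeE by blast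
  obtain z where z: "z < n" "z \<noteq> v" using xy by metis
  have "(v, z) \<in> {(x, y). {x, y} \<in> E}\<^sup>*" using conn v z by (simp add: connected_graph_def)
  then obtain w where "{v, w} \<in> E" using z by (auto elim: converse_rtranclE)
  then have "{v, w} \<in> {e \<in> E. v \<in> e}" by simp
  then have "{e \<in> E. v \<in> e} \<noteq> {}" by blast
  then show ?thesis using finite_E by (simp add: deg_def Suc_le_eq card_gt_0_iff)
qed

sublocale weighted_graph "{..<n}" a
proof
  show "1 \<le> (\<Sum>w<n. a u w)" if "u \<in> {..<n}" for u
  proof -
    have "real (deg E u) = (\<Sum>w<n. a u w)" by (simp add: deg_eq a_def)
    then show ?thesis using deg_pos[of u] that by simp
  qed
qed (auto simp: a_def insert_commute)

lemma d_eq: "d u = real (deg E u)"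
  by (simp add: d_def deg_eq a_def)

lemma wvol_eq: "wvol S = real (vol E S)"
  by (simp add: wvol_def vol_def d_eq)

lemma card_boundary:
  assumes S: "S \<subseteq> {..<n}"
  shows "card (edge_boundary E S) = (\<Sum>u\<in>S. \<Sum>w\<in>{..<n} - S. of_bool ({u, w} \<in> E))"
proof -
  let ?P = "{p \<in> S \<times> ({..<n} - S). {fst p, snd p} \<in> E}"
  have fin: "finite S" using S finite_subset by blast
  have "edge_boundary E S = (\<lambda>p. {fst p, snd p}) ` ?P"
  proof (intro equalityI subsetI)
    fix e assume "e \<in> edge_boundary E S"
    then have e: "e \<in> E" "\<exists>!v. v \<in> e \<and> v \<in> S" by (auto simp: edge_boundary_def)
    obtain x y where xy: "x < n" "y < n" "x \<noteq> y" "e = {x, y}" using edgeE[OF e(1)] by blast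
    show "e \<in> (\<lambda>p. {fst p, snd p}) ` ?P"
    proof (cases "x \<in> S")
      case True
      then have "y \<notin> S" using e(2) xy by blast
      then show ?thesis using True xy e(1) by (intro image_eqI[of _ _ "(x, y)"]) auto
    next
      case False
      then have "y \<in> S" using e(2) xy by blast
      then show ?thesis using False xy e(1)
        by (intro image_eqI[of _ _ "(y, x)"]) (auto simp: insert_commute)
    qed
  next
    fix e assume "e \<in> (\<lambda>p. {fst p, snd p}) ` ?P"
    then show "e \<in> edge_boundary E S" by (auto simp: edge_boundary_def)
  qed
  moreover have "inj_on (\<lambda>p. {fst p, snd p}) ?P" by (auto simp: inj_on_def doubleton_eq_iff)
  ultimately have "card (edge_boundary E S) = card ?P" by (simp add: card_image)
  also have "\<dots> = (\<Sum>p\<in>S \<times> ({..<n} - S). of_bool ({fst p, snd p} \<in> E))"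
    using fin by (simp add: of_bool_def sum.If_cases Int_def)
  also have "\<dots> = (\<Sum>u\<in>S. \<Sum>w\<in>{..<n} - S. of_bool ({u, w} \<in> E))"
    by (subst sum.cartesian_product) (auto intro: sum.cong)
  finally show ?thesis .
qed

lemma cut_eq: "S \<subseteq> {..<n} \<Longrightarrow> cut S = real (card (edge_boundary E S))"
  by (simp add: card_boundary cut_def a_def)

lemma conductance_eq: "S \<subseteq> {..<n} \<Longrightarrow> conductance E S = cut S / wvol S"
  by (simp add: conductance_def cut_eq wvol_eq)

lemma handshake: "vol E {..<n} = 2 * card E"
proof -
  have "vol E {..<n} = (\<Sum>v<n. \<Sum>e\<in>E. of_bool (v \<in> e))"
    unfolding vol_def deg_def using finite_E by (simp add: of_bool_def sum.If_cases Int_def)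
  also have "\<dots> = (\<Sum>e\<in>E. \<Sum>v<n. of_bool (v \<in> e))" by (rule sum.swap)
  also have "\<dots> = (\<Sum>e\<in>E. 2)"
  proof (rule sum.cong[OF refl])
    fix e assume "e \<in> E"
    then obtain x y where xy: "x < n" "y < n" "x \<noteq> y" "e = {x, y}" using edgeE by blast
    then have "{v. v < n \<and> v \<in> e} = {x, y}" by auto
    then have "card {v. v < n \<and> v \<in> e} = 2" using xy by simp
    then show "(\<Sum>v<n. of_bool (v \<in> e)) = (2::nat)" by (simp add: of_bool_def sum.If_cases Int_def)
  qed
  finally show ?thesis by simp
qed

text \<open>By \<open>handshake\<close> the total volume is twice \<open>card E\<close>, so
  \<open>S\<close> misses a vertex. With an empty boundary everything reachable from a vertex of
  \<open>S\<close> would lie in \<open>S\<close>, against connectivity.\<close>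

lemma cut_ge_1:
  assumes S: "S \<subseteq> {..<n}" "S \<noteq> {}" and v: "vol E S \<le> card E"
  shows "1 \<le> cut S"
proof -
  have "card E \<noteq> 0" using finite_E E_ne by simp
  then have "S \<noteq> {..<n}" using v handshake by auto
  then obtain y where y: "y < n" "y \<notin> S" using S by auto
  obtain x where x: "x \<in> S" using S by blast
  have "edge_boundary E S \<noteq> {}"
  proof
    assume none: "edge_boundary E S = {}"
    have "z \<in> S" if "(x, z) \<in> {(x, y). {x, y} \<in> E}\<^sup>*" for z
      using that
    proof (induction rule: rtrancl_induct)
      case (step z w)
      have "w \<in> S"
      proof (rule ccontr)
        assume "w \<notin> S"
        then have "\<exists>!v. v \<in> {z, w} \<and> v \<in> S" using step by auto
        then have "{z, w} \<in> edge_boundary E S" using step by (simp add: edge_boundary_def)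
        then show False using none by blast
      qed
      then show ?case .
    qed (rule x)
    moreover have "(x, y) \<in> {(x, y). {x, y} \<in> E}\<^sup>*"
      using conn x S y by (auto simp: connected_graph_def)
    ultimately show False using y by blast
  qed
  moreover have "finite (edge_boundary E S)" using finite_E by (simp add: edge_boundary_def)
  ultimately have "1 \<le> card (edge_boundary E S)" by (simp add: Suc_le_eq card_gt_0_iff)
  then show ?thesis using cut_eq[OF S(1)] by simp
qed

section \<open>Program quantities in terms of the graph\<close>

lemma adj_eq:
  assumes "u < n" "w < n"
  shows "adj (u * n + w) = of_bool ({u, w} \<in> E)"
proof -
  have "u * n + w < Suc u * n" using assms by simp
  also have "\<dots> \<le> n * n" using assms by (intro mult_le_mono1) simp
  finally show ?thesis using assms by (simp add: adj_def)
qed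

lemma rowsum_eq: "u < n \<Longrightarrow> rowsum n adj u = deg E u"
  by (simp add: rowsum_def deg_eq adj_eq)

lemma deg_le: "deg E u \<le> n"
proof -
  have "deg E u \<le> (\<Sum>w<n. 1)" unfolding deg_eq by (intro sum_mono) auto
  then show ?thesis by simp
qed

lemma deg_dvd_fact: "u < n \<Longrightarrow> deg E u dvd fact n"
  using deg_pos deg_le by (intro dvd_fact) auto

text \<open>Every degree is at most n and so divides n!, which makes the integer division exact. The
  factor 2 is the halving in \<open>lazy\<close>, which the program leaves out.\<close>

lemma scaled_step_eq:
  assumes u: "u < n" and f: "\<And>w. w < n \<Longrightarrow> real (f w) = c * g w"
  shows "real (scaled_step n adj f u) = 2 * fact n * c * lazy g u"
proof -
  have q: "real (fact n div deg E u) = fact n / d u"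
    using deg_dvd_fact[OF u] by (simp add: real_of_nat_div d_eq)
  have "real (scaled_step n adj f u) = fact n * (c * g u) + (\<Sum>w<n. fact n / d u * a u w * (c * g w))"
    using u f by (simp add: scaled_step_def rowsum_eq adj_eq q a_def)
  also have "(\<Sum>w<n. fact n / d u * a u w * (c * g w)) = fact n * c * ((\<Sum>w<n. a u w * g w) / d u)"
    by (simp add: sum_distrib_left sum_divide_distrib mult_ac)
  finally show ?thesis by (simp add: lazy_def algebra_simps)
qed

text \<open>The factor \<open>d v\<close> is there because the program starts with the value 1 at
  \<open>v\<close> instead of the density 1 / d v.\<close>

lemma scaled_walk_eq:
  "u < n \<Longrightarrow> v < n \<Longrightarrow> real (scaled_walk n adj v t u) = (2 * fact n) ^ t * d v * walk v t u"
proof (induction t arbitrary: u)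
  case 0
  then show ?case using d_pos[of v] by (simp add: scaled_walk_0 walk_0 start_def)
next
  case (Suc t)
  show ?case
    using scaled_step_eq[OF Suc.prems(1) Suc.IH[OF _ Suc.prems(2)]]
    by (simp add: scaled_walk_Suc walk_Suc mult_ac)
qed

text \<open>The integer weights in a row sum to at most n!, so the maximum grows by a factor of at
  most 2 n! per step and the number of digits only linearly in time.\<close>

lemma scaled_step_le:
  assumes u: "u < n" and f: "\<And>w. w < n \<Longrightarrow> f w \<le> M"
  shows "scaled_step n adj f u \<le> 2 * fact n * M"
proof -
  have "(\<Sum>w<n. fact n div rowsum n adj u * adj (u * n + w) * f w)
      \<le> (\<Sum>w<n. fact n div rowsum n adj u * adj (u * n + w) * M)"
    using f by (intro sum_mono mult_le_mono2) auto
  also have "\<dots> = fact n div rowsum n adj u * rowsum n adj u * M"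
    by (simp add: rowsum_def sum_distrib_left sum_distrib_right)
  also have "\<dots> \<le> fact n * M" by (intro mult_le_mono1) simp
  finally have "(\<Sum>w<n. fact n div rowsum n adj u * adj (u * n + w) * f w) \<le> fact n * M" .
  moreover have "fact n * f u \<le> fact n * M" using f[OF u] by (rule mult_le_mono2)
  ultimately have "scaled_step n adj f u \<le> fact n * M + fact n * M"
    unfolding scaled_step_def by (rule add_mono[rotated])
  then show ?thesis by simp
qed

lemma scaled_walk_le: "u < n \<Longrightarrow> scaled_walk n adj v t u \<le> (2 * fact n) ^ t"
proof (induction t arbitrary: u)
  case 0
  then show ?case by (simp add: scaled_walk_0)
next
  case (Suc t)
  then show ?case using scaled_step_le[of u "scaled_walk n adj v t" "(2 * fact n) ^ t"]
    by (simp add: scaled_walk_Suc)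
qed

text \<open>For fixed start and time the scaling factor is positive and common to all vertices, so
  it does not affect comparisons.\<close>

lemma cset_eq_level:
  assumes "v < n" "u < n"
  shows "cset n adj (v, t, u) = level (walk v t) u"
proof -
  have p: "0 < (2 * fact n) ^ t * d v" using d_pos assms by simp
  have "scaled_walk n adj v t u \<le> scaled_walk n adj v t w \<longleftrightarrow> walk v t u \<le> walk v t w" if "w < n" for w
  proof -
    have "scaled_walk n adj v t u \<le> scaled_walk n adj v t w \<longleftrightarrow>
      (2 * fact n) ^ t * d v * walk v t u \<le> (2 * fact n) ^ t * d v * walk v t w"
      using scaled_walk_eq[of u v t] scaled_walk_eq[of w v t] assms that by (metis of_nat_le_iff)
    then show ?thesis by (simp only: mult_le_cancel_left_pos[OF p])
  qed
  then show ?thesis by (auto simp: cset_def level_def)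
qed

lemma cset_sub: "cset n adj c \<subseteq> {..<n}"
  by (cases c) (auto simp: cset_def)

lemma sum_rows:
  fixes g :: "nat \<Rightarrow> nat"
  shows "(\<Sum>l<n * n. g l) = (\<Sum>u<n. \<Sum>w<n. g (u * n + w))"
proof -
  have "(\<Sum>l<n * n. g l) = (\<Sum>l<n * n. \<Sum>u<n. if l div n = u then g l else 0)"
  proof (intro sum.cong refl)
    fix l assume "l \<in> {..<n * n}"
    then have "l div n < n" by (cases "n = 0") (auto simp: div_less_iff_less_mult)
    then show "g l = (\<Sum>u<n. if l div n = u then g l else 0)" by simp
  qed
  also have "\<dots> = (\<Sum>u<n. \<Sum>l<n * n. if l div n = u then g l else 0)" by (rule sum.swap)
  finally show ?thesis by (simp add: sum_row)
qed

lemma cvol_eq: "cvol n adj c = vol E (cset n adj c)"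
proof -
  let ?S = "cset n adj c"
  have "cvol n adj c = (\<Sum>u<n. \<Sum>w<n. of_bool (u \<in> ?S) * adj (u * n + w))"
    unfolding cvol_def sum_rows by (intro sum.cong refl) auto
  also have "\<dots> = (\<Sum>u<n. if u \<in> ?S then deg E u else 0)"
    by (intro sum.cong refl) (auto simp: rowsum_def rowsum_eq[symmetric])
  also have "\<dots> = vol E ?S"
    unfolding vol_def using cset_sub[of c] by (simp add: sum.If_cases Int_absorb1 Int_commute)
  finally show ?thesis .
qed

lemma cbd_eq: "cbd n adj c = card (edge_boundary E (cset n adj c))"
proof -
  let ?S = "cset n adj c"
  have "cbd n adj c = (\<Sum>u<n. \<Sum>w<n. of_bool (u \<in> ?S) * (1 - of_bool (w \<in> ?S)) * adj (u * n + w))"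
    unfolding cbd_def sum_rows by (intro sum.cong refl) auto
  also have "\<dots> = (\<Sum>u<n. if u \<in> ?S then (\<Sum>w\<in>{..<n} - ?S. of_bool ({u, w} \<in> E)) else 0)"
  proof (intro sum.cong refl)
    fix u assume u: "u \<in> {..<n}"
    have "(\<Sum>w<n. (1 - of_bool (w \<in> ?S)) * adj (u * n + w)) = (\<Sum>w\<in>{..<n} - ?S. of_bool ({u, w} \<in> E))"
      using u by (intro sum.mono_neutral_cong_right) (auto simp: adj_eq)
    then show "(\<Sum>w<n. of_bool (u \<in> ?S) * (1 - of_bool (w \<in> ?S)) * adj (u * n + w)) =
      (if u \<in> ?S then (\<Sum>w\<in>{..<n} - ?S. of_bool ({u, w} \<in> E)) else 0)" by simp
  qed
  also have "\<dots> = card (edge_boundary E ?S)"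
    unfolding card_boundary[OF cset_sub] using cset_sub[of c]
    by (simp add: sum.If_cases Int_absorb1 Int_commute)
  finally show ?thesis .
qed

lemma cvol_pos: "v < n \<Longrightarrow> u < n \<Longrightarrow> 0 < cvol n adj (v, t, u)"
proof -
  assume vu: "v < n" "u < n"
  have "u \<in> cset n adj (v, t, u)" using vu by (simp add: cset_def)
  then have "deg E u \<le> vol E (cset n adj (v, t, u))" unfolding vol_def
    using finite_subset[OF cset_sub] by (intro member_le_sum) auto
  then show ?thesis using deg_pos[OF vu(2)] cvol_eq by simp
qed

lemma small_conductance_attained:
  assumes "small_sets {..<n} E k \<noteq> {}"
  shows "\<exists>S\<in>small_sets {..<n} E k. small_conductance {..<n} E k = conductance E S"
proof -
  have "finite (small_sets {..<n} E k)"
    by (rule finite_subset[of _ "Pow {..<n}"]) (auto simp: small_sets_def)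
  then have "Min (conductance E ` small_sets {..<n} E k) \<in> conductance E ` small_sets {..<n} E k"
    using assms by (intro Min_in) auto
  then show ?thesis unfolding small_conductance_def by auto
qed

context
  fixes k K T :: nat and t :: store
  assumes kE: "k \<le> card E" and kK: "k \<le> K" and ne: "small_sets {..<n} E k \<noteq> {}"
    and T: "k * k < T"
    and best: "best n adj K {(v, t, u). v < n \<and> t < T \<and> u < n} t"
begin

text \<open>For \<open>v\<close> in a set of volume at most \<open>k\<close>, the level set of
  \<open>v\<close> at time 0 is the singleton of \<open>v\<close>, whose volume is at most k <= K.
  This rules out the alternative of \<open>best\<close> in which nothing was found.\<close>

lemma best_candidate:
  obtains c where "output_set n t = cset n adj c" "output_set n t \<noteq> {}" "vol E (output_set n t) \<le> K"
    "0 < cvol n adj c"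
    "\<And>v s u. v < n \<Longrightarrow> s < T \<Longrightarrow> u < n \<Longrightarrow> cvol n adj (v, s, u) \<le> K \<Longrightarrow>
      cbd n adj c * cvol n adj (v, s, u) \<le> cbd n adj (v, s, u) * cvol n adj c"
proof -
  let ?X = "{(v, t, u). v < n \<and> t < T \<and> u < n}"
  obtain S where S: "S \<subseteq> {..<n}" "S \<noteq> {}" "vol E S \<le> k" using ne by (auto simp: small_sets_def)
  then obtain v where v: "v \<in> S" by blast
  have vn: "v < n" using v S by blast
  have "cset n adj (v, 0, v) = {v}" using vn by (auto simp: cset_def scaled_walk_0)
  then have "cvol n adj (v, 0, v) = deg E v" by (simp add: cvol_eq vol_def)
  also have "\<dots> \<le> vol E S" unfolding vol_def
    using finite_subset[OF S(1)] v by (intro member_le_sum) auto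
  also have "\<dots> \<le> K" using S kK by simp
  finally have "cvol n adj (v, 0, v) \<le> K" .
  moreover have "(v, 0, v) \<in> ?X" using vn T by simp
  ultimately have "\<not> (\<forall>c\<in>?X. K < cvol n adj c)" by (metis linorder_not_less)
  then obtain c where c: "c \<in> ?X" "cvol n adj c \<le> K" "0 < cvol n adj c"
      "\<forall>w<n. t ''S'' w \<noteq> 0 \<longleftrightarrow> w \<in> cset n adj c"
      "\<forall>c'\<in>?X. cvol n adj c' \<le> K \<longrightarrow> cbd n adj c * cvol n adj c' \<le> cbd n adj c' * cvol n adj c"
    using best unfolding best_def by blast
  have o: "output_set n t = cset n adj c" using c(4) cset_sub[of c] by (auto simp: output_set_def)
  show thesis
  proof (rule that[OF o])
    show "output_set n t \<noteq> {}" using c(3) o by (auto simp: cvol_eq vol_def)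
    show "vol E (output_set n t) \<le> K" using c(2) by (simp add: o cvol_eq)
    show "0 < cvol n adj c" by (rule c(3))
    show "cbd n adj c * cvol n adj (v, s, u) \<le> cbd n adj (v, s, u) * cvol n adj c"
      if "v < n" "s < T" "u < n" "cvol n adj (v, s, u) \<le> K" for v s u
      using c(5) that by blast
  qed
qed

lemma output_basic:
  "output_set n t \<noteq> {}" "vol E (output_set n t) \<le> K"
  "0 \<le> conductance E (output_set n t)" "conductance E (output_set n t) \<le> 1"
proof -
  obtain c where c: "output_set n t = cset n adj c" "output_set n t \<noteq> {}" "vol E (output_set n t) \<le> K"
    "0 < cvol n adj c"
    using best_candidate by metis
  then show "output_set n t \<noteq> {}" "vol E (output_set n t) \<le> K" by auto
  have sub: "output_set n t \<subseteq> {..<n}" using c cset_sub by simp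
  have "0 < wvol (output_set n t)" using c(4) by (simp add: wvol_eq c(1) cvol_eq)
  then show "0 \<le> conductance E (output_set n t)" "conductance E (output_set n t) \<le> 1"
    using cut_nonneg cut_le_wvol[OF sub] by (simp_all add: conductance_eq[OF sub])
qed

text \<open>\<open>Kr\<close> is the threshold of the analysis and may lie below the
  \<open>K\<close> of the program, a freedom that serves to keep \<open>l\<close> at most ln k.
  Minimality of the output among the candidates yields the expansion hypothesis of
  \<open>sweep_bound\<close>, with \<open>\<phi>\<close> the conductance of the output.\<close>

lemma output_conductance:
  fixes Kr :: real
  defines "l \<equiv> ln (Kr / k)"
  assumes k: "2 \<le> k" and Kr: "0 < Kr" "\<And>x. real x \<le> Kr \<Longrightarrow> x \<le> K"
    and l: "1 / (4 * real k) \<le> l" "l \<le> ln k"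
  shows "(conductance E (output_set n t))\<^sup>2 \<le> 176 * small_conductance {..<n} E k * ln k / l"
proof -
  obtain c where c: "output_set n t = cset n adj c" "0 < cvol n adj c"
    "\<And>v s u. v < n \<Longrightarrow> s < T \<Longrightarrow> u < n \<Longrightarrow> cvol n adj (v, s, u) \<le> K \<Longrightarrow>
      cbd n adj c * cvol n adj (v, s, u) \<le> cbd n adj (v, s, u) * cvol n adj c"
    using best_candidate by metis
  obtain S where S: "S \<subseteq> {..<n}" "S \<noteq> {}" "vol E S \<le> k"
    and sc: "small_conductance {..<n} E k = conductance E S"
    using small_conductance_attained[OF ne] by (auto simp: small_sets_def)
  define \<phi> where "\<phi> = conductance E (output_set n t)"
  have ph: "\<phi> = real (cbd n adj c) / real (cvol n adj c)"
    by (simp add: \<phi>_def conductance_def c(1) cbd_eq cvol_eq)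
  have "\<phi>\<^sup>2 \<le> 176 * (cut S / wvol S) * ln k / l"
    unfolding l_def
  proof (rule sweep_bound)
    show "2 \<le> real k" using k by simp
    show "wvol S \<le> real k" using S by (simp add: wvol_eq)
    show "1 \<le> local.cut S" using cut_ge_1[OF S(1,2)] S(3) kE by simp
    show "1 / (4 * real k) \<le> ln (Kr / real k)" "ln (Kr / real k) \<le> ln (real k)"
      using l by (simp_all add: l_def)
    show "0 \<le> \<phi>" "\<phi> \<le> 1" using output_basic by (simp_all add: \<phi>_def)
  next
    fix v s u assume a: "v \<in> {..<n}" "real s \<le> (real k)\<^sup>2" "u \<in> {..<n}" "wvol (level (walk v s) u) \<le> Kr"
    let ?c = "(v, s, u)"
    have lev: "level (walk v s) u = cset n adj ?c" using a cset_eq_level by simp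
    have "real s \<le> real (k * k)" using a(2) by (simp add: power2_eq_square)
    then have s: "s < T" using T by linarith
    have "cvol n adj ?c \<le> K" using a(4) Kr(2) by (simp add: lev cvol_eq wvol_eq)
    then have "cbd n adj c * cvol n adj ?c \<le> cbd n adj ?c * cvol n adj c" using c(3) a s by simp
    then have "real (cbd n adj c) * real (cvol n adj ?c) \<le> real (cbd n adj ?c) * real (cvol n adj c)"
      by (metis of_nat_le_iff of_nat_mult)
    then have "\<phi> * real (cvol n adj ?c) \<le> real (cbd n adj ?c)"
      using c(2) by (simp add: ph divide_le_eq)
    then show "\<phi> * wvol (level (walk v s) u) \<le> local.cut (level (walk v s) u)"
      by (simp add: lev cvol_eq cbd_eq wvol_eq cut_eq[OF cset_sub])
  qed (use S Kr in auto)
  then show ?thesis by (simp add: \<phi>_def sc conductance_eq[OF S(1)])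
qed

end

end

section \<open>Running time and guarantee\<close>

definition poly_bounded :: "(nat \<Rightarrow> nat) \<Rightarrow> bool" where
  "poly_bounded f \<longleftrightarrow> (\<exists>P :: nat poly. \<forall>x. f x \<le> poly P x)"

lemma poly_bounded_const: "poly_bounded (\<lambda>_. c)"
  unfolding poly_bounded_def by (intro exI[of _ "[:c:]"]) simp

lemma poly_bounded_id: "poly_bounded (\<lambda>x. x)"
  unfolding poly_bounded_def by (intro exI[of _ "[:0, 1:]"]) simp

lemma poly_bounded_add: "poly_bounded f \<Longrightarrow> poly_bounded g \<Longrightarrow> poly_bounded (\<lambda>x. f x + g x)"
  unfolding poly_bounded_def by (metis add_mono poly_add)

lemma poly_bounded_mult: "poly_bounded f \<Longrightarrow> poly_bounded g \<Longrightarrow> poly_bounded (\<lambda>x. f x * g x)"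
  unfolding poly_bounded_def by (metis mult_le_mono poly_mult)

lemmas poly_bounded_intros = poly_bounded_const poly_bounded_id poly_bounded_add poly_bounded_mult

lemma core_time_mono: "m \<le> m' \<Longrightarrow> T \<le> T' \<Longrightarrow> core_time m T \<le> core_time m' T'"
  unfolding core_time_def walk_time_def step_time_def sweep_time_def
  by (intro add_mono mult_le_mono order_refl)

lemma less_two_power_len: "x < 2 ^ len x"
  by (cases "x = 0") (auto simp: floorlog_bounds)

text \<open>A walk value is at most (2 n!)^(k^2 + 1), where n! <= 2^(z^2) and k <= z, so its
  exponent of two is at most (z^2 + 1)^2. The slightly larger square leaves room for strict
  inequalities and for the other numbers.\<close>

definition word_size :: "nat \<Rightarrow> nat" where
  "word_size z = (z * z + 2) * (z * z + 2)"

context input_graph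
begin

lemma card_E_le: "card E \<le> n * n"
proof -
  have "vol E {..<n} \<le> (\<Sum>v<n. n)" unfolding vol_def using deg_le by (intro sum_mono) auto
  then show ?thesis using handshake by simp
qed

context
  fixes k p q z :: nat
  assumes kE: "k \<le> card E" and z: "z = input_size n k p q"
begin

text \<open>The value of \<open>k\<close>, and not only its length, is bounded by \<open>z\<close>:
  k <= card E <= n * n, and the matrix is part of the input. For \<open>p\<close> and
  \<open>q\<close> only the lengths are bounded.\<close>

lemma sizes: "n \<le> z" "n * n \<le> z" "k \<le> z" "p < 2 ^ z" "q < 2 ^ z" "k \<le> 2 ^ z"
proof -
  show nn: "n * n \<le> z" by (simp add: z input_size_def)
  show "n \<le> z" using nn by (cases n) auto
  show kz: "k \<le> z" using kE card_E_le nn by linarith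
  then show "k \<le> 2 ^ z" using less_exp[of z] by linarith
  have "x < 2 ^ z" if "len x \<le> z" for x
    using less_le_trans[OF less_two_power_len power_increasing[OF that]] by simp
  then show "p < 2 ^ z" "q < 2 ^ z" by (simp_all add: z input_size_def)
qed

lemma word_bound_size: "word_bound (word_size z)"
  by unfold_locales (simp add: word_size_def)

lemma less_word:
  fixes x :: nat
  assumes "x \<le> 2 ^ e" "e < word_size z"
  shows "x < 2 ^ word_size z"
  by (rule le_less_trans[OF assms(1) power_strict_increasing[OF assms(2)]]) simp

lemma z_word: "z * z < word_size z" "(z * z + 1) * (z * z + 1) < word_size z" "2 * (z * z) < word_size z"
    "2 * z + 1 < word_size z" "z < word_size z"
proof -
  define y where "y = z * z"
  have "z \<le> y" by (cases z) (auto simp: y_def)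
  moreover have "word_size z = y * y + 4 * y + 4" by (simp add: word_size_def y_def algebra_simps)
  moreover have "(y + 1) * (y + 1) = y * y + 2 * y + 1" by (simp add: algebra_simps)
  ultimately show "z * z < word_size z" "(z * z + 1) * (z * z + 1) < word_size z" "2 * (z * z) < word_size z"
    "2 * z + 1 < word_size z" "z < word_size z"
    unfolding y_def[symmetric] by linarith+
qed

lemma input_bounded: "word_bound.bounded (word_size z) (input_store n E k p q)"
proof -
  interpret word_bound "word_size z" by (rule word_bound_size)
  have "n \<le> 2 ^ z" "k \<le> 2 ^ z" "p \<le> 2 ^ z" "q \<le> 2 ^ z"
    using sizes less_exp[of z] by (auto intro: less_imp_le order_trans)
  then have "n < 2 ^ word_size z" "k < 2 ^ word_size z" "p < 2 ^ word_size z" "q < 2 ^ word_size z"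
    using less_word z_word by blast+
  moreover have "1 < (2::nat) ^ word_size z" using B by (intro one_less_power) auto
  ultimately show ?thesis by (auto simp: bounded_def input_store_def)
qed

lemma sweep_run_input: "sweep_run (word_size z) n adj (k * k + 1)"
proof -
  interpret word_bound "word_size z" by (rule word_bound_size)
  have n2: "n \<le> 2 ^ z" using sizes(1) less_exp[of z] by linarith
  have "(fact n :: nat) \<le> n ^ n" using fact_le_power[of n, where 'a = nat] by simp
  also have "\<dots> \<le> (2 ^ z) ^ n" using n2 by (intro power_mono) auto
  also have "\<dots> \<le> (2 ^ z) ^ z" using sizes(1) by (intro power_increasing) auto
  finally have f: "fact n \<le> (2::nat) ^ (z * z)" by (simp add: power_mult)
  have kz: "k * k \<le> z * z" using sizes(3) by (intro mult_le_mono)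
  show ?thesis
  proof
    show "adj l \<le> 1" for l by (simp add: adj_def)
    show "n * n < 2 ^ word_size z"
      using le_trans[OF sizes(2) less_imp_le[OF less_exp]] z_word(5) by (rule less_word)
    show "fact n < (2::nat) ^ word_size z" by (rule less_word[OF f z_word(1)])
    have "k * k + 1 \<le> z * z + 1" using kz by simp
    also have "\<dots> \<le> 2 ^ (z * z + 1)" using less_exp[of "z * z + 1"] by linarith
    finally show "k * k + 1 < 2 ^ word_size z"
      by (rule less_word) (simp add: word_size_def)
    show "scaled_walk n adj v t u < 2 ^ word_size z" if "v < n" "t \<le> k * k + 1" "u < n" for v t u
    proof (rule less_word[OF _ z_word(2)])
      have "scaled_walk n adj v t u \<le> (2 * fact n) ^ t" using that by (intro scaled_walk_le)
      also have "\<dots> \<le> (2 ^ (z * z + 1)) ^ t" using f by (intro power_mono) auto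
      also have "\<dots> \<le> (2 ^ (z * z + 1)) ^ (z * z + 1)" using that kz by (intro power_increasing) auto
      finally show "scaled_walk n adj v t u \<le> 2 ^ ((z * z + 1) * (z * z + 1))"
        by (simp only: power_mult)
    qed
    show "0 < cvol n adj (v, t, u)" if "v < n" "u < n" for v t u using that by (rule cvol_pos)
  qed
qed

text \<open>The preceding program may change only the listed scratch cells. In particular
  \<open>deg\<close> and \<open>bv\<close> keep the zeros of the input store, on which
  \<open>core_prog\<close> relies.\<close>

lemma run_from_input:
  assumes pre: "word_bound.runs (word_size z) c N
    (\<lambda>t. t ''K'' 0 = K \<and> (\<forall>y. y \<notin> {''a'', ''R'', ''Q'', ''K'', ''i'', ''j''} \<longrightarrow> t y = input_store n E k p q y))
    (input_store n E k p q)" and N: "N \<le> N'"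
  shows "\<exists>T t. exec (Seq c core_prog) (input_store n E k p q) T t \<and>
    T \<le> (N' + core_time z (z * z + 1) + 1) * word_bound.unit (word_size z) \<and>
    best n adj K {(v, t, u). v < n \<and> t < k * k + 1 \<and> u < n} t"
proof -
  interpret sweep_run "word_size z" n adj K "k * k + 1" by (rule sweep_run_input)
  let ?s = "input_store n E k p q"
  have "runs (Seq c core_prog) (N + core_time n (k * k + 1) + 1)
    (best n adj K {(v, t, u). v < n \<and> t < k * k + 1 \<and> u < n}) ?s"
  proof (rule runs_Seq[OF pre])
    fix t assume t: "bounded t" "t ''K'' 0 = K \<and>
      (\<forall>y. y \<notin> {''a'', ''R'', ''Q'', ''K'', ''i'', ''j''} \<longrightarrow> t y = ?s y)"
    have "?s ''adj'' = adj" by (simp add: input_store_def adj_def fun_eq_iff)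
    then show "runs core_prog (core_time n (k * k + 1))
      (best n adj K {(v, t, u). v < n \<and> t < k * k + 1 \<and> u < n}) t"
      using t by (intro runs_core) (auto simp: input_store_def)
  qed
  moreover have "N + core_time n (k * k + 1) + 1 \<le> N' + core_time z (z * z + 1) + 1"
    using N sizes by (intro add_mono core_time_mono mult_le_mono) auto
  ultimately show ?thesis unfolding runs_def by (meson le_trans mult_le_mono1)
qed

lemma run_times:
  "\<exists>T t. exec (Seq times_prog core_prog) (input_store n E k p q) T t \<and>
    T \<le> (2 + core_time z (z * z + 1) + 1) * word_bound.unit (word_size z) \<and>
    best n adj ((q + p) * k div q) {(v, t, u). v < n \<and> t < k * k + 1 \<and> u < n} t"
proof (rule run_from_input)
  interpret word_bound "word_size z" by (rule word_bound_size)
  have "(q + p) * k div q \<le> (q + p) * k" by simp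
  also have "\<dots> \<le> (2 ^ z + 2 ^ z) * 2 ^ z"
    by (rule mult_le_mono[OF add_mono[OF less_imp_le[OF sizes(5)] less_imp_le[OF sizes(4)]] sizes(6)])
  also have "\<dots> = 2 ^ (2 * z + 1)" by (simp add: power_add mult_2_right mult_2 distrib_left distrib_right)
  finally have "(q + p) * k div q < 2 ^ word_size z" by (rule less_word) (rule z_word)
  then show "runs times_prog 2 (\<lambda>t. t ''K'' 0 = (q + p) * k div q \<and>
      (\<forall>y. y \<notin> {''a'', ''R'', ''Q'', ''K'', ''i'', ''j''} \<longrightarrow> t y = input_store n E k p q y))
    (input_store n E k p q)"
    by (intro runs_mono[OF runs_times[OF input_bounded]]) (auto simp: input_store_def)
qed simp

lemma run_power:
  assumes k: "1 \<le> k"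
  shows "\<exists>T t. exec (Seq power_prog core_prog) (input_store n E k p q) T t \<and>
    T \<le> (power_time z + core_time z (z * z + 1) + 1) * word_bound.unit (word_size z) \<and>
    best n adj (power_bound k (min (k * p div q) k)) {(v, t, u). v < n \<and> t < k * k + 1 \<and> u < n} t"
proof (rule run_from_input)
  interpret word_bound "word_size z" by (rule word_bound_size)
  have "k ^ (2 * k) \<le> (2 ^ z) ^ (2 * k)" using sizes(6) by (intro power_mono) auto
  also have "\<dots> \<le> (2 ^ z) ^ (2 * z)" using sizes by (intro power_increasing) auto
  also have "\<dots> = 2 ^ (2 * (z * z))" by (simp add: power_mult[symmetric] mult_ac)
  finally have b1: "k ^ (2 * k) < 2 ^ word_size z" by (rule less_word) (rule z_word)
  have "2 * k \<le> 2 * 2 ^ z" using sizes(6) by (rule mult_le_mono2)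
  also have "\<dots> = 2 ^ (z + 1)" by simp
  finally have b2: "2 * k < 2 ^ word_size z" using z_word(4) by (intro less_word[of _ "z + 1"]) auto
  show "runs power_prog (power_time k) (\<lambda>t. t ''K'' 0 = power_bound k (min (k * p div q) k) \<and>
      (\<forall>y. y \<notin> {''a'', ''R'', ''Q'', ''K'', ''i'', ''j''} \<longrightarrow> t y = input_store n E k p q y))
    (input_store n E k p q)"
    by (rule runs_power[OF refl input_bounded _ _ _ _ k b1 b2]) (auto simp: input_store_def)
  show "power_time k \<le> power_time z"
    unfolding power_time_def using sizes(3) by (intro add_mono mult_le_mono order_refl)
qed

end

text \<open>Raising to the k-th power is monotone on nonnegative reals and turns the fractional
  exponent into the integer k + m.\<close>

lemma power_bound_iff_powr:
  assumes k: "1 \<le> k" and m: "m \<le> k"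
  shows "x \<le> power_bound k m \<longleftrightarrow> real x \<le> real k powr (1 + real m / real k)"
proof -
  have "(real k powr (1 + real m / real k)) ^ k = real k powr (real (k + m))"
    using k by (simp add: powr_powr[symmetric] powr_realpow[symmetric] powr_powr distrib_right)
  also have "\<dots> = real (k ^ (k + m))" using k powr_realpow[of "real k" "k + m"] by simp
  finally have "x ^ k \<le> k ^ (k + m) \<longleftrightarrow> real x ^ k \<le> (real k powr (1 + real m / real k)) ^ k"
    by (metis of_nat_le_iff of_nat_power)
  also have "\<dots> \<longleftrightarrow> real x \<le> real k powr (1 + real m / real k)"
    using k by (intro power_mono_iff) auto
  finally show ?thesis using le_power_bound_iff[OF k m] by simp
qed

end

text \<open>This is ln y <= y - 1 at y = 1 / (1 + x). It exchanges ln (1 + \<epsilon>) for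
  \<epsilon> in the second part of the theorem, and x = 1 gives ln 2 >= 1 / 2.\<close>

lemma half_le_ln_one_plus:
  fixes x :: real
  assumes "0 \<le> x" "x \<le> 1"
  shows "x / 2 \<le> ln (1 + x)"
proof -
  have "ln (1 / (1 + x)) \<le> 1 / (1 + x) - 1" using assms by (intro ln_le_minus_one) auto
  moreover have "ln (1 / (1 + x)) = - ln (1 + x)" using assms by (simp add: ln_div)
  moreover have "1 / (1 + x) - 1 \<le> - (x / 2)"
    using assms mult_right_mono[of x 1 x] by (simp add: field_simps)
  ultimately show ?thesis by linarith
qed

lemma ln_ge_half: "2 \<le> k \<Longrightarrow> 1 / 2 \<le> ln (real k)"
proof -
  assume "2 \<le> k"
  then have "ln 2 \<le> ln (real k)" by simp
  then show ?thesis using half_le_ln_one_plus[of 1] by simp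
qed

text \<open>Here l = (m / k) ln k, so the ln k in \<open>output_conductance\<close> cancels.
  Replacing m / k by \<epsilon> costs the factor 2 * max 1 \<epsilon>max, which turns 176 into 352
  times the maximum.\<close>

lemma (in input_graph) power_guarantee:
  fixes \<epsilon> \<epsilon>max :: real and p q k :: nat
  assumes S_def: "S = output_set n t" and m_def: "m = min (k * p div q) k"
    and k: "1 \<le> k" "k \<le> card E" and ne: "small_sets {..<n} E k \<noteq> {}"
    and q: "0 < q" and e: "\<epsilon> = real p / real q" "1 / real k < \<epsilon>" "\<epsilon> \<le> \<epsilon>max"
    and best: "best n adj (power_bound k m) {(v, t, u). v < n \<and> t < k * k + 1 \<and> u < n} t"
  shows "S \<noteq> {}"
    and "conductance E S \<le> sqrt (352 * max 1 \<epsilon>max) * sqrt (small_conductance {..<n} E k / \<epsilon>)"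
    and "real (vol E S) \<le> real k powr (1 + \<epsilon>)"
proof -
  let ?K = "power_bound k m" and ?e = "real m / real k" and ?M = "max 1 \<epsilon>max"
  let ?\<theta> = "small_conductance {..<n} E k"
  have mk: "m \<le> k" by (simp add: m_def)
  have e0: "0 < \<epsilon>" using e(2) k by (smt (verit) divide_nonneg_nonneg of_nat_0_le_iff)
  have ke: "real k * \<epsilon> = real (k * p) / real q" by (simp add: e)
  have fl: "real (k * p div q) \<le> real k * \<epsilon>" "real k * \<epsilon> < real (k * p div q) + 1"
  proof -
    have "real (k * p) = real (k * p div q) * real q + real (k * p mod q)"
      unfolding of_nat_mult[symmetric] of_nat_add[symmetric] by simp
    moreover have "real (k * p mod q) < real q" using q by simp
    ultimately show "real (k * p div q) \<le> real k * \<epsilon>" "real k * \<epsilon> < real (k * p div q) + 1"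
      unfolding ke using q by (auto simp: field_simps)
  qed
  have "1 < real k * \<epsilon>" using e(2) k by (simp add: field_simps)
  then have "1 \<le> k * p div q" using fl by linarith
  then have m1: "1 \<le> m" using k by (simp add: m_def)
  have "real m \<le> real (k * p div q)" by (simp add: m_def)
  then have "real m \<le> real k * \<epsilon>" using fl(1) by linarith
  then have ee: "?e \<le> \<epsilon>" using k by (simp add: field_simps)
  \<comment> \<open>If the cap at \<open>k\<close> is active, then m / k = 1 and \<epsilon> <=
    \<epsilon>max. Otherwise m >= 1 absorbs the rounding: k \<epsilon> < m + 1 <= 2 m.\<close>
  have eM: "\<epsilon> \<le> 2 * ?M * ?e"
  proof (cases "k \<le> k * p div q")
    case True
    then have "?e = 1" using k by (simp add: m_def)
    then show ?thesis using e by auto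
  next
    case False
    then have "m = k * p div q" by (simp add: m_def)
    then have "real k * \<epsilon> \<le> 2 * real m" using fl(2) m1 by linarith
    then have "\<epsilon> \<le> 2 * ?e" using k by (simp add: field_simps)
    also have "\<dots> \<le> ?M * (2 * ?e)" using mult_right_mono[of 1 ?M "2 * ?e"] by simp
    finally show ?thesis by (simp add: mult_ac)
  qed
  have "real k powr 1 \<le> real k powr (1 + ?e)" using k by (intro powr_mono) auto
  then have kK: "k \<le> ?K" unfolding power_bound_iff_powr[OF k(1) mk] using k by simp
  note basic = output_basic[OF k(2) kK ne _ best]
  show "S \<noteq> {}" using basic by (simp add: S_def)
  have "real (vol E S) \<le> real k powr (1 + ?e)"
    using basic(2) power_bound_iff_powr[OF k(1) mk] by (simp add: S_def)
  also have "\<dots> \<le> real k powr (1 + \<epsilon>)" using ee k by (intro powr_mono) auto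
  finally show "real (vol E S) \<le> real k powr (1 + \<epsilon>)" .
  obtain S' where S': "S' \<subseteq> {..<n}" "S' \<noteq> {}" "vol E S' \<le> k" "?\<theta> = conductance E S'"
    using small_conductance_attained[OF ne] by (auto simp: small_sets_def)
  have cut1: "1 \<le> cut S'" using cut_ge_1[OF S'(1,2)] S'(3) k by simp
  have th0: "0 \<le> ?\<theta>" by (simp add: S'(4) conductance_def)
  have key: "(conductance E S)\<^sup>2 \<le> 352 * ?M * (?\<theta> / \<epsilon>)"
  proof (cases "k = 1")
    case True
    have "wvol S' \<le> 1" "1 \<le> wvol S'" using S'(3) True cut1 cut_le_wvol[OF S'(1)] by (auto simp: wvol_eq)
    then have "1 \<le> ?\<theta>" using cut1 by (simp add: S'(4) conductance_eq[OF S'(1)])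
    have "\<epsilon> \<le> 352 * ?M" using e(3) by simp
    then have M: "1 \<le> 352 * ?M * (1 / \<epsilon>)" using e0 by simp
    have "(conductance E S)\<^sup>2 \<le> 1" using basic(3,4) by (simp add: S_def power_le_one)
    also note M
    also have "352 * ?M * (1 / \<epsilon>) \<le> 352 * ?M * (?\<theta> / \<epsilon>)"
      using \<open>1 \<le> ?\<theta>\<close> e0 by (intro mult_left_mono divide_right_mono) auto
    finally show ?thesis .
  next
    case False
    then have k2: "2 \<le> k" using k by simp
    have ln: "1 / 2 \<le> ln (real k)" by (rule ln_ge_half[OF k2])
    have l: "ln (real k powr (1 + ?e) / real k) = ?e * ln (real k)"
      using k by (simp add: powr_add ln_powr)
    have e1: "1 / real k \<le> ?e" "?e \<le> 1" using m1 mk k by (simp_all add: divide_right_mono)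
    have "(conductance E S)\<^sup>2 \<le> 176 * ?\<theta> * ln (real k) / (?e * ln (real k))"
      unfolding S_def l[symmetric]
    proof (rule output_conductance[OF k(2) kK ne _ best k2])
      show "k * k < k * k + 1" by simp
      show "0 < real k powr (1 + ?e)" using k by simp
      show "x \<le> ?K" if "real x \<le> real k powr (1 + ?e)" for x
        using that power_bound_iff_powr[OF k(1) mk] by simp
      have "1 / (4 * real k) \<le> 1 / real k * (1 / 2)" using k by (simp add: field_simps)
      also have "\<dots> \<le> ?e * ln (real k)" using e1 ln by (intro mult_mono) auto
      finally show "1 / (4 * real k) \<le> ln (real k powr (1 + ?e) / real k)" by (simp add: l)
      show "ln (real k powr (1 + ?e) / real k) \<le> ln (real k)"
        unfolding l using e1 ln by (intro mult_left_le_one_le) auto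
    qed
    also have "\<dots> = 176 * ?\<theta> * (1 / ?e)" using ln by simp
    also have "\<dots> \<le> 176 * ?\<theta> * (2 * ?M / \<epsilon>)"
    proof (intro mult_left_mono)
      show "1 / ?e \<le> 2 * ?M / \<epsilon>" using eM e0 m1 k by (simp add: field_simps)
    qed (use th0 in simp)
    finally show ?thesis by (simp add: mult_ac)
  qed
  then have "conductance E S \<le> sqrt (352 * ?M * (?\<theta> / \<epsilon>))" by (rule real_le_rsqrt)
  then show "conductance E S \<le> sqrt (352 * ?M) * sqrt (?\<theta> / \<epsilon>)" by (simp only: real_sqrt_mult)
qed

text \<open>Now l = ln (1 + min \<epsilon> 1) is of the order of \<epsilon> itself, so the factor ln
  k survives. The minimum keeps l at most ln 2 <= ln k and costs the factor max 1 \<epsilon>max, and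
  \<open>half_le_ln_one_plus\<close> costs the factor 2. Since 2 ln k >= 1, the assumption on
  \<epsilon> gives \<epsilon> > 1 / k and thus the lower bound on l.\<close>

lemma (in input_graph) times_guarantee:
  fixes \<epsilon> \<epsilon>max :: real and p q k :: nat
  assumes S_def: "S = output_set n t"
    and k: "2 \<le> k" "k \<le> card E" and ne: "small_sets {..<n} E k \<noteq> {}"
    and q: "0 < q" and e: "\<epsilon> = real p / real q" "2 * ln (real k) / real k < \<epsilon>" "\<epsilon> \<le> \<epsilon>max"
    and best: "best n adj ((q + p) * k div q) {(v, t, u). v < n \<and> t < k * k + 1 \<and> u < n} t"
  shows "S \<noteq> {}"
    and "conductance E S \<le> sqrt (352 * max 1 \<epsilon>max) * sqrt (small_conductance {..<n} E k * ln (real k) / \<epsilon>)"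
    and "real (vol E S) \<le> (1 + \<epsilon>) * real k"
proof -
  let ?K = "(q + p) * k div q" and ?M = "max 1 \<epsilon>max" and ?e = "min \<epsilon> 1"
  let ?\<theta> = "small_conductance {..<n} E k"
  have ln: "1 / 2 \<le> ln (real k)" by (rule ln_ge_half[OF k(1)])
  have "1 / real k \<le> 2 * ln (real k) / real k" using ln by (intro divide_right_mono) auto
  then have ek: "1 / real k < \<epsilon>" using e(2) by linarith
  have e0: "0 < \<epsilon>" using ek k by (smt (verit) divide_nonneg_nonneg of_nat_0_le_iff)
  have K_iff: "x \<le> ?K \<longleftrightarrow> real x \<le> (1 + \<epsilon>) * real k" for x
  proof -
    have "x \<le> ?K \<longleftrightarrow> x * q \<le> (q + p) * k" using q by (simp add: less_eq_div_iff_mult_less_eq)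
    also have "\<dots> \<longleftrightarrow> real x * real q \<le> (real q + real p) * real k"
      by (metis of_nat_add of_nat_le_iff of_nat_mult)
    also have "\<dots> \<longleftrightarrow> real x \<le> (1 + \<epsilon>) * real k" using q by (simp add: e(1) field_simps)
    finally show ?thesis .
  qed
  have kK: "k \<le> ?K" unfolding K_iff using e0 by (simp add: algebra_simps)
  note basic = output_basic[OF k(2) kK ne _ best]
  show "S \<noteq> {}" using basic by (simp add: S_def)
  show "real (vol E S) \<le> (1 + \<epsilon>) * real k" using basic(2) K_iff by (simp add: S_def)
  have th0: "0 \<le> ?\<theta>"
    using small_conductance_attained[OF ne] by (auto simp: conductance_def)
  let ?l = "ln (1 + ?e)"
  have le: "?e / 2 \<le> ?l" using e0 by (intro half_le_ln_one_plus) auto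
  have l: "ln ((1 + ?e) * real k / real k) = ?l" using k by simp
  have "(conductance E S)\<^sup>2 \<le> 176 * ?\<theta> * ln (real k) / ?l"
    unfolding S_def l[symmetric]
  proof (rule output_conductance[OF k(2) kK ne _ best k(1)])
    show "k * k < k * k + 1" by simp
    show "0 < (1 + ?e) * real k" using k e0 by (intro mult_pos_pos) auto
    show "x \<le> ?K" if "real x \<le> (1 + ?e) * real k" for x
    proof -
      have "(1 + ?e) * real k \<le> (1 + \<epsilon>) * real k" by (intro mult_right_mono) auto
      then show ?thesis using that K_iff by simp
    qed
    have "1 / real k \<le> ?e" using ek k by simp
    then have "1 / real k / 2 \<le> ?e / 2" by (rule divide_right_mono) simp
    then have "1 / real k / 2 \<le> ?l" using le by (rule order_trans)
    then have "1 / (2 * real k) \<le> ?l" by simp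
    moreover have "1 / (4 * real k) \<le> 1 / (2 * real k)" using k by (simp add: field_simps)
    ultimately have "1 / (4 * real k) \<le> ?l" by linarith
    then show "1 / (4 * real k) \<le> ln ((1 + ?e) * real k / real k)" by (simp only: l)
    show "ln ((1 + ?e) * real k / real k) \<le> ln (real k)" unfolding l using k e0 by simp
  qed
  also have "\<dots> \<le> 176 * ?\<theta> * ln (real k) * (2 * ?M / \<epsilon>)"
  proof -
    have "\<epsilon> \<le> ?M * ?e"
    proof (cases "\<epsilon> \<le> 1")
      case True
      then show ?thesis using mult_right_mono[of 1 ?M \<epsilon>] e0 by simp
    qed (use e in auto)
    also have "\<dots> \<le> ?M * (2 * ?l)" using le by (intro mult_left_mono) auto
    finally have "\<epsilon> \<le> 2 * ?M * ?l" by simp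
    moreover have "0 < ?l" using e0 by simp
    ultimately have "1 / ?l \<le> 2 * ?M / \<epsilon>" using e0 by (simp add: field_simps)
    then have "176 * ?\<theta> * ln (real k) * (1 / ?l) \<le> 176 * ?\<theta> * ln (real k) * (2 * ?M / \<epsilon>)"
      using th0 ln by (intro mult_left_mono) auto
    then show ?thesis by simp
  qed
  finally have "(conductance E S)\<^sup>2 \<le> 352 * ?M * (?\<theta> * ln (real k) / \<epsilon>)" by (simp add: mult_ac)
  then have "conductance E S \<le> sqrt (352 * ?M * (?\<theta> * ln (real k) / \<epsilon>))" by (rule real_le_rsqrt)
  then show "conductance E S \<le> sqrt (352 * ?M) * sqrt (?\<theta> * ln (real k) / \<epsilon>)"
    by (simp only: real_sqrt_mult)
qed

lemma poly_bounded_time: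
  assumes "poly_bounded f"
  shows "poly_bounded (\<lambda>z. (f z + core_time z (z * z + 1) + 1) * word_bound.unit (word_size z))"
proof -
  have u: "word_bound.unit (word_size z) = 1 + 100 * (1 + 2 * (word_size z * 100))" for z
    by (rule word_bound.unit_def) (unfold_locales, simp add: word_size_def)
  show ?thesis
    unfolding u
    unfolding core_time_def walk_time_def step_time_def sweep_time_def word_size_def
    by (intro poly_bounded_intros assms)
qed

theorem theorem1:
  shows
    "(\<exists>(A :: prog) (P :: nat poly). \<forall>\<epsilon>max :: real. \<exists>C :: real.
        \<forall>(n :: nat) (E :: nat set set) (k :: nat) (p :: nat) (q :: nat) (\<epsilon> :: real).
          simple_graph {..<n} E \<and> connected_graph {..<n} E \<and>
          1 \<le> k \<and> k \<le> card E \<and> small_sets {..<n} E k \<noteq> {} \<and>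
          0 < q \<and> \<epsilon> = real p / real q \<and> 1 / real k < \<epsilon> \<and> \<epsilon> \<le> \<epsilon>max \<longrightarrow>
          (\<exists>T t S.
             exec A (input_store n E k p q) T t \<and>
             T \<le> poly P (input_size n k p q) \<and>
             S = output_set n t \<and> S \<noteq> {} \<and>
             conductance E S \<le> C * sqrt (small_conductance {..<n} E k / \<epsilon>) \<and>
             real (vol E S) \<le> real k powr (1 + \<epsilon>)))
     \<and>
     (\<exists>(A :: prog) (P :: nat poly). \<forall>\<epsilon>max :: real. \<exists>C :: real.
        \<forall>(n :: nat) (E :: nat set set) (k :: nat) (p :: nat) (q :: nat) (\<epsilon> :: real).
          simple_graph {..<n} E \<and> connected_graph {..<n} E \<and>
          2 \<le> k \<and> k \<le> card E \<and> small_sets {..<n} E k \<noteq> {} \<and>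
          0 < q \<and> \<epsilon> = real p / real q \<and> 2 * ln (real k) / real k < \<epsilon> \<and> \<epsilon> \<le> \<epsilon>max \<longrightarrow>
          (\<exists>T t S.
             exec A (input_store n E k p q) T t \<and>
             T \<le> poly P (input_size n k p q) \<and>
             S = output_set n t \<and> S \<noteq> {} \<and>
             conductance E S \<le> C * sqrt (small_conductance {..<n} E k * ln (real k) / \<epsilon>) \<and>
             real (vol E S) \<le> (1 + \<epsilon>) * real k))"
proof (rule conjI, goal_cases)
  case 1
  have "poly_bounded power_time" unfolding power_time_def by (intro poly_bounded_intros)
  from poly_bounded_time[OF this] obtain P :: "nat poly" where P: "(power_time z + core_time z (z * z + 1) + 1) *
      word_bound.unit (word_size z) \<le> poly P z" for z
    unfolding poly_bounded_def by blast
  show ?case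
  proof (intro exI[of _ "Seq power_prog core_prog"] exI[of _ P] allI, goal_cases)
    case (1 \<epsilon>max)
    show ?case
    proof (intro exI[of _ "sqrt (352 * max 1 \<epsilon>max)"] allI impI, elim conjE, goal_cases)
      case (1 n E k p q \<epsilon>)
      then have "E \<noteq> {}" by auto
      then interpret input_graph n E using 1 by unfold_locales
      obtain T t where run: "exec (Seq power_prog core_prog) (input_store n E k p q) T t"
        and T: "T \<le> (power_time z + core_time z (z * z + 1) + 1) * word_bound.unit (word_size z)"
        and best: "best n adj (power_bound k (min (k * p div q) k)) {(v, t, u). v < n \<and> t < k * k + 1 \<and> u < n} t"
        if "z = input_size n k p q" for z
        using run_power[OF \<open>k \<le> card E\<close> refl \<open>1 \<le> k\<close>, of p q] by blast
      note g = power_guarantee[OF refl refl \<open>1 \<le> k\<close> \<open>k \<le> card E\<close> \<open>small_sets {..<n} E k \<noteq> {}\<close>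
          \<open>0 < q\<close> \<open>\<epsilon> = real p / real q\<close> \<open>1 / real k < \<epsilon>\<close> \<open>\<epsilon> \<le> \<epsilon>max\<close> best[OF refl]]
      show ?case using run[OF refl] T[OF refl] P[of "input_size n k p q"] g by (meson le_trans)
    qed
  qed
next
  case 2
  have "poly_bounded (\<lambda>z. 2)" by (intro poly_bounded_intros)
  from poly_bounded_time[OF this] obtain P :: "nat poly" where P: "(2 + core_time z (z * z + 1) + 1) *
      word_bound.unit (word_size z) \<le> poly P z" for z
    unfolding poly_bounded_def by blast
  show ?case
  proof (intro exI[of _ "Seq times_prog core_prog"] exI[of _ P] allI, goal_cases)
    case (1 \<epsilon>max)
    show ?case
    proof (intro exI[of _ "sqrt (352 * max 1 \<epsilon>max)"] allI impI, elim conjE, goal_cases)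
      case (1 n E k p q \<epsilon>)
      then have "E \<noteq> {}" by auto
      then interpret input_graph n E using 1 by unfold_locales
      obtain T t where run: "exec (Seq times_prog core_prog) (input_store n E k p q) T t"
        and T: "T \<le> (2 + core_time z (z * z + 1) + 1) * word_bound.unit (word_size z)"
        and best: "best n adj ((q + p) * k div q) {(v, t, u). v < n \<and> t < k * k + 1 \<and> u < n} t"
        if "z = input_size n k p q" for z
        using run_times[OF \<open>k \<le> card E\<close> refl, of p q] by blast
      note g = times_guarantee[OF refl \<open>2 \<le> k\<close> \<open>k \<le> card E\<close> \<open>small_sets {..<n} E k \<noteq> {}\<close>
          \<open>0 < q\<close> \<open>\<epsilon> = real p / real q\<close> \<open>2 * ln (real k) / real k < \<epsilon>\<close> \<open>\<epsilon> \<le> \<epsilon>max\<close> best[OF refl]]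
      show ?case using run[OF refl] T[OF refl] P[of "input_size n k p q"] g by (meson le_trans)
    qed
  qed
qed

end
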